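(* Let $D=\{L_1,\dots,L_a\}$ be an arrangement of $a$ lines on $X$ with $L_i\in|\mathcal O_X(f)|$. If $a\ge e+1$, then $$\Omega_X^1(\log D)\cong\mathcal O_X((a-2)f)\oplus\mathcal O_X(-2H+cf).$$
   Context: The base field is algebraically closed of characteristic $0$. Let $0<a_0\le a_1$ be integers, $\mathcal E=\mathcal O_{\mathbf P^1}(a_0)\oplus\mathcal O_{\mathbf P^1}(a_1)$, and let $X=S(a_0,a_1)$ be the smooth rational normal scroll surface, i.e. the image of $\mathbf P(\mathcal E)$ under the embedding given by $\mathcal O_{\mathbf P(\mathcal E)}(1)$; let $\pi:X\cong\mathbf P(\mathcal E)\to\mathbf P^1$ be the projection. $H$ is the class of $\mathcal O_{\mathbf P(\mathcal E)}(1)$ (hyperplane class) and $f$ the class of $\pi^*\mathcal O_{\mathbf P^1}(1)$ (fibre class); $\mathrm{Pic}(X)=\mathbf Z\langle H,f\rangle$. Put $c=a_0+a_1$ and $e=a_1-a_0$. An arrangement on $X$ is a finite set $D=\{D_1,\dots,D_m\}$ of smooth irreducible divisors of $X$ with $D_i\ne D_j$ for $i\neq j$. $\Omega_X^1(\log D)$ denotes the logarithmic sheaf of $D$, i.e. the sheaf of differential $1$-forms with logarithmic poles along $\bigcup_i D_i$; when $D$ has simple normal crossings it is locally free and fits into the residue sequence $0\to\Omega_X^1\to\Omega_X^1(\log D)\to\bigoplus_i\mathcal O_{D_i}\to0$. *)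

theory Defs
  imports "HOL-Analysis.Abstract_Topology" "HOL-Computational_Algebra.Polynomial"
begin

section \<open>Varieties as spaces with functions\<close>

text \<open>
  A variety over \<open>'k\<close> is given by its closed points with the Zariski topology and its sheaf of
  regular functions. \<open>reg X U f\<close> says that \<open>f\<close> is regular on the open set \<open>U\<close>; only the values
  of \<open>f\<close> on \<open>U\<close> are relevant.
\<close>

record ('p, 'k) fspace =
  zar :: "'p topology"
  reg :: "'p set \<Rightarrow> ('p \<Rightarrow> 'k) \<Rightarrow> bool"

definition regular_at :: "('p, 'k) fspace \<Rightarrow> 'p \<Rightarrow> ('p \<Rightarrow> 'k) \<Rightarrow> bool" where
  "regular_at X p f \<longleftrightarrow> (\<exists>U. openin (zar X) U \<and> p \<in> U \<and> reg X U f)"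

section \<open>Subvarieties of projective space\<close>

inductive form :: "nat \<Rightarrow> nat \<Rightarrow> ((nat \<Rightarrow> 'k::field) \<Rightarrow> 'k) \<Rightarrow> bool" for n :: nat where
  form_const: "form n 0 (\<lambda>x. c)"
| form_coord: "i \<le> n \<Longrightarrow> form n 1 (\<lambda>x. x i)"
| form_add: "form n d F \<Longrightarrow> form n d G \<Longrightarrow> form n d (\<lambda>x. F x + G x)"
| form_mult: "form n d F \<Longrightarrow> form n d' G \<Longrightarrow> form n (d + d') (\<lambda>x. F x * G x)"

text \<open>
  Vectors of \<open>k\<^sup>n\<^sup>+\<^sup>1\<close> are functions on \<open>nat\<close> vanishing beyond \<open>n\<close>. A point of projective space is
  the set of all its homogeneous coordinate vectors, i.e. a line through the origin without the
  origin.
\<close>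

definition nonzero_vecs :: "nat \<Rightarrow> (nat \<Rightarrow> 'k::field) set" where
  "nonzero_vecs n = {x. (\<forall>i>n. x i = 0) \<and> (\<exists>i. x i \<noteq> 0)}"

definition pt :: "(nat \<Rightarrow> 'k::field) \<Rightarrow> (nat \<Rightarrow> 'k) set" where
  "pt x = {\<lambda>i. c * x i | c. c \<noteq> 0}"

definition proj_line :: "nat \<Rightarrow> (nat \<Rightarrow> 'k::field) set set \<Rightarrow> bool" where
  "proj_line n L \<longleftrightarrow>
     (\<exists>a b. a \<in> nonzero_vecs n \<and> b \<in> nonzero_vecs n \<and> pt a \<noteq> pt b \<and>
            L = {pt (\<lambda>i. s * a i + t * b i) | s t. (s, t) \<noteq> (0, 0)})"

text \<open>
  The reduced structure induced on a subset \<open>S\<close> of projective space: the topology is generated by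
  the complements of hypersurfaces, and regular functions are locally quotients of forms of equal
  degree.
\<close>

definition proj_variety ::
    "nat \<Rightarrow> (nat \<Rightarrow> 'k::field) set set \<Rightarrow> ((nat \<Rightarrow> 'k) set, 'k) fspace" where
  "proj_variety n S =
     (let T = topology_generated_by {{P \<in> S. \<forall>x\<in>P. F x \<noteq> 0} | F. \<exists>d. form n d F}
      in \<lparr> zar = T,
           reg = (\<lambda>U f. \<forall>P\<in>U. \<exists>V d F G. openin T V \<and> P \<in> V \<and> V \<subseteq> U \<and> form n d F \<and> form n d G \<and>
                          (\<forall>Q\<in>V. \<forall>x\<in>Q. G x \<noteq> 0 \<and> f Q = F x / G x)) \<rparr>)"

section \<open>Sheaves of modules over the structure sheaf\<close>

text \<open>
  \<open>sec F U\<close> are the sections over \<open>U\<close>. In all sheaves below sections are functions (or pairs of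
  functions), extended by zero outside their domain so that equality of sections is equality in
  HOL; hence addition, the action of regular functions and restriction \<open>res F W\<close> to the smaller
  open set \<open>W\<close> are given by operations that do not depend on the domain.
\<close>

record ('p, 'k, 'm) mod_sheaf =
  sec :: "'p set \<Rightarrow> 'm set"
  add :: "'m \<Rightarrow> 'm \<Rightarrow> 'm"
  act :: "('p \<Rightarrow> 'k) \<Rightarrow> 'm \<Rightarrow> 'm"
  res :: "'p set \<Rightarrow> 'm \<Rightarrow> 'm"

definition direct_sum ::
    "('p, 'k, 'm) mod_sheaf \<Rightarrow> ('p, 'k, 'n) mod_sheaf \<Rightarrow> ('p, 'k, 'm \<times> 'n) mod_sheaf" where
  "direct_sum F G =
     \<lparr> sec = (\<lambda>U. sec F U \<times> sec G U),
       add = (\<lambda>s t. (add F (fst s) (fst t), add G (snd s) (snd t))),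
       act = (\<lambda>g s. (act F g (fst s), act G g (snd s))),
       res = (\<lambda>W s. (res F W (fst s), res G W (snd s))) \<rparr>"

definition sheaf_isomorphic ::
    "('p, 'k) fspace \<Rightarrow> ('p, 'k, 'm) mod_sheaf \<Rightarrow> ('p, 'k, 'n) mod_sheaf \<Rightarrow> bool" where
  "sheaf_isomorphic X F G \<longleftrightarrow>
     (\<exists>\<Phi>. \<forall>U. openin (zar X) U \<longrightarrow>
        bij_betw (\<Phi> U) (sec F U) (sec G U) \<and>
        (\<forall>s\<in>sec F U. \<forall>t\<in>sec F U. \<Phi> U (add F s t) = add G (\<Phi> U s) (\<Phi> U t)) \<and>
        (\<forall>g. reg X U g \<longrightarrow> (\<forall>s\<in>sec F U. \<Phi> U (act F g s) = act G g (\<Phi> U s))) \<and>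
        (\<forall>W. openin (zar X) W \<and> W \<subseteq> U \<longrightarrow>
           (\<forall>s\<in>sec F U. \<Phi> W (res F W s) = res G W (\<Phi> U s))))"

text \<open>A local frame \<open>e\<close> of an invertible sheaf \<open>L\<close> over \<open>V\<close>: \<open>g \<mapsto> g e\<close> identifies \<open>O\<close> with \<open>L\<close> on \<open>V\<close>.\<close>

definition local_frame ::
    "('p, 'k) fspace \<Rightarrow> ('p, 'k, 'm) mod_sheaf \<Rightarrow> 'p set \<Rightarrow> 'm \<Rightarrow> bool" where
  "local_frame X L V e \<longleftrightarrow>
     openin (zar X) V \<and> e \<in> sec L V \<and>
     (\<forall>W. openin (zar X) W \<and> W \<subseteq> V \<longrightarrow>
        (\<forall>s\<in>sec L W. \<exists>g. reg X W g \<and> s = act L g (res L W e)) \<and>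
        (\<forall>g g'. reg X W g \<and> reg X W g' \<and> act L g (res L W e) = act L g' (res L W e) \<longrightarrow>
                (\<forall>q\<in>W. g q = g' q)))"

section \<open>Differential forms\<close>

text \<open>
  A tangent vector at \<open>p\<close> is a \<open>k\<close>-linear derivation from the local ring at \<open>p\<close> to its residue
  field \<open>k\<close>, encoded as a functional on all functions that depends only on germs and is zero on
  functions not regular at \<open>p\<close>.
\<close>

type_synonym ('p, 'k) tvec = "('p \<Rightarrow> 'k) \<Rightarrow> 'k"

definition tangent :: "('p, 'k::field) fspace \<Rightarrow> 'p \<Rightarrow> ('p, 'k) tvec \<Rightarrow> bool" where
  "tangent X p v \<longleftrightarrow>
     (\<forall>f. \<not> regular_at X p f \<longrightarrow> v f = 0) \<and>
     (\<forall>f g. regular_at X p f \<and> regular_at X p g \<longrightarrow>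
        v (\<lambda>x. f x + g x) = v f + v g \<and>
        v (\<lambda>x. f x * g x) = f p * v g + g p * v f) \<and>
     (\<forall>c f. regular_at X p f \<longrightarrow> v (\<lambda>x. c * f x) = c * v f) \<and>
     (\<forall>U f g. openin (zar X) U \<and> p \<in> U \<and> regular_at X p f \<and> (\<forall>x\<in>U. f x = g x) \<longrightarrow> v f = v g)"

text \<open>
  On a smooth variety a regular 1-form is a field of cotangent vectors that is locally
  \<open>\<Sum> g\<^sub>i df\<^sub>i\<close> with regular \<open>g\<^sub>i, f\<^sub>i\<close>, where \<open>df(v) = v(f)\<close>; similarly for
  2-forms, with \<open>(df \<and> dh)(v, w) = v(f) w(h) - w(f) v(h)\<close>. Only the values at
  points of \<open>U\<close> and on tangent vectors matter here.
\<close>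

type_synonym ('p, 'k) form1 = "'p \<Rightarrow> ('p, 'k) tvec \<Rightarrow> 'k"
type_synonym ('p, 'k) form2 = "'p \<Rightarrow> ('p, 'k) tvec \<Rightarrow> ('p, 'k) tvec \<Rightarrow> 'k"

definition regular_1form :: "('p, 'k::field) fspace \<Rightarrow> 'p set \<Rightarrow> ('p, 'k) form1 \<Rightarrow> bool" where
  "regular_1form X U \<omega> \<longleftrightarrow>
     (\<forall>p\<in>U. \<exists>V (n::nat) g f. openin (zar X) V \<and> p \<in> V \<and> V \<subseteq> U \<and>
        (\<forall>i<n. reg X V (g i) \<and> reg X V (f i)) \<and>
        (\<forall>q\<in>V. \<forall>v. tangent X q v \<longrightarrow> \<omega> q v = (\<Sum>i<n. g i q * v (f i))))"

definition regular_2form :: "('p, 'k::field) fspace \<Rightarrow> 'p set \<Rightarrow> ('p, 'k) form2 \<Rightarrow> bool" where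
  "regular_2form X U \<tau> \<longleftrightarrow>
     (\<forall>p\<in>U. \<exists>V (n::nat) g f h. openin (zar X) V \<and> p \<in> V \<and> V \<subseteq> U \<and>
        (\<forall>i<n. reg X V (g i) \<and> reg X V (f i) \<and> reg X V (h i)) \<and>
        (\<forall>q\<in>V. \<forall>v w. tangent X q v \<and> tangent X q w \<longrightarrow>
           \<tau> q v w = (\<Sum>i<n. g i q * (v (f i) * w (h i) - w (f i) * v (h i)))))"

text \<open>\<open>exterior_derivative X U \<omega> \<sigma>\<close>: locally \<open>\<omega> = \<Sum> g\<^sub>i df\<^sub>i\<close> and \<open>\<sigma> = \<Sum> dg\<^sub>i \<and> df\<^sub>i\<close>, i.e. \<open>d\<omega> = \<sigma>\<close>.\<close>

definition exterior_derivative ::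
    "('p, 'k::field) fspace \<Rightarrow> 'p set \<Rightarrow> ('p, 'k) form1 \<Rightarrow> ('p, 'k) form2 \<Rightarrow> bool" where
  "exterior_derivative X U \<omega> \<sigma> \<longleftrightarrow>
     (\<forall>p\<in>U. \<exists>V (n::nat) g f. openin (zar X) V \<and> p \<in> V \<and> V \<subseteq> U \<and>
        (\<forall>i<n. reg X V (g i) \<and> reg X V (f i)) \<and>
        (\<forall>q\<in>V. \<forall>v. tangent X q v \<longrightarrow> \<omega> q v = (\<Sum>i<n. g i q * v (f i))) \<and>
        (\<forall>q\<in>V. \<forall>v w. tangent X q v \<and> tangent X q w \<longrightarrow>
           \<sigma> q v w = (\<Sum>i<n. v (g i) * w (f i) - w (g i) * v (f i))))"

section \<open>Divisors, linear systems and logarithmic forms\<close>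

text \<open>\<open>h\<close> generates the ideal of functions vanishing on \<open>Z\<close> at every point of \<open>V\<close>.\<close>

definition local_equation ::
    "('p, 'k::field) fspace \<Rightarrow> 'p set \<Rightarrow> 'p set \<Rightarrow> ('p \<Rightarrow> 'k) \<Rightarrow> bool" where
  "local_equation X Z V h \<longleftrightarrow>
     openin (zar X) V \<and> reg X V h \<and> (\<forall>x \<in> V \<inter> Z. h x = 0) \<and>
     (\<forall>q\<in>V. \<forall>W f. openin (zar X) W \<and> q \<in> W \<and> W \<subseteq> V \<and> reg X W f \<and> (\<forall>x \<in> W \<inter> Z. f x = 0) \<longrightarrow>
        (\<exists>W' g. openin (zar X) W' \<and> q \<in> W' \<and> W' \<subseteq> W \<and> reg X W' g \<and>
                (\<forall>x\<in>W'. f x = g x * h x)))"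

definition irreducible_closed :: "('p, 'k) fspace \<Rightarrow> 'p set \<Rightarrow> bool" where
  "irreducible_closed X Z \<longleftrightarrow>
     closedin (zar X) Z \<and> Z \<noteq> {} \<and>
     (\<forall>A B. closedin (zar X) A \<and> closedin (zar X) B \<and> Z \<subseteq> A \<union> B \<longrightarrow> Z \<subseteq> A \<or> Z \<subseteq> B)"

text \<open>
  A prime divisor of a smooth variety is identified with its set of points. It is smooth iff at
  each of its points it has a local equation whose differential does not vanish there; this also
  excludes that it is the whole variety.
\<close>

definition smooth_irreducible_divisor :: "('p, 'k::field) fspace \<Rightarrow> 'p set \<Rightarrow> bool" where
  "smooth_irreducible_divisor X Z \<longleftrightarrow>
     irreducible_closed X Z \<and>
     (\<forall>p\<in>Z. \<exists>V h v. p \<in> V \<and> local_equation X Z V h \<and> tangent X p v \<and> v h \<noteq> 0)"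

definition arrangement :: "('p, 'k::field) fspace \<Rightarrow> 'p set set \<Rightarrow> bool" where
  "arrangement X D \<longleftrightarrow> finite D \<and> (\<forall>Z\<in>D. smooth_irreducible_divisor X Z)"

text \<open>The prime divisors in \<open>|L|\<close>: those which are the divisor of zeros of a nonzero global section.\<close>

definition linear_system ::
    "('p, 'k::field) fspace \<Rightarrow> ('p, 'k, 'm) mod_sheaf \<Rightarrow> 'p set set" where
  "linear_system X L =
     {Z. \<exists>s \<in> sec L (topspace (zar X)). s \<noteq> act L (\<lambda>_. 0) s \<and>
           (\<forall>p \<in> topspace (zar X). \<exists>V e g. p \<in> V \<and> local_frame X L V e \<and>
              local_equation X Z V g \<and> res L V s = act L g e)}"

text \<open>
  Following Saito, a logarithmic form along the reduced divisor \<open>Z\<close> is a rational 1-form \<open>\<omega>\<close>, regular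
  outside \<open>Z\<close>, such that \<open>\<omega>\<close> and \<open>d\<omega>\<close> have at most simple poles along \<open>Z\<close>: if \<open>h\<close> is a local
  equation of \<open>Z\<close>, then \<open>h \<omega>\<close> and \<open>h d\<omega>\<close> are regular. A section is represented by its values
  on the complement of \<open>Z\<close>, which is dense.
\<close>

definition log_1forms ::
    "('p, 'k::field) fspace \<Rightarrow> 'p set \<Rightarrow> ('p, 'k, ('p, 'k) form1) mod_sheaf" where
  "log_1forms X Z =
     \<lparr> sec = (\<lambda>U. {\<omega>.
         (\<forall>p v. \<not> (p \<in> U - Z \<and> tangent X p v) \<longrightarrow> \<omega> p v = 0) \<and>
         (\<forall>p\<in>U. \<exists>V h \<eta> \<sigma> \<tau>. p \<in> V \<and> V \<subseteq> U \<and> local_equation X Z V h \<and>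
            regular_1form X V \<eta> \<and> (\<forall>q \<in> V - Z. \<forall>v. tangent X q v \<longrightarrow> \<eta> q v = h q * \<omega> q v) \<and>
            exterior_derivative X (V - Z) \<omega> \<sigma> \<and>
            regular_2form X V \<tau> \<and>
            (\<forall>q \<in> V - Z. \<forall>v w. tangent X q v \<and> tangent X q w \<longrightarrow> \<tau> q v w = h q * \<sigma> q v w))}),
       add = (\<lambda>\<omega> \<eta> p v. \<omega> p v + \<eta> p v),
       act = (\<lambda>g \<omega> p v. g p * \<omega> p v),
       res = (\<lambda>W \<omega> p v. if p \<in> W then \<omega> p v else 0) \<rparr>"

section \<open>The rational normal scroll surface\<close>

text \<open>
  A point of \<open>P(O(a0) \<oplus> O(a1))\<close> is given by homogeneous coordinates \<open>y = (s : t)\<close> of its image in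
  \<open>P\<^sup>1\<close> and \<open>z = (u : v)\<close> in the fibre. The global sections of \<open>O(1)\<close> are those of
  \<open>O(a0) \<oplus> O(a1)\<close>, with basis \<open>s\<^sup>a\<^sup>0\<^sup>-\<^sup>i t\<^sup>i u\<close> for \<open>i \<le> a0\<close> and \<open>s\<^sup>a\<^sup>1\<^sup>-\<^sup>j t\<^sup>j v\<close> for \<open>j \<le> a1\<close>.
  \<open>scroll_map\<close> is the resulting map to projective space of dimension \<open>a0 + a1 + 1\<close>.
\<close>

definition scroll_map :: "nat \<Rightarrow> nat \<Rightarrow> (nat \<Rightarrow> 'k::field) \<Rightarrow> (nat \<Rightarrow> 'k) \<Rightarrow> nat \<Rightarrow> 'k" where
  "scroll_map a0 a1 y z = (\<lambda>i.
     if i \<le> a0 then y 0 ^ (a0 - i) * y 1 ^ i * z 0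
     else if i \<le> a0 + a1 + 1 then y 0 ^ (a0 + a1 + 1 - i) * y 1 ^ (i - (a0 + 1)) * z 1
     else 0)"

definition scroll_points :: "nat \<Rightarrow> nat \<Rightarrow> (nat \<Rightarrow> 'k::field) set set" where
  "scroll_points a0 a1 = {pt (scroll_map a0 a1 y z) | y z. y \<in> nonzero_vecs 1 \<and> z \<in> nonzero_vecs 1}"

definition scroll :: "nat \<Rightarrow> nat \<Rightarrow> ((nat \<Rightarrow> 'k::field) set, 'k) fspace" where
  "scroll a0 a1 = proj_variety (a0 + a1 + 1) (scroll_points a0 a1)"

text \<open>The projection to the projective line, again as a set of homogeneous coordinate vectors.\<close>

definition scroll_proj :: "nat \<Rightarrow> nat \<Rightarrow> (nat \<Rightarrow> 'k::field) set \<Rightarrow> (nat \<Rightarrow> 'k) set" where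
  "scroll_proj a0 a1 P =
     {y \<in> nonzero_vecs 1. \<exists>z \<in> nonzero_vecs 1. scroll_map a0 a1 y z \<in> P}"

lemma rational_normal_curve_inj:
  fixes p q p' q' w w' c :: "'k::field"
  assumes n: "n > 0" and c: "c \<noteq> 0" and w: "w \<noteq> 0"
    and nz: "p \<noteq> 0 \<or> q \<noteq> 0"
    and eq: "\<And>i. i \<le> n \<Longrightarrow> p' ^ (n - i) * q' ^ i * w' = c * (p ^ (n - i) * q ^ i * w)"
  shows "p' * q = q' * p"
proof -
  obtain m where m: "n = Suc m" using n gr0_implies_Suc by blast
  have e0: "p' ^ n * w' = c * (p ^ n * w)" using eq[of 0] by simp
  have e1: "p' ^ m * q' * w' = c * (p ^ m * q * w)" using eq[of 1] m by simp
  have en: "q' ^ n * w' = c * (q ^ n * w)" using eq[of n] by simp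
  show ?thesis
  proof (cases "p = 0")
    case True
    then have "q \<noteq> 0" using nz by simp
    then have "w' \<noteq> 0" using en c w by auto
    moreover have "p' ^ n * w' = 0" using e0 True n by (simp add: power_0_left)
    ultimately have "p' = 0" by simp
    then show ?thesis using True by simp
  next
    case False
    then have nz': "w' \<noteq> 0" "p' \<noteq> 0" using e0 c w n by (auto simp: power_0_left)
    have "p' * q * (c * p ^ m * w) = p' * (c * (p ^ m * q * w))" by (simp add: algebra_simps)
    also have "\<dots> = q' * (p' ^ n * w')" unfolding e1[symmetric] m by (simp add: algebra_simps)
    also have "\<dots> = q' * p * (c * p ^ m * w)" using e0 m by (simp add: algebra_simps)
    finally show ?thesis using False c w by simp
  qed
qed

lemma scroll_proj_pt:
  assumes a: "0 < a0" "0 < a1" and y: "y \<in> nonzero_vecs 1" and z: "z \<in> nonzero_vecs 1"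
  shows "scroll_proj a0 a1 (pt (scroll_map a0 a1 y z)) = pt y"
proof (intro set_eqI iffI)
  have supp: "x i = 0" if "x \<in> nonzero_vecs 1" "i > 1" for x :: "nat \<Rightarrow> 'a" and i
    using that by (auto simp: nonzero_vecs_def)
  have nz: "x 0 \<noteq> 0 \<or> x 1 \<noteq> 0" if x: "x \<in> nonzero_vecs 1" for x :: "nat \<Rightarrow> 'a"
  proof -
    obtain i where "x i \<noteq> 0" using x by (auto simp: nonzero_vecs_def)
    moreover from this have "i = 0 \<or> i = 1" using supp[OF x, of i] by (cases "i > 1") auto
    ultimately show ?thesis by auto
  qed
  fix y'
  {
    assume "y' \<in> scroll_proj a0 a1 (pt (scroll_map a0 a1 y z))"
    then obtain z' c where y': "y' \<in> nonzero_vecs 1" and c: "c \<noteq> 0"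
      and eq: "scroll_map a0 a1 y' z' = (\<lambda>i. c * scroll_map a0 a1 y z i)"
      by (auto simp: scroll_proj_def pt_def)
    have "y' 0 * y 1 = y' 1 * y 0"
    proof (cases "z 0 = 0")
      case False
      show ?thesis
        by (rule rational_normal_curve_inj[OF a(1) c False nz[OF y], of _ _ "z' 0"])
           (use eq in \<open>auto simp: scroll_map_def fun_eq_iff split: if_splits\<close>)
    next
      case True
      then have z1: "z 1 \<noteq> 0" using nz[OF z] by simp
      have "y' 0 ^ (a1 - i) * y' 1 ^ i * z' 1 = c * (y 0 ^ (a1 - i) * y 1 ^ i * z 1)"
        if "i \<le> a1" for i
        using fun_cong[OF eq, of "a0 + 1 + i"] that by (simp add: scroll_map_def)
      then show ?thesis
        by (rule rational_normal_curve_inj[OF a(2) c z1 nz[OF y]])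
    qed
    then obtain d where d: "y' 0 = d * y 0" "y' 1 = d * y 1"
    proof (cases "y 0 = 0")
      case True
      then show ?thesis using nz[OF y] \<open>y' 0 * y 1 = y' 1 * y 0\<close> by (intro that[of "y' 1 / y 1"]) auto
    next
      case False
      then show ?thesis using \<open>y' 0 * y 1 = y' 1 * y 0\<close>
        by (intro that[of "y' 0 / y 0"]) (auto simp: field_simps)
    qed
    have "y' i = d * y i" for i
      using d supp[OF y', of i] supp[OF y, of i] by (cases "i = 0"; cases "i = 1"; auto)
    moreover have "d \<noteq> 0" using nz[OF y'] d by auto
    ultimately show "y' \<in> pt y" unfolding pt_def by blast
  }
  {
    assume "y' \<in> pt y"
    then obtain c where c: "c \<noteq> 0" and y': "y' = (\<lambda>i. c * y i)" by (auto simp: pt_def)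
    define z' where "z' = (\<lambda>i. if i = 0 then z 0 / c ^ a0 else z i / c ^ a1)"
    have pw: "c ^ (n - i) * c ^ i = c ^ n" if "i \<le> n" for n i
      using that by (simp flip: power_add)
    have "z' \<in> nonzero_vecs 1"
    proof -
      have "z' 0 \<noteq> 0 \<or> z' 1 \<noteq> 0" using nz[OF z] c by (simp add: z'_def)
      moreover have "\<forall>i>1. z' i = 0" using supp[OF z] by (simp add: z'_def)
      ultimately show ?thesis unfolding nonzero_vecs_def by blast
    qed
    moreover have "y' \<in> nonzero_vecs 1"
      using y c by (auto simp: nonzero_vecs_def y')
    moreover have "scroll_map a0 a1 y' z' = scroll_map a0 a1 y z"
    proof
      fix i
      consider "i \<le> a0" | j where "i = a0 + 1 + j" "j \<le> a1" | "i > a0 + a1 + 1"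
        proof -
        assume "i \<le> a0 \<Longrightarrow> thesis" "\<And>j. i = a0 + 1 + j \<Longrightarrow> j \<le> a1 \<Longrightarrow> thesis" "a0 + a1 + 1 < i \<Longrightarrow> thesis"
        note * = this
        show thesis
          using *(1) *(2)[of "i - (a0 + 1)"] *(3) by linarith
      qed
      then show "scroll_map a0 a1 y' z' i = scroll_map a0 a1 y z i"
      proof cases
        case 1
        then show ?thesis using pw[OF 1] c
          by (simp add: scroll_map_def y' z'_def power_mult_distrib field_simps)
      next
        case 2
        then show ?thesis using pw[OF 2(2)] c
          by (simp add: scroll_map_def y' z'_def power_mult_distrib field_simps)
      next
        case 3
        then show ?thesis by (simp add: scroll_map_def)
      qed
    qed
    moreover have "scroll_map a0 a1 y z \<in> pt (scroll_map a0 a1 y z)"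
      unfolding pt_def by (rule CollectI, rule exI[of _ 1]) simp
    ultimately show "y' \<in> scroll_proj a0 a1 (pt (scroll_map a0 a1 y z))"
      unfolding scroll_proj_def by (intro CollectI conjI bexI[of _ z']) simp_all
  }
qed

text \<open>
  The invertible sheaf \<open>O(m H + n f)\<close>, i.e. \<open>O(1)\<^sup>\<otimes>\<^sup>m\<close> restricted from the ambient projective space
  tensored with the pullback of \<open>O(n)\<close> from \<open>P\<^sup>1\<close>. Since \<open>O(-1)\<close> is the tautological
  line bundle, sections of \<open>O(m)\<close> on a projective space are homogeneous functions of degree \<open>m\<close> of the
  homogeneous coordinate vector, with frame \<open>x\<^sub>i\<^sup>m\<close> where \<open>x\<^sub>i \<noteq> 0\<close>. So a section here is a
  function of coordinate vectors \<open>x\<close> of \<open>P\<close> and \<open>y\<close> of the projection of \<open>P\<close> which locally is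
  a regular function of \<open>P\<close> times \<open>x\<^sub>i\<^sup>m y\<^sub>j\<^sup>n\<close>.
\<close>

definition scroll_O :: "nat \<Rightarrow> nat \<Rightarrow> int \<Rightarrow> int \<Rightarrow>
    ((nat \<Rightarrow> 'k::field) set, 'k, (nat \<Rightarrow> 'k) \<Rightarrow> (nat \<Rightarrow> 'k) \<Rightarrow> 'k) mod_sheaf" where
  "scroll_O a0 a1 m n =
     \<lparr> sec = (\<lambda>U. {s.
         (\<forall>x y. \<not> (pt x \<in> U \<and> y \<in> scroll_proj a0 a1 (pt x)) \<longrightarrow> s x y = 0) \<and>
         (\<forall>P\<in>U. \<exists>V g. \<exists>i \<le> a0 + a1 + 1. \<exists>j \<le> 1.
            openin (zar (scroll a0 a1)) V \<and> P \<in> V \<and> V \<subseteq> U \<and> reg (scroll a0 a1) V g \<and>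
            (\<forall>Q\<in>V. \<forall>x\<in>Q. \<forall>y \<in> scroll_proj a0 a1 Q.
               x i \<noteq> 0 \<and> y j \<noteq> 0 \<and> s x y = g Q * x i powi m * y j powi n))}),
       add = (\<lambda>s s' x y. s x y + s' x y),
       act = (\<lambda>g s x y. g (pt x) * s x y),
       res = (\<lambda>W s x y. if pt x \<in> W then s x y else 0) \<rparr>"

end

(*
  In homogeneous coordinates y = (y0 : y1) on the base and z = (z0 : z1) in the fibres, let l be a
  linear form in y for each of the fibres in D and let F be the product of these forms. The
  isomorphism sends a pair (A, B) to
    A (y0 dy1 - y1 dy0) / F + B (z0 dz1 - z1 dz0 + (a1 - a0) z0 z1 dl / l),
  where l belongs to any one of the fibres. The last term makes the second summand vanish on the
  Euler vector fields, so that it descends to X: it is an explicit splitting of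
    0 -> O((a - 2) f) -> Omega(log D) -> Omega(X/P1) = O(-2H + cf) -> 0.
  In an affine chart with coordinates t, w the fibres are the zeros of a polynomial F(t) with simple
  roots. If F omega = p dt + q dw and F d(omega) are regular, then comparing coefficients gives
  q F' = F (...), so q vanishes on the fibres and is divisible by F; hence the forms
  dt / F and dw generate the logarithmic forms.
*)
theory Submission
  imports Defs
begin

text \<open>The Euler correction comes from weights: \<open>scroll_map\<close> is unchanged under y
  -> c y, z_i -> c^(-a_i) z_i. Contracting z0 dz1 - z1 dz0 with the Euler field of this action gives
  (a0 - a1) z0 z1, while dl / l gives 1. The bound on a makes D nonempty and so provides l. The same
  weights explain the twists: (y0 dy1 - y1 dy0) / F has degree 2 - a in y, and the second form
  scales like z0 z1. A logarithmic form is recorded only off D, and a section of an invertible sheaf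
  is a function of coordinate vectors. Comparisons therefore pass through four affine charts, where
  a regular function is locally a fraction of polynomials and an identity off the zeros of a nonzero
  polynomial holds everywhere. This gives injectivity across D, and injectivity lets local preimages
  glue. The members of D are given by a linear system. That they are zero loci of linear forms in y
  is a separate argument, in which algebraic closedness enters: a function on the line that is
  locally a fraction is a polynomial.\<close>

declare split_paired_All [simp del] split_paired_Ex [simp del]

section \<open>Rational functions on the affine plane\<close>

text \<open>Bivariate polynomials are taken as k[t][w]: coefficients in the base coordinate
  \<open>fst\<close>, outer variable the fibre coordinate \<open>snd\<close>. An equation of fibres
  is then a constant \<open>[:p:]\<close>, and divisibility by it can be tested
  coefficientwise.\<close>

definition ev :: "'k::field poly poly \<Rightarrow> 'k \<times> 'k \<Rightarrow> 'k" where
  "ev P u = poly (poly P [:snd u:]) (fst u)"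

lemma ev_simps [simp]:
  "ev (P + Q) u = ev P u + ev Q u" "ev (P * Q) u = ev P u * ev Q u" "ev (P - Q) u = ev P u - ev Q u"
  "ev (- P) u = - ev P u" "ev 0 u = 0" "ev 1 u = 1" "ev (P ^ n) u = ev P u ^ n"
  by (simp_all add: ev_def)

lemma ev_2 [simp]: "ev 2 u = 2"
  unfolding one_add_one[symmetric] ev_simps ..

lemma ev_lift [simp]: "ev [:p:] u = poly p (fst u)"
  by (simp add: ev_def)

lemma ev_smult [simp]: "ev (smult p P) u = poly p (fst u) * ev P u"
  by (simp add: ev_def)

lemma ev_snd [simp]: "ev [:0, 1:] u = snd u"
  by (simp add: ev_def)

lemma ev_pCons: "ev (pCons p P) u = poly p (fst u) + snd u * ev P u"
  by (simp add: ev_def)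

text \<open>All constants \<open>[:w:]\<close> are roots of P over the domain k[t], and
  characteristic 0 makes them infinitely many.\<close>

lemma ev_eq_0_imp:
  fixes P :: "'k::field_char_0 poly poly"
  assumes "\<And>u. ev P u = 0"
  shows "P = 0"
proof (rule ccontr)
  assume "P \<noteq> 0"
  have "poly P [:w:] = 0" for w
    using assms[of "(_, w)"] by (simp add: ev_def poly_all_0_iff_0[symmetric])
  then have "range (\<lambda>w. [:w:]) \<subseteq> {x. poly P x = 0}" by auto
  moreover have "infinite (range (\<lambda>w::'k. [:w:]))"
    by (simp add: finite_image_iff inj_on_def infinite_UNIV_char_0)
  ultimately show False using poly_roots_finite[OF \<open>P \<noteq> 0\<close>] finite_subset by blast
qed

text \<open>Density of a nonempty principal open set: P Q vanishes at every point, so P Q = 0 in a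
  domain.\<close>

lemma ev_mult_eq_0_imp:
  fixes P Q :: "'k::field_char_0 poly poly"
  assumes "ev Q u \<noteq> 0" "\<And>v. ev Q v \<noteq> 0 \<Longrightarrow> ev P v = 0"
  shows "P = 0"
proof -
  have "P * Q = 0" using assms(2) by (intro ev_eq_0_imp) auto
  moreover have "Q \<noteq> 0" using assms(1) by auto
  ultimately show ?thesis by simp
qed

section \<open>Formal partial derivatives of polynomials\<close>

definition pdrv :: "nat \<Rightarrow> 'k::field poly poly \<Rightarrow> 'k poly poly" where
  "pdrv i P = (if i = 0 then map_poly pderiv P else pderiv P)"

lemma pdrv_add [simp]: "pdrv i (P + Q) = pdrv i P + pdrv i Q"
  by (auto simp: pdrv_def pderiv_add coeff_map_poly intro!: poly_eqI)

lemma pdrv_diff [simp]: "pdrv i (P - Q) = pdrv i P - pdrv i Q"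
  by (auto simp: pdrv_def pderiv_diff coeff_map_poly intro!: poly_eqI)

lemma pdrv_mult [simp]: "pdrv i (P * Q) = pdrv i P * Q + P * pdrv i Q"
proof (cases "i = 0")
  case True
  have sm: "map_poly pderiv (smult a Q) = smult (pderiv a) Q + smult a (map_poly pderiv Q)" for a :: "'a poly"
    by (intro poly_eqI) (simp add: coeff_map_poly pderiv_mult mult.commute)
  have ad: "map_poly pderiv (P + Q) = map_poly pderiv P + map_poly pderiv Q" for P Q :: "'a poly poly"
    by (intro poly_eqI) (simp add: coeff_map_poly pderiv_add)
  have "map_poly pderiv (P * Q) = map_poly pderiv P * Q + P * map_poly pderiv Q"
    by (induction P) (simp_all add: map_poly_pCons ad sm algebra_simps)
  with True show ?thesis by (simp add: pdrv_def)
qed (simp add: pdrv_def pderiv_mult add.commute mult.commute)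

lemma pdrv_0 [simp]: "pdrv i 0 = 0"
  by (simp add: pdrv_def)

lemma pdrv_comm: "pdrv i (pdrv j P) = pdrv j (pdrv i P)"
proof -
  have c: "pderiv (of_nat n * p) = of_nat n * pderiv p" for n and p :: "'a poly"
    by (simp add: pderiv_mult pderiv_of_nat)
  have "map_poly pderiv (pderiv P) = pderiv (map_poly pderiv P)"
    by (intro poly_eqI) (simp only: coeff_map_poly coeff_pderiv c pderiv_0)
  then show ?thesis by (auto simp: pdrv_def)
qed

lemma pdrv_lift: "pdrv i [:p:] = (if i = 0 then [:pderiv p:] else 0)"
  by (simp add: pdrv_def map_poly_pCons pderiv_pCons)

lemma pdrv_snd: "pdrv i [:0, 1:] = (if i = 0 then 0 else 1)"
  by (simp add: pdrv_def map_poly_pCons pderiv_pCons one_pCons)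

text \<open>The fraction has to be valid on the whole principal open set where Q is nonzero, not
  merely near u. Two representations then satisfy an identity of polynomials
  (\<open>rep_unique\<close>), and the base point can be moved (\<open>rep_move\<close>).\<close>

definition rep :: "('k::field \<times> 'k \<Rightarrow> 'k) \<Rightarrow> 'k \<times> 'k \<Rightarrow> 'k poly poly \<Rightarrow> 'k poly poly \<Rightarrow> bool" where
  "rep f u P Q \<longleftrightarrow> ev Q u \<noteq> 0 \<and> (\<forall>v. ev Q v \<noteq> 0 \<longrightarrow> f v = ev P v / ev Q v)"

definition aopen :: "('k::field \<times> 'k) set \<Rightarrow> bool" where
  "aopen U \<longleftrightarrow> (\<forall>u\<in>U. \<exists>Q. ev Q u \<noteq> 0 \<and> (\<forall>v. ev Q v \<noteq> 0 \<longrightarrow> v \<in> U))"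

definition areg :: "('k::field \<times> 'k) set \<Rightarrow> ('k \<times> 'k \<Rightarrow> 'k) \<Rightarrow> bool" where
  "areg U f \<longleftrightarrow> (\<forall>u\<in>U. \<exists>P Q. rep f u P Q \<and> (\<forall>v. ev Q v \<noteq> 0 \<longrightarrow> v \<in> U))"

definition dq :: "nat \<Rightarrow> 'k::field poly poly \<Rightarrow> 'k poly poly \<Rightarrow> 'k \<times> 'k \<Rightarrow> 'k" where
  "dq i P Q u = (ev (pdrv i P) u * ev Q u - ev P u * ev (pdrv i Q) u) / (ev Q u)\<^sup>2"

text \<open>The partial derivatives with respect to the first (\<open>i = 0\<close>) and second coordinate.\<close>

definition dd :: "nat \<Rightarrow> ('k::field \<times> 'k \<Rightarrow> 'k) \<Rightarrow> 'k \<times> 'k \<Rightarrow> 'k" where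
  "dd i f u = (let PQ = (SOME PQ. rep f u (fst PQ) (snd PQ)) in dq i (fst PQ) (snd PQ) u)"

lemma rep_unique:
  fixes f :: "'k::field_char_0 \<times> 'k \<Rightarrow> 'k"
  assumes "rep f u P Q" "rep f u P' Q'"
  shows "P * Q' = P' * Q"
proof -
  have "P * Q' - P' * Q = 0"
  proof (rule ev_mult_eq_0_imp[of "Q * Q'" u])
    show "ev (Q * Q') u \<noteq> 0" using assms by (simp add: rep_def)
    fix v assume "ev (Q * Q') v \<noteq> 0"
    then have n: "ev Q v \<noteq> 0" "ev Q' v \<noteq> 0" by auto
    then have "ev P v / ev Q v = ev P' v / ev Q' v" using assms unfolding rep_def by metis
    then show "ev (P * Q' - P' * Q) v = 0" using n by (simp add: field_simps)
  qed
  then show ?thesis by simp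
qed

text \<open>\<open>dd\<close> picks an arbitrary fraction, so independence of the choice is at
  stake. Differentiating the polynomial identity P Q' = P' Q of \<open>rep_unique\<close> shows that
  the two quotient-rule expressions agree.\<close>

lemma dd_eq:
  fixes f :: "'k::field_char_0 \<times> 'k \<Rightarrow> 'k"
  assumes r: "rep f u P Q"
  shows "dd i f u = dq i P Q u"
proof -
  define PQ where "PQ = (SOME PQ. rep f u (fst PQ) (snd PQ))"
  obtain P' Q' where PQ: "PQ = (P', Q')" by (cases PQ)
  have "rep f u (fst PQ) (snd PQ)" unfolding PQ_def
    by (rule someI[of _ "(P, Q)"]) (use r in simp)
  then have r': "rep f u P' Q'" by (simp add: PQ)
  define q q' p p' where "q = ev Q u" "q' = ev Q' u" "p = ev P u" "p' = ev P' u"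
  note d = this
  have nz: "q \<noteq> 0" "q' \<noteq> 0" using r r' by (auto simp: rep_def d)
  have e: "p * q' = p' * q"
    using arg_cong[OF rep_unique[OF r r'], of "\<lambda>P. ev P u"] by (simp add: d)
  have "ev (pdrv i (P * Q')) u = ev (pdrv i (P' * Q)) u" using rep_unique[OF r r'] by simp
  then have e': "ev (pdrv i P) u * q' + p * ev (pdrv i Q') u = ev (pdrv i P') u * q + p' * ev (pdrv i Q) u"
    by (simp add: d)
  define a a' b b' where "a = ev (pdrv i P) u" "a' = ev (pdrv i P') u" "b = ev (pdrv i Q) u" "b' = ev (pdrv i Q') u"
  note d' = this
  have p': "p' = p * q' / q" using e nz by (simp add: field_simps)
  have a': "a' = (a * q' + p * b' - p' * b) / q" using e' nz by (simp add: field_simps d')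
  have "(a * q - p * b) / q\<^sup>2 = (a' * q' - p' * b') / q'\<^sup>2"
    using nz unfolding a' p' by (simp add: field_simps power2_eq_square)
  then show ?thesis
    unfolding dd_def PQ_def[symmetric] by (simp add: PQ dq_def d d' Let_def)
qed

text \<open>Expanding by R restricts the domain of validity to points where R is nonzero as well;
  this is how a fraction is fitted into a given open set.\<close>

lemma rep_shrink:
  fixes f :: "'k::field \<times> 'k \<Rightarrow> 'k"
  assumes "rep f u P Q" "ev R u \<noteq> 0"
  shows "rep f u (P * R) (Q * R)"
  using assms by (auto simp: rep_def)

lemma rep_cong:
  assumes "rep f u P Q" "\<And>v. ev Q v \<noteq> 0 \<Longrightarrow> f v = g v"
  shows "rep g u P Q"
  using assms by (auto simp: rep_def)

lemma rep_move: "rep f u P Q \<Longrightarrow> ev Q v \<noteq> 0 \<Longrightarrow> rep f v P Q"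
  by (auto simp: rep_def)

lemma rep_add:
  "rep f u P Q \<Longrightarrow> rep g u P' Q' \<Longrightarrow> rep (\<lambda>v. f v + g v) u (P * Q' + P' * Q) (Q * Q')"
  by (auto simp: rep_def add_divide_distrib)

lemma rep_mult:
  "rep f u P Q \<Longrightarrow> rep g u P' Q' \<Longrightarrow> rep (\<lambda>v. f v * g v) u (P * P') (Q * Q')"
  by (auto simp: rep_def)

text \<open>Q / P would not do: where P is nonzero but Q vanishes, nothing is known about f.
  Expanding by Q excludes these points.\<close>

lemma rep_inverse:
  "rep f u P Q \<Longrightarrow> f u \<noteq> 0 \<Longrightarrow> rep (\<lambda>v. inverse (f v)) u (Q * Q) (P * Q)"
  by (cases u) (auto simp: rep_def)

lemma rep_ev: "rep (ev P) u P 1"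
  by (auto simp: rep_def)

lemma aregE:
  assumes "areg U f" "u \<in> U"
  obtains P Q where "rep f u P Q" "\<And>v. ev Q v \<noteq> 0 \<Longrightarrow> v \<in> U"
  using assms unfolding areg_def by blast

lemma aopenE:
  assumes "aopen U" "u \<in> U"
  obtains Q where "ev Q u \<noteq> 0" "\<And>v. ev Q v \<noteq> 0 \<Longrightarrow> v \<in> U"
  using assms unfolding aopen_def by blast

lemma areg_imp_aopen: "areg U f \<Longrightarrow> aopen U"
  unfolding areg_def aopen_def rep_def by blast

lemma aopen_Int: "aopen U \<Longrightarrow> aopen V \<Longrightarrow> aopen (U \<inter> V)"
  unfolding aopen_def
proof
  fix u assume *: "\<forall>u\<in>U. \<exists>Q. ev Q u \<noteq> 0 \<and> (\<forall>v. ev Q v \<noteq> 0 \<longrightarrow> v \<in> U)"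
    "\<forall>u\<in>V. \<exists>Q. ev Q u \<noteq> 0 \<and> (\<forall>v. ev Q v \<noteq> 0 \<longrightarrow> v \<in> V)" "u \<in> U \<inter> V"
  then obtain Q R where "ev Q u \<noteq> 0" "\<forall>v. ev Q v \<noteq> 0 \<longrightarrow> v \<in> U" "ev R u \<noteq> 0" "\<forall>v. ev R v \<noteq> 0 \<longrightarrow> v \<in> V"
    by blast
  then show "\<exists>Q. ev Q u \<noteq> 0 \<and> (\<forall>v. ev Q v \<noteq> 0 \<longrightarrow> v \<in> U \<inter> V)"
    by (intro exI[of _ "Q * R"]) auto
qed

lemma aopen_UNIV [simp]: "aopen UNIV"
  unfolding aopen_def by (auto intro: exI[of _ 1])

lemma aopen_ev: "aopen {v. ev Q v \<noteq> 0}"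
  unfolding aopen_def by auto

lemma aregI:
  assumes "aopen U" "\<And>u. u \<in> U \<Longrightarrow> \<exists>P Q. rep f u P Q"
  shows "areg U f"
  unfolding areg_def
proof
  fix u assume u: "u \<in> U"
  then obtain P Q where r: "rep f u P Q" using assms by blast
  obtain R where R: "ev R u \<noteq> 0" "\<And>v. ev R v \<noteq> 0 \<Longrightarrow> v \<in> U" using aopenE[OF assms(1) u] by blast
  show "\<exists>P Q. rep f u P Q \<and> (\<forall>v. ev Q v \<noteq> 0 \<longrightarrow> v \<in> U)"
    by (rule exI[of _ "P * R"], rule exI[of _ "Q * R"]) (use rep_shrink[OF r R(1)] R(2) in auto)
qed

lemma areg_rep: "areg U f \<Longrightarrow> u \<in> U \<Longrightarrow> \<exists>P Q. rep f u P Q"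
  unfolding areg_def by blast

lemma areg_ev: "aopen U \<Longrightarrow> areg U (ev P)"
  by (rule aregI) (use rep_ev in blast)+

lemma areg_cong:
  assumes "areg U f" "\<And>u. u \<in> U \<Longrightarrow> f u = g u"
  shows "areg U g"
proof -
  have "\<exists>P Q. rep g u P Q \<and> (\<forall>v. ev Q v \<noteq> 0 \<longrightarrow> v \<in> U)" if u: "u \<in> U" for u
  proof -
    obtain P Q where "rep f u P Q" "\<And>v. ev Q v \<noteq> 0 \<Longrightarrow> v \<in> U" using aregE[OF assms(1) u] by blast
    then show ?thesis using assms(2) rep_cong by metis
  qed
  then show ?thesis by (auto simp: areg_def)
qed

lemma areg_const: "aopen U \<Longrightarrow> areg U (\<lambda>_. c)"
  by (rule areg_cong[OF areg_ev[of U "[:[:c:]:]"]]) simp_all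

lemma areg_poly: "aopen U \<Longrightarrow> areg U (\<lambda>u. poly p (fst u))"
  by (rule areg_cong[OF areg_ev[of U "[:p:]"]]) simp_all

lemma areg_fst: "aopen U \<Longrightarrow> areg U fst"
  by (rule areg_cong[OF areg_poly[of U "[:0, 1:]"]]) simp_all

lemma areg_snd: "aopen U \<Longrightarrow> areg U snd"
  by (rule areg_cong[OF areg_ev[of U "[:0, 1:]"]]) simp_all

lemma areg_add:
  assumes "areg U f" "areg U g"
  shows "areg U (\<lambda>u. f u + g u)"
  by (rule aregI[OF areg_imp_aopen[OF assms(1)]]) (blast dest: areg_rep[OF assms(1)] areg_rep[OF assms(2)] intro: rep_add)

lemma areg_mult:
  assumes "areg U f" "areg U g"
  shows "areg U (\<lambda>u. f u * g u)"
  by (rule aregI[OF areg_imp_aopen[OF assms(1)]]) (blast dest: areg_rep[OF assms(1)] areg_rep[OF assms(2)] intro: rep_mult)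

lemma areg_minus: "areg U f \<Longrightarrow> areg U (\<lambda>u. - f u)"
  using areg_mult[OF areg_const[of U "-1"], of f] areg_imp_aopen by auto

lemma areg_diff: "areg U f \<Longrightarrow> areg U g \<Longrightarrow> areg U (\<lambda>u. f u - g u)"
  using areg_add[OF _ areg_minus, of U f g] by simp

lemma areg_inverse:
  assumes "areg U f" "\<And>u. u \<in> U \<Longrightarrow> f u \<noteq> 0"
  shows "areg U (\<lambda>u. inverse (f u))"
  by (rule aregI[OF areg_imp_aopen[OF assms(1)]]) (blast dest: areg_rep[OF assms(1)] assms(2) intro: rep_inverse)

lemma areg_divide:
  "areg U f \<Longrightarrow> areg U g \<Longrightarrow> (\<And>u. u \<in> U \<Longrightarrow> g u \<noteq> 0) \<Longrightarrow> areg U (\<lambda>u. f u / g u)"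
  using areg_mult[OF _ areg_inverse, of U f g] by (simp add: field_class.field_divide_inverse)

lemma areg_power: "areg U f \<Longrightarrow> areg U (\<lambda>u. f u ^ n)"
  by (induction n) (auto intro: areg_mult areg_const areg_imp_aopen)

lemma areg_powi:
  assumes "areg U f" "\<And>u. u \<in> U \<Longrightarrow> f u \<noteq> 0"
  shows "areg U (\<lambda>u. f u powi n)"
  using areg_power[OF assms(1)] areg_power[OF areg_inverse[OF assms]]
  by (cases "n \<ge> 0") (simp_all add: power_int_def)

lemma areg_sum: "aopen U \<Longrightarrow> (\<And>i. i \<in> I \<Longrightarrow> areg U (f i)) \<Longrightarrow> areg U (\<lambda>u. \<Sum>i\<in>I. f i u)"
  by (induction I rule: infinite_finite_induct) (auto intro: areg_add areg_const)

lemma areg_subset: "areg U f \<Longrightarrow> aopen W \<Longrightarrow> W \<subseteq> U \<Longrightarrow> areg W f"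
  by (rule aregI) (blast dest: areg_rep)+

lemma areg_local:
  assumes "\<And>u. u \<in> U \<Longrightarrow> \<exists>W. u \<in> W \<and> W \<subseteq> U \<and> areg W f"
  shows "areg U f"
  unfolding areg_def
proof
  fix u assume "u \<in> U"
  then obtain W where "u \<in> W" "W \<subseteq> U" "areg W f" using assms by blast
  then show "\<exists>P Q. rep f u P Q \<and> (\<forall>v. ev Q v \<noteq> 0 \<longrightarrow> v \<in> U)"
    unfolding areg_def by blast
qed

lemma aopen_nonzero:
  assumes "areg U f"
  shows "aopen {u \<in> U. f u \<noteq> 0}"
  unfolding aopen_def
proof
  fix u assume u: "u \<in> {u \<in> U. f u \<noteq> 0}"
  then obtain P Q where r: "rep f u P Q" "\<And>v. ev Q v \<noteq> 0 \<Longrightarrow> v \<in> U" using aregE[OF assms] by blast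
  moreover from r u have "f u = ev P u / ev Q u" "f u \<noteq> 0" by (auto simp: rep_def)
  ultimately show "\<exists>R. ev R u \<noteq> 0 \<and> (\<forall>v. ev R v \<noteq> 0 \<longrightarrow> v \<in> {u \<in> U. f u \<noteq> 0})"
    by (intro exI[of _ "P * Q"]) (auto simp: rep_def)
qed

text \<open>If P / Q represents f near u, then P R vanishes wherever Q does not, so P R = 0 and
  hence P = 0. This carries identities proved outside the divisor across it.\<close>

lemma areg_dense:
  fixes f :: "'k::field_char_0 \<times> 'k \<Rightarrow> 'k"
  assumes "areg U f" "R \<noteq> 0" "\<And>u. u \<in> U \<Longrightarrow> ev R u \<noteq> 0 \<Longrightarrow> f u = 0" "u \<in> U"
  shows "f u = 0"
proof -
  obtain P Q where r: "rep f u P Q" "\<And>v. ev Q v \<noteq> 0 \<Longrightarrow> v \<in> U" using aregE[OF assms(1,4)] by blast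
  have "P * R = 0"
    by (rule ev_mult_eq_0_imp[of Q u]) (use r assms(3) in \<open>auto simp: rep_def\<close>)
  then have "P = 0" using assms(2) by simp
  then show ?thesis using r(1) by (simp add: rep_def)
qed

section \<open>Rules for the partial derivatives of regular functions\<close>

lemma dd_areg:
  fixes f :: "'k::field_char_0 \<times> 'k \<Rightarrow> 'k"
  assumes "areg U f"
  shows "areg U (dd i f)"
proof (rule aregI[OF areg_imp_aopen[OF assms]])
  fix u assume "u \<in> U"
  then obtain P Q where r: "rep f u P Q" using areg_rep[OF assms] by blast
  have "rep (dd i f) u (pdrv i P * Q - P * pdrv i Q) (Q\<^sup>2)"
    using r dd_eq[OF rep_move[OF r]] by (auto simp: rep_def dq_def)
  then show "\<exists>P Q. rep (dd i f) u P Q" by blast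
qed

lemma dd_cong:
  fixes f :: "'k::field_char_0 \<times> 'k \<Rightarrow> 'k"
  assumes "areg U f" "\<And>v. v \<in> U \<Longrightarrow> f v = g v" "u \<in> U"
  shows "dd i f u = dd i g u"
proof -
  obtain P Q where r: "rep f u P Q" "\<And>v. ev Q v \<noteq> 0 \<Longrightarrow> v \<in> U" using aregE[OF assms(1,3)] by blast
  have "rep g u P Q" by (rule rep_cong[OF r(1)]) (use assms(2) r(2) in auto)
  then show ?thesis using dd_eq r(1) by metis
qed

lemma dd_add:
  fixes f :: "'k::field_char_0 \<times> 'k \<Rightarrow> 'k"
  assumes "areg U f" "areg U g" "u \<in> U"
  shows "dd i (\<lambda>u. f u + g u) u = dd i f u + dd i g u"
proof -
  obtain P Q P' Q' where r: "rep f u P Q" "rep g u P' Q'" using areg_rep assms by metis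
  have "ev Q u \<noteq> 0" "ev Q' u \<noteq> 0" using r by (auto simp: rep_def)
  then show ?thesis
    by (simp add: dd_eq[OF r(1)] dd_eq[OF r(2)] dd_eq[OF rep_add[OF r]] dq_def field_simps power2_eq_square)
qed

lemma dd_mult:
  fixes f :: "'k::field_char_0 \<times> 'k \<Rightarrow> 'k"
  assumes "areg U f" "areg U g" "u \<in> U"
  shows "dd i (\<lambda>u. f u * g u) u = f u * dd i g u + g u * dd i f u"
proof -
  obtain P Q P' Q' where r: "rep f u P Q" "rep g u P' Q'" using areg_rep assms by metis
  have n: "ev Q u \<noteq> 0" "ev Q' u \<noteq> 0" using r by (auto simp: rep_def)
  have v: "f u = ev P u / ev Q u" "g u = ev P' u / ev Q' u" using r by (auto simp: rep_def)
  show ?thesis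
    using n by (simp add: v dd_eq[OF r(1)] dd_eq[OF r(2)] dd_eq[OF rep_mult[OF r]] dq_def field_simps power2_eq_square)
qed

lemma dd_ev: "dd i (ev P) (u :: 'k::field_char_0 \<times> 'k) = ev (pdrv i P) u"
proof -
  have "pdrv i 1 = (0 :: 'k poly poly)" using pdrv_lift[of i "1 :: 'k poly"] by (simp add: one_pCons)
  then show ?thesis by (simp add: dd_eq[OF rep_ev] dq_def)
qed

lemma dd_poly: "dd i (\<lambda>u. poly p (fst u)) (u :: 'k::field_char_0 \<times> 'k) = (if i = 0 then poly (pderiv p) (fst u) else 0)"
proof -
  have "(\<lambda>u::'k \<times> 'k. poly p (fst u)) = ev [:p:]" by auto
  then show ?thesis using dd_ev[of i "[:p:]" u] by (simp add: pdrv_lift)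
qed

lemma dd_const [simp]: "dd i (\<lambda>_. c) (u :: 'k::field_char_0 \<times> 'k) = 0"
  using dd_poly[of i "[:c:]" u] by (simp add: pderiv_pCons)

lemma dd_fst: "dd i fst (u :: 'k::field_char_0 \<times> 'k) = (if i = 0 then 1 else 0)"
  using dd_poly[of i "[:0, 1:]" u] by (simp add: pderiv_pCons)

lemma dd_snd: "dd i snd (u :: 'k::field_char_0 \<times> 'k) = (if i = 0 then 0 else 1)"
proof -
  have "snd = ev ([:0, 1:] :: 'k poly poly)" by auto
  then show ?thesis using dd_ev[of i "[:0, 1:]" u] by (simp add: pdrv_snd)
qed

lemma dd_sum:
  fixes f :: "'i \<Rightarrow> 'k::field_char_0 \<times> 'k \<Rightarrow> 'k"
  assumes "aopen U" "u \<in> U" "\<And>n. n \<in> I \<Longrightarrow> areg U (f n)"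
  shows "dd i (\<lambda>u. \<Sum>n\<in>I. f n u) u = (\<Sum>n\<in>I. dd i (f n) u)"
  using assms(3)
  by (induction I rule: infinite_finite_induct)
    (simp_all add: dd_add[OF _ _ assms(2)] areg_sum[OF assms(1)])

lemma dd_divide:
  fixes f :: "'k::field_char_0 \<times> 'k \<Rightarrow> 'k"
  assumes f: "areg U f" and g: "areg U g" and nz: "\<And>u. u \<in> U \<Longrightarrow> g u \<noteq> 0" and u: "u \<in> U"
  shows "dd i (\<lambda>u. f u / g u) u = (dd i f u * g u - f u * dd i g u) / (g u)\<^sup>2"
proof -
  have q: "areg U (\<lambda>u. f u / g u)" by (rule areg_divide) (use assms in auto)
  have "dd i f u = dd i (\<lambda>u. (f u / g u) * g u) u"
    by (rule dd_cong[OF f _ u]) (use nz in auto)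
  also have "\<dots> = f u / g u * dd i g u + g u * dd i (\<lambda>u. f u / g u) u"
    by (rule dd_mult[OF q g u])
  finally show ?thesis using nz[OF u] by (simp add: field_simps power2_eq_square)
qed

text \<open>Symmetry of mixed partials, inherited from polynomials; it is what makes the exterior
  derivative independent of the presentation of a form.\<close>

lemma dd_comm:
  fixes f :: "'k::field_char_0 \<times> 'k \<Rightarrow> 'k"
  assumes "areg U f" "u \<in> U"
  shows "dd i (dd j f) u = dd j (dd i f) u"
proof -
  obtain P Q where r: "rep f u P Q" using areg_rep[OF assms] by blast
  then have nz: "ev Q u \<noteq> 0" by (auto simp: rep_def)
  have *: "rep (dd i f) u (pdrv i P * Q - P * pdrv i Q) (Q * Q)" for i
    using r dd_eq[OF rep_move[OF r]] by (auto simp: rep_def dq_def power2_eq_square)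
  show ?thesis
    unfolding dd_eq[OF *] dq_def using nz
    by (simp add: pdrv_comm[of i j] field_simps power2_eq_square)
qed

text \<open>A point derivation is determined by its values on the two coordinates: the product rule
  settles polynomials by induction, and P = f Q settles fractions. The sum and product rules are
  assumed for functions regular near u, since tangent vectors of the scroll obey them on such
  functions.\<close>

lemma dd_total:
  fixes v :: "('k::field_char_0 \<times> 'k \<Rightarrow> 'k) \<Rightarrow> 'k"
  assumes add: "\<And>U f g. areg U f \<Longrightarrow> areg U g \<Longrightarrow> u \<in> U \<Longrightarrow> v (\<lambda>x. f x + g x) = v f + v g"
    and mult: "\<And>U f g. areg U f \<Longrightarrow> areg U g \<Longrightarrow> u \<in> U \<Longrightarrow> v (\<lambda>x. f x * g x) = f u * v g + g u * v f"
    and const: "\<And>c. v (\<lambda>_. c) = 0"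
    and cong: "\<And>U f g. areg U f \<Longrightarrow> u \<in> U \<Longrightarrow> (\<And>x. x \<in> U \<Longrightarrow> f x = g x) \<Longrightarrow> v f = v g"
    and f: "areg U f" and u: "u \<in> U"
  shows "v f = dd 0 f u * v fst + dd 1 f u * v snd"
proof -
  have evc: "v (ev P) = ev (pdrv 0 P) u * v fst + ev (pdrv 1 P) u * v snd" for P
  proof (induction P)
    case 0
    have "ev (0 :: 'k poly poly) = (\<lambda>_. 0)" by auto
    then show ?case by (simp add: const)
  next
    case (pCons p P)
    have 1: "v (\<lambda>x. poly p (fst x)) = poly (pderiv p) (fst u) * v fst" for p
    proof (induction p)
      case 0
      then show ?case by (simp add: const)
    next
      case (pCons c p)
      have "v (\<lambda>x. poly (pCons c p) (fst x)) = v (\<lambda>x. c + fst x * poly p (fst x))" by simp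
      also have "\<dots> = v (\<lambda>_. c) + v (\<lambda>x. fst x * poly p (fst x))"
        by (rule add[of UNIV]) (simp_all add: areg_const areg_mult areg_poly areg_fst)
      also have "v (\<lambda>x. fst x * poly p (fst x)) = fst u * v (\<lambda>x. poly p (fst x)) + poly p (fst u) * v fst"
        by (rule mult[of UNIV]) (simp_all add: areg_poly areg_fst)
      finally show ?case by (simp add: pCons.IH const pderiv_pCons algebra_simps)
    qed
    have "v (ev (pCons p P)) = v (\<lambda>x. poly p (fst x) + snd x * ev P x)"
      by (rule arg_cong[of _ _ v]) (auto simp: ev_pCons)
    also have "\<dots> = v (\<lambda>x. poly p (fst x)) + v (\<lambda>x. snd x * ev P x)"
      by (rule add[of UNIV]) (simp_all add: areg_mult areg_poly areg_snd areg_ev)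
    also have "v (\<lambda>x. snd x * ev P x) = snd u * v (ev P) + ev P u * v snd"
      by (rule mult[of UNIV]) (simp_all add: areg_snd areg_ev)
    finally have "v (ev (pCons p P)) = poly (pderiv p) (fst u) * v fst + (snd u * v (ev P) + ev P u * v snd)"
      by (simp add: 1)
    moreover have "ev (pCons p P) = (\<lambda>a. poly p (fst a) + snd a * ev P a)"
      by (auto simp: ev_pCons)
    ultimately show ?case
      by (simp add: pCons.IH pdrv_def map_poly_pCons pderiv_pCons ev_pCons algebra_simps)
  qed
  obtain P Q where r: "rep f u P Q" "\<And>v. ev Q v \<noteq> 0 \<Longrightarrow> v \<in> U" using aregE[OF f u] by blast
  let ?W = "{v. ev Q v \<noteq> 0}"
  have W: "aopen ?W" "u \<in> ?W" using r by (auto simp: aopen_ev rep_def)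
  have fW: "areg ?W f" by (rule areg_subset[OF f W(1)]) (use r in auto)
  have "v (ev P) = v (\<lambda>x. f x * ev Q x)"
    by (rule cong[of ?W]) (use W r in \<open>auto simp: areg_ev rep_def\<close>)
  also have "\<dots> = f u * v (ev Q) + ev Q u * v f"
    by (rule mult[of ?W]) (use W fW in \<open>auto simp: areg_ev\<close>)
  finally have e: "v (ev P) = f u * v (ev Q) + ev Q u * v f" .
  have nz: "ev Q u \<noteq> 0" and fu: "f u = ev P u / ev Q u" using r by (auto simp: rep_def)
  have vf: "v f = (v (ev P) - f u * v (ev Q)) / ev Q u" using e nz by (simp add: field_simps)
  show ?thesis
    unfolding vf evc fu dd_eq[OF r(1)] dq_def using nz by (simp add: field_simps power2_eq_square)
qed

text \<open>At a root t0 of F, simplicity gives F = (t - t0) G with G nonzero at t0. Vanishing of b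
  on the line t = t0 makes t - t0 divide its numerator, and G can be inverted nearby.\<close>

lemma areg_divisible:
  fixes F :: "'k::field_char_0 poly"
  assumes b: "areg U b" and F: "F \<noteq> 0" and simple: "\<And>t. poly F t = 0 \<Longrightarrow> poly (pderiv F) t \<noteq> 0"
    and van: "\<And>x. x \<in> U \<Longrightarrow> poly F (fst x) = 0 \<Longrightarrow> b x = 0" and u: "u \<in> U"
  obtains W c where "u \<in> W" "W \<subseteq> U" "areg W c" "\<And>x. x \<in> W \<Longrightarrow> b x = c x * poly F (fst x)"
proof (cases "poly F (fst u) = 0")
  case False
  let ?W = "{x \<in> U. poly F (fst x) \<noteq> 0}"
  have "aopen ?W" by (rule aopen_nonzero) (use b areg_imp_aopen areg_poly in blast)
  show ?thesis
    by (rule that[of ?W "\<lambda>x. b x / poly F (fst x)"])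
      (use False u \<open>aopen ?W\<close> in \<open>auto intro!: areg_divide areg_subset[OF b] areg_poly\<close>)
next
  case True
  define t0 where "t0 = fst u"
  obtain G where G: "F = [:- t0, 1:] * G" using True by (auto simp: poly_eq_0_iff_dvd t0_def dvd_def)
  have "poly (pderiv F) t0 = poly G t0" unfolding G pderiv_mult by (simp add: pderiv_pCons)
  then have G0: "poly G t0 \<noteq> 0" using simple[of t0] True by (auto simp: t0_def)
  obtain P Q where r: "rep b u P Q" "\<And>v. ev Q v \<noteq> 0 \<Longrightarrow> v \<in> U" using aregE[OF b u] by blast
  \<comment> \<open>Numerator and denominator restricted to the line t = t0. P is known to vanish
    there only where Q does not, so the product P0 Q0 is considered; Q0 is nonzero because Q does
    not vanish at u.\<close>
  define P0 Q0 where "P0 = map_poly (\<lambda>p. poly p t0) P" "Q0 = map_poly (\<lambda>p. poly p t0) Q"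
  have ev0: "poly (map_poly (\<lambda>p. poly p t0) P) w = ev P (t0, w)" for P :: "'k poly poly" and w
    by (induction P) (simp_all add: map_poly_pCons ev_pCons)
  have "P0 * Q0 = 0"
  proof (rule poly_all_0_iff_0[THEN iffD1], rule allI)
    fix w
    have "ev P (t0, w) = 0" if "ev Q (t0, w) \<noteq> 0"
      using r that van[of "(t0, w)"] True by (auto simp: rep_def t0_def)
    then show "poly (P0 * Q0) w = 0" by (auto simp: P0_Q0_def ev0)
  qed
  moreover have "Q0 \<noteq> 0"
  proof
    assume "Q0 = 0"
    then have "ev Q (t0, snd u) = 0" using ev0[of Q "snd u"] by (simp add: P0_Q0_def)
    then show False using r by (simp add: rep_def t0_def)
  qed
  ultimately have "P0 = 0" by simp
  moreover have "coeff P0 n = poly (coeff P n) t0" for n by (simp add: P0_Q0_def coeff_map_poly)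
  ultimately have "poly (coeff P n) t0 = 0" for n by (metis coeff_0)
  then have "[:[:- t0, 1:]:] dvd P" by (simp add: const_poly_dvd_iff poly_eq_0_iff_dvd)
  then obtain P' where P': "P = [:[:- t0, 1:]:] * P'" by (auto simp: dvd_def)
  \<comment> \<open>With G in the denominator the cofactor of t - t0 in F is invertible on the
    neighbourhood, and b = P' / (Q G) times F.\<close>
  let ?R = "Q * [:G:]"
  let ?W = "{x. ev ?R x \<noteq> 0}"
  have W: "aopen ?W" by (rule aopen_ev)
  show ?thesis
  proof (rule that[of ?W "\<lambda>x. ev P' x / ev ?R x"])
    show "u \<in> ?W" using r G0 by (auto simp: rep_def t0_def)
    show "?W \<subseteq> U" using r by auto
    show "areg ?W (\<lambda>x. ev P' x / ev ?R x)" by (intro areg_divide areg_ev W) simp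
    show "b x = ev P' x / ev ?R x * poly F (fst x)" if x: "x \<in> ?W" for x
    proof -
      have "ev Q x \<noteq> 0" using x by simp
      then have bx: "b x = ev P x / ev Q x" using r(1) by (simp add: rep_def)
      show ?thesis unfolding bx using x by (simp add: P' G field_simps)
    qed
  qed
qed

declare One_nat_def [simp del]

section \<open>Regular functions on projective varieties\<close>

definition form_quotient :: "nat \<Rightarrow> (nat \<Rightarrow> 'k::field) set set \<Rightarrow> ((nat \<Rightarrow> 'k) set \<Rightarrow> 'k) \<Rightarrow> bool" where
  "form_quotient n V f \<longleftrightarrow>
     (\<exists>d F G. form n d F \<and> form n d G \<and> (\<forall>Q\<in>V. \<forall>x\<in>Q. G x \<noteq> 0 \<and> f Q = F x / G x))"

lemma form_quotientI:
  "form n d F \<Longrightarrow> form n d G \<Longrightarrow> (\<And>Q x. Q \<in> V \<Longrightarrow> x \<in> Q \<Longrightarrow> G x \<noteq> 0 \<and> f Q = F x / G x) \<Longrightarrow> form_quotient n V f"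
  unfolding form_quotient_def by blast

lemma form_quotientE:
  assumes "form_quotient n V f"
  obtains d F G where "form n d F" "form n d G" "\<forall>Q\<in>V. \<forall>x\<in>Q. G x \<noteq> 0 \<and> f Q = F x / G x"
  using assms unfolding form_quotient_def by blast

lemma form_quotient_subset: "form_quotient n V f \<Longrightarrow> W \<subseteq> V \<Longrightarrow> form_quotient n W f"
  unfolding form_quotient_def by blast

lemma form_quotient_cong: "form_quotient n V f \<Longrightarrow> (\<And>P. P \<in> V \<Longrightarrow> f P = g P) \<Longrightarrow> form_quotient n V g"
  by (erule form_quotientE, erule form_quotientI, assumption) simp

context
  fixes n :: nat and S :: "(nat \<Rightarrow> 'k::field) set set"
begin

private abbreviation Y :: "((nat \<Rightarrow> 'k) set, 'k) fspace" where
  "Y \<equiv> proj_variety n S"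

lemma zar_proj:
  "zar Y = topology_generated_by {{P \<in> S. \<forall>x\<in>P. F x \<noteq> 0} | F. \<exists>d. form n d F}"
  by (simp add: proj_variety_def Let_def)

lemma reg_proj:
  "reg Y U f \<longleftrightarrow>
    (\<forall>P\<in>U. \<exists>V. openin (zar Y) V \<and> P \<in> V \<and> V \<subseteq> U \<and> form_quotient n V f)"
proof -
  have "reg Y U f \<longleftrightarrow>
    (\<forall>P\<in>U. \<exists>V d F G. openin (zar Y) V \<and> P \<in> V \<and> V \<subseteq> U \<and> form n d F \<and> form n d G \<and>
       (\<forall>Q\<in>V. \<forall>x\<in>Q. G x \<noteq> 0 \<and> f Q = F x / G x))"
    unfolding zar_proj by (simp add: proj_variety_def Let_def)
  then show ?thesis by (simp add: form_quotient_def)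
qed

lemma openin_basic: "form n d F \<Longrightarrow> openin (zar Y) {P \<in> S. \<forall>x\<in>P. F x \<noteq> 0}"
  unfolding zar_proj by (rule topology_generated_by_Basis) blast

lemma topspace_proj [simp]: "topspace (zar Y) = S"
proof -
  have "form n 0 (\<lambda>_. 1)" by (rule form_const)
  then have "S \<in> {{P \<in> S. \<forall>x\<in>P. F x \<noteq> 0} | F. \<exists>d. form n d F}"
    by (intro CollectI exI[of _ "\<lambda>_. 1"]) auto
  then show ?thesis unfolding zar_proj topology_generated_by_topspace by blast
qed

text \<open>The generating sets already form a basis: the sets where F and G are nonzero meet in the
  one where F G is nonzero.\<close>

lemma openin_proj_basic:
  assumes "openin (zar Y) U" "p \<in> U"
  obtains d F where "form n d F" "\<forall>x\<in>p. F x \<noteq> 0" "{P \<in> S. \<forall>x\<in>P. F x \<noteq> 0} \<subseteq> U"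
proof -
  have "generate_topology_on {{P \<in> S. \<forall>x\<in>P. F x \<noteq> 0} | F. \<exists>d. form n d F} U"
    using assms(1) unfolding zar_proj by (rule openin_topology_generated_by)
  then have "p \<in> U \<longrightarrow> (\<exists>d F. form n d F \<and> (\<forall>x\<in>p. F x \<noteq> 0) \<and> {P \<in> S. \<forall>x\<in>P. F x \<noteq> 0} \<subseteq> U)"
  proof induction
    case Empty
    then show ?case by simp
  next
    case (Int A B)
    show ?case
    proof
      assume "p \<in> A \<inter> B"
      then obtain d F d' G where *: "form n d F" "\<forall>x\<in>p. F x \<noteq> 0" "{P \<in> S. \<forall>x\<in>P. F x \<noteq> 0} \<subseteq> A"
        "form n d' G" "\<forall>x\<in>p. G x \<noteq> 0" "{P \<in> S. \<forall>x\<in>P. G x \<noteq> 0} \<subseteq> B" using Int by blast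
      show "\<exists>d F. form n d F \<and> (\<forall>x\<in>p. F x \<noteq> 0) \<and> {P \<in> S. \<forall>x\<in>P. F x \<noteq> 0} \<subseteq> A \<inter> B"
        by (rule exI, rule exI, rule conjI[OF form_mult[OF *(1,4)]]) (use * in auto)
    qed
  next
    case (UN K)
    show ?case
    proof
      assume "p \<in> \<Union>K"
      then obtain A where "A \<in> K" "p \<in> A" by blast
      then have "\<exists>d F. form n d F \<and> (\<forall>x\<in>p. F x \<noteq> 0) \<and> {P \<in> S. \<forall>x\<in>P. F x \<noteq> 0} \<subseteq> A"
        using UN.IH[of A] by simp
      then show "\<exists>d F. form n d F \<and> (\<forall>x\<in>p. F x \<noteq> 0) \<and> {P \<in> S. \<forall>x\<in>P. F x \<noteq> 0} \<subseteq> \<Union>K"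
        using Union_upper[OF \<open>A \<in> K\<close>] by (meson order_trans)
    qed
  next
    case (Basis s)
    then show ?case by blast
  qed
  then show ?thesis using assms(2) that by blast
qed

lemma regE:
  assumes "reg Y U f" "P \<in> U"
  obtains V where "openin (zar Y) V" "P \<in> V" "V \<subseteq> U" "form_quotient n V f"
  using assms unfolding reg_proj by blast

lemma reg_local:
  assumes "\<And>P. P \<in> U \<Longrightarrow> \<exists>V. P \<in> V \<and> V \<subseteq> U \<and> reg Y V f"
  shows "reg Y U f"
  unfolding reg_proj
proof
  fix P assume "P \<in> U"
  then obtain V where V: "P \<in> V" "V \<subseteq> U" "reg Y V f" using assms by blast
  obtain V' where "openin (zar Y) V'" "P \<in> V'" "V' \<subseteq> V" "form_quotient n V' f"
    by (rule regE[OF V(3,1)])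
  then show "\<exists>V. openin (zar Y) V \<and> P \<in> V \<and> V \<subseteq> U \<and> form_quotient n V f"
    using V(2) by blast
qed

lemma form_quotient_imp_reg:
  "openin (zar Y) V \<Longrightarrow> form_quotient n V f \<Longrightarrow> reg Y V f"
  unfolding reg_proj by blast

lemma reg_imp_openin:
  assumes "reg Y U f"
  shows "openin (zar Y) U"
proof (subst openin_subopen, rule ballI)
  fix P assume "P \<in> U"
  from regE[OF assms this] show "\<exists>T. openin (zar Y) T \<and> P \<in> T \<and> T \<subseteq> U" by metis
qed

lemma reg_subset:
  assumes f: "reg Y U f" and W: "openin (zar Y) W" "W \<subseteq> U"
  shows "reg Y W f"
proof (rule reg_local)
  fix P assume P: "P \<in> W"
  then have "P \<in> U" using W by blast
  then obtain V where V: "openin (zar Y) V" "P \<in> V" "V \<subseteq> U" "form_quotient n V f"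
    by (rule regE[OF f])
  have "reg Y (V \<inter> W) f"
    by (rule form_quotient_imp_reg[OF openin_Int[OF V(1) W(1)] form_quotient_subset[OF V(4)]]) simp
  then show "\<exists>V. P \<in> V \<and> V \<subseteq> W \<and> reg Y V f"
    using V(2) P by (intro exI[of _ "V \<inter> W"]) simp
qed

lemma reg_cong:
  assumes "reg Y U f" "\<And>P. P \<in> U \<Longrightarrow> f P = g P"
  shows "reg Y U g"
  unfolding reg_proj
proof
  fix P assume "P \<in> U"
  then obtain V where V: "openin (zar Y) V" "P \<in> V" "V \<subseteq> U" "form_quotient n V f"
    by (rule regE[OF assms(1)])
  have "form_quotient n V g" by (rule form_quotient_cong[OF V(4)]) (use assms(2) V(3) in blast)
  then show "\<exists>V. openin (zar Y) V \<and> P \<in> V \<and> V \<subseteq> U \<and> form_quotient n V g" using V by blast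
qed

lemma reg_const: "openin (zar Y) U \<Longrightarrow> reg Y U (\<lambda>_. c)"
  by (rule form_quotient_imp_reg[OF _ form_quotientI[where F = "\<lambda>_. c" and G = "\<lambda>_. 1"]]) (auto intro: form_const)

lemma reg_binop:
  assumes f: "reg Y U f" and g: "reg Y U g"
    and h: "\<And>V. V \<subseteq> U \<Longrightarrow> form_quotient n V f \<Longrightarrow> form_quotient n V g \<Longrightarrow> form_quotient n V h"
  shows "reg Y U h"
  unfolding reg_proj
proof
  fix P assume P: "P \<in> U"
  obtain V where V: "openin (zar Y) V" "P \<in> V" "V \<subseteq> U" "form_quotient n V f"
    by (rule regE[OF f P])
  obtain V' where V': "openin (zar Y) V'" "P \<in> V'" "V' \<subseteq> U" "form_quotient n V' g"
    by (rule regE[OF g P])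
  have "form_quotient n (V \<inter> V') h"
    by (rule h) (use V V' in \<open>auto intro: form_quotient_subset\<close>)
  then show "\<exists>V. openin (zar Y) V \<and> P \<in> V \<and> V \<subseteq> U \<and> form_quotient n V h"
    using V V' openin_Int[OF V(1) V'(1)] by (intro exI[of _ "V \<inter> V'"]) auto
qed

lemma reg_add:
  assumes "reg Y U f" "reg Y U g"
  shows "reg Y U (\<lambda>P. f P + g P)"
proof (rule reg_binop[OF assms])
  fix V assume f: "form_quotient n V f" and g: "form_quotient n V g"
  obtain d F G where F: "form n d F" "form n d G" "\<forall>Q\<in>V. \<forall>x\<in>Q. G x \<noteq> 0 \<and> f Q = F x / G x"
    by (rule form_quotientE[OF f])
  obtain d' F' G' where F': "form n d' F'" "form n d' G'" "\<forall>Q\<in>V. \<forall>x\<in>Q. G' x \<noteq> 0 \<and> g Q = F' x / G' x"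
    by (rule form_quotientE[OF g])
  have 2: "form n (d + d') (\<lambda>x. F' x * G x)" using form_mult[OF F'(1) F(2)] by (simp add: add.commute)
  show "form_quotient n V (\<lambda>P. f P + g P)"
    by (rule form_quotientI[OF form_add[OF form_mult[OF F(1) F'(2)] 2] form_mult[OF F(2) F'(2)]])
      (use F(3) F'(3) in \<open>simp add: add_divide_distrib\<close>)
qed

lemma reg_mult:
  assumes "reg Y U f" "reg Y U g"
  shows "reg Y U (\<lambda>P. f P * g P)"
proof (rule reg_binop[OF assms])
  fix V assume f: "form_quotient n V f" and g: "form_quotient n V g"
  obtain d F G where F: "form n d F" "form n d G" "\<forall>Q\<in>V. \<forall>x\<in>Q. G x \<noteq> 0 \<and> f Q = F x / G x"
    by (rule form_quotientE[OF f])
  obtain d' F' G' where F': "form n d' F'" "form n d' G'" "\<forall>Q\<in>V. \<forall>x\<in>Q. G' x \<noteq> 0 \<and> g Q = F' x / G' x"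
    by (rule form_quotientE[OF g])
  show "form_quotient n V (\<lambda>P. f P * g P)"
    by (rule form_quotientI[OF form_mult[OF F(1) F'(1)] form_mult[OF F(2) F'(2)]])
      (use F(3) F'(3) in simp)
qed

lemma reg_divide:
  assumes "reg Y U f" "reg Y U g" "\<And>P. P \<in> U \<Longrightarrow> g P \<noteq> 0"
  shows "reg Y U (\<lambda>P. f P / g P)"
proof (rule reg_binop[OF assms(1,2)])
  fix V assume f: "form_quotient n V f" and g: "form_quotient n V g" and V: "V \<subseteq> U"
  obtain d F G where F: "form n d F" "form n d G" "\<forall>Q\<in>V. \<forall>x\<in>Q. G x \<noteq> 0 \<and> f Q = F x / G x"
    by (rule form_quotientE[OF f])
  obtain d' F' G' where F': "form n d' F'" "form n d' G'" "\<forall>Q\<in>V. \<forall>x\<in>Q. G' x \<noteq> 0 \<and> g Q = F' x / G' x"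
    by (rule form_quotientE[OF g])
  show "form_quotient n V (\<lambda>P. f P / g P)"
  proof (rule form_quotientI[OF form_mult[OF F(1) F'(2)] form_mult[OF F(2) F'(1)]])
    fix Q x assume Q: "Q \<in> V" "x \<in> Q"
    then have "g Q \<noteq> 0" using V assms(3) by blast
    moreover have "G x \<noteq> 0 \<and> f Q = F x / G x" "G' x \<noteq> 0 \<and> g Q = F' x / G' x" using F(3) F'(3) Q by blast+
    ultimately show "G x * F' x \<noteq> 0 \<and> f Q / g Q = F x * G' x / (G x * F' x)" by simp
  qed
qed

text \<open>Points are sets of coordinate vectors. For an empty one, nonvanishing of the numerator
  on all its vectors would hold vacuously and say nothing about the value of f.\<close>

lemma openin_nonzero:
  assumes f: "reg Y U f" and ne: "\<And>P. P \<in> S \<Longrightarrow> P \<noteq> {}"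
  shows "openin (zar Y) {P \<in> U. f P \<noteq> 0}"
proof (subst openin_subopen, rule ballI)
  fix P assume P: "P \<in> {P \<in> U. f P \<noteq> 0}"
  then have "P \<in> U" by simp
  then obtain V where V: "openin (zar Y) V" "P \<in> V" "V \<subseteq> U" "form_quotient n V f"
    by (rule regE[OF f])
  obtain d F G where F: "form n d F" "form n d G" "\<forall>Q\<in>V. \<forall>x\<in>Q. G x \<noteq> 0 \<and> f Q = F x / G x"
    by (rule form_quotientE[OF V(4)])
  have VS: "V \<subseteq> S" using openin_subset[OF V(1)] by simp
  let ?W = "V \<inter> {P \<in> S. \<forall>x\<in>P. F x \<noteq> 0}"
  have "openin (zar Y) ?W" by (rule openin_Int[OF V(1) openin_basic[OF F(1)]])
  moreover have "P \<in> ?W" using V(2) F(3) VS P by fastforce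
  moreover have "?W \<subseteq> {P \<in> U. f P \<noteq> 0}"
  proof
    fix Q assume Q: "Q \<in> ?W"
    then obtain x where "x \<in> Q" using ne by blast
    then show "Q \<in> {P \<in> U. f P \<noteq> 0}" using Q V(3) F(3) by auto
  qed
  ultimately show "\<exists>T. openin (zar Y) T \<and> P \<in> T \<and> T \<subseteq> {P \<in> U. f P \<noteq> 0}" by blast
qed

end

lemma form_homogeneous: "form n d F \<Longrightarrow> F (\<lambda>i. c * x i) = c ^ d * F x"
  by (induction rule: form.induct) (simp_all add: algebra_simps power_add)

lemma pt_self: "x \<in> pt x"
  unfolding pt_def by (rule CollectI, rule exI[of _ 1]) simp

lemma ptE:
  assumes "y \<in> pt x"
  obtains c where "c \<noteq> 0" "y = (\<lambda>i. c * x i)"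
  using assms unfolding pt_def by blast

lemma mem_pt: "y \<in> pt x \<longleftrightarrow> (\<exists>c. c \<noteq> 0 \<and> y = (\<lambda>i. c * x i))"
  by (auto simp: pt_def)

lemma pt_scale: "c \<noteq> 0 \<Longrightarrow> pt (\<lambda>i. c * x i) = pt x"
proof (rule set_eqI)
  fix y assume c: "c \<noteq> 0"
  have 1: "y \<in> pt x" if h: "y \<in> pt (\<lambda>i. c * x i)"
  proof -
    obtain d where "d \<noteq> 0" "y = (\<lambda>i. d * (c * x i))" by (rule ptE[OF h])
    then show ?thesis using c unfolding mem_pt by (intro exI[of _ "d * c"]) (simp add: mult.assoc)
  qed
  have 2: "y \<in> pt (\<lambda>i. c * x i)" if h: "y \<in> pt x"
  proof -
    obtain d where "d \<noteq> 0" "y = (\<lambda>i. d * x i)" by (rule ptE[OF h])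
    then show ?thesis using c unfolding mem_pt by (intro exI[of _ "d / c"]) simp
  qed
  show "y \<in> pt (\<lambda>i. c * x i) \<longleftrightarrow> y \<in> pt x" using 1 2 by blast
qed

lemma nonzero_vecs_1: "y \<in> nonzero_vecs 1 \<longleftrightarrow> (\<forall>i>1. y i = 0) \<and> (y 0 \<noteq> 0 \<or> y 1 \<noteq> 0)"
proof -
  have "(\<exists>i. y i \<noteq> 0) \<longleftrightarrow> (y 0 \<noteq> 0 \<or> y 1 \<noteq> 0)" if "\<forall>i>1. y i = 0"
  proof
    assume "\<exists>i. y i \<noteq> 0"
    then obtain i where "y i \<noteq> 0" by blast
    moreover from this have "i = 0 \<or> i = 1" using that by (cases "i > 1") auto
    ultimately show "y 0 \<noteq> 0 \<or> y 1 \<noteq> 0" by auto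
  qed auto
  then show ?thesis unfolding nonzero_vecs_def by blast
qed

lemma tangentD:
  assumes "tangent X p v"
  shows "\<not> regular_at X p f \<Longrightarrow> v f = 0"
    "regular_at X p f \<Longrightarrow> regular_at X p g \<Longrightarrow> v (\<lambda>x. f x + g x) = v f + v g"
    "regular_at X p f \<Longrightarrow> regular_at X p g \<Longrightarrow> v (\<lambda>x. f x * g x) = f p * v g + g p * v f"
    "regular_at X p f \<Longrightarrow> v (\<lambda>x. c * f x) = c * v f"
    "openin (zar X) U \<Longrightarrow> p \<in> U \<Longrightarrow> regular_at X p f \<Longrightarrow> (\<And>x. x \<in> U \<Longrightarrow> f x = g x) \<Longrightarrow> v f = v g"
  using assms unfolding tangent_def by blast+

section \<open>The four affine charts of a scroll\<close>

locale scroll_surface =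
  fixes a0 a1 :: nat
  assumes a0: "0 < a0" and a1: "0 < a1"
begin

abbreviation X :: "((nat \<Rightarrow> 'k::field) set, 'k) fspace" where
  "X \<equiv> scroll a0 a1"

abbreviation pts :: "(nat \<Rightarrow> 'k::field) set set" where
  "pts \<equiv> scroll_points a0 a1"

abbreviation proj :: "(nat \<Rightarrow> 'k::field) set \<Rightarrow> (nat \<Rightarrow> 'k) set" where
  "proj \<equiv> scroll_proj a0 a1"

abbreviation Osh :: "int \<Rightarrow> int \<Rightarrow> ((nat \<Rightarrow> 'k::field) set, 'k, (nat \<Rightarrow> 'k) \<Rightarrow> (nat \<Rightarrow> 'k) \<Rightarrow> 'k) mod_sheaf" where
  "Osh \<equiv> scroll_O a0 a1"

definition adeg :: "nat \<Rightarrow> nat" where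
  "adeg l = (if l = 0 then a0 else a1)"

text \<open>\<open>corner j l\<close> is the index of the coordinate \<open>y\<^sub>j\<^sup>a\<^sup>l z\<^sub>l\<close>, and \<open>nbr j l\<close> that of
  \<open>y\<^sub>j\<^sup>a\<^sup>l\<^sup>-\<^sup>1 y\<^sub>1\<^sub>-\<^sub>j z\<^sub>l\<close>.\<close>

definition corner :: "nat \<Rightarrow> nat \<Rightarrow> nat" where
  "corner j l = l * (a0 + 1) + j * adeg l"

definition nbr :: "nat \<Rightarrow> nat \<Rightarrow> nat" where
  "nbr j l = l * (a0 + 1) + (if j = 0 then 1 else adeg l - 1)"

definition yv :: "nat \<Rightarrow> 'k::field \<Rightarrow> nat \<Rightarrow> 'k" where
  "yv j t = (\<lambda>i. if i = j then 1 else if i = 1 - j then t else 0)"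

definition xv :: "nat \<Rightarrow> nat \<Rightarrow> 'k::field \<times> 'k \<Rightarrow> nat \<Rightarrow> 'k" where
  "xv j l u = scroll_map a0 a1 (yv j (fst u)) (yv l (snd u))"

definition phi :: "nat \<Rightarrow> nat \<Rightarrow> 'k::field \<times> 'k \<Rightarrow> (nat \<Rightarrow> 'k) set" where
  "phi j l u = pt (xv j l u)"

definition chart :: "nat \<Rightarrow> nat \<Rightarrow> (nat \<Rightarrow> 'k::field) set set" where
  "chart j l = {P \<in> pts. \<forall>x\<in>P. x (corner j l) \<noteq> 0}"

text \<open>Both ratios are the same for all coordinate vectors of P, so the choice of x is
  immaterial. They are y_(1-j) / y_j and the fibre coordinate obtained after normalising y_j = z_l =
  1.\<close>

definition xi :: "nat \<Rightarrow> nat \<Rightarrow> (nat \<Rightarrow> 'k::field) set \<Rightarrow> 'k \<times> 'k" where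
  "xi j l P = (let x = (SOME x. x \<in> P) in (x (nbr j l) / x (corner j l), x (corner j (1 - l)) / x (corner j l)))"

lemma le_1_cases: "(j::nat) \<le> 1 \<Longrightarrow> (j = 0 \<Longrightarrow> P) \<Longrightarrow> (j = 1 \<Longrightarrow> P) \<Longrightarrow> P"
  by linarith

lemma adeg_pos [simp]: "adeg l > 0"
  by (simp add: adeg_def a0 a1)

lemma scroll_map_corner:
  "j \<le> 1 \<Longrightarrow> l \<le> 1 \<Longrightarrow> scroll_map a0 a1 y z (corner j l) = y j ^ adeg l * z l"
  by (erule le_1_cases; erule le_1_cases) (simp_all add: scroll_map_def corner_def adeg_def)

text \<open>Positivity of a0 and a1 enters here: a summand of degree 0 has no coordinate involving
  y_(1-j), from which the base coordinate could be read off.\<close>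

lemma scroll_map_nbr:
  "j \<le> 1 \<Longrightarrow> l \<le> 1 \<Longrightarrow> scroll_map a0 a1 y z (nbr j l) = y j ^ (adeg l - 1) * y (1 - j) * z l"
  using a0 a1 by (elim le_1_cases) (auto simp: scroll_map_def nbr_def adeg_def not_le)

lemma corner_le: "j \<le> 1 \<Longrightarrow> l \<le> 1 \<Longrightarrow> corner j l \<le> a0 + a1 + 1"
  by (erule le_1_cases; erule le_1_cases) (simp_all add: corner_def adeg_def)

lemma nbr_le: "j \<le> 1 \<Longrightarrow> l \<le> 1 \<Longrightarrow> nbr j l \<le> a0 + a1 + 1"
  using a0 a1 by (elim le_1_cases) (auto simp: nbr_def adeg_def)

lemma scroll_map_scale_fibre: "scroll_map a0 a1 y (\<lambda>i. d * z i) = (\<lambda>i. d * scroll_map a0 a1 y z i)"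
  by (auto simp: scroll_map_def)

text \<open>The torus relation behind all weights: with respect to scaling of the base vector, z_i
  has degree -a_i.\<close>

lemma scroll_map_scale_base:
  "scroll_map a0 a1 (\<lambda>i. c * y i) z = scroll_map a0 a1 y (\<lambda>i. c ^ adeg i * z i)"
proof
  fix i
  have pw: "(c * s) ^ m * (c * t) ^ k = c ^ (m + k) * (s ^ m * t ^ k)" for s t :: 'a and m k
    by (simp add: power_mult_distrib power_add)
  have "a0 + a1 + 1 - i + (i - (a0 + 1)) = a1" if "\<not> i \<le> a0" "i \<le> a0 + a1 + 1" using that by linarith
  then show "scroll_map a0 a1 (\<lambda>i. c * y i) z i = scroll_map a0 a1 y (\<lambda>i. c ^ adeg i * z i) i"
    unfolding scroll_map_def pw by (simp add: adeg_def)
qed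

lemma yv_simps [simp]: "yv j t j = 1" "j \<le> 1 \<Longrightarrow> yv j t (1 - j) = t" "yv 0 t 1 = t" "yv 1 t 0 = t"
  by (auto simp: yv_def elim: le_1_cases)

lemma yv_nonzero [simp]: "j \<le> 1 \<Longrightarrow> yv j t \<in> nonzero_vecs 1"
  by (erule le_1_cases) (auto simp: nonzero_vecs_1 yv_def)

lemma vec_eq_yv:
  assumes "j \<le> 1" "y \<in> nonzero_vecs 1" "y j \<noteq> 0"
  shows "y = (\<lambda>i. y j * yv j (y (1 - j) / y j) i)"
proof
  fix i
  have "i = j \<or> i = 1 - j \<or> i > 1" using assms(1) by linarith
  then show "y i = y j * yv j (y (1 - j) / y j) i"
    using assms by (auto simp: nonzero_vecs_1 yv_def)
qed

lemma xv_corner [simp]: "j \<le> 1 \<Longrightarrow> l \<le> 1 \<Longrightarrow> xv j l u (corner j l) = 1"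
  by (simp add: xv_def scroll_map_corner)

lemma xv_nbr: "j \<le> 1 \<Longrightarrow> l \<le> 1 \<Longrightarrow> xv j l u (nbr j l) = fst u"
  by (simp add: xv_def scroll_map_nbr)

lemma xv_opposite_corner: "j \<le> 1 \<Longrightarrow> l \<le> 1 \<Longrightarrow> xv j l u (corner j (1 - l)) = snd u"
  by (simp add: xv_def scroll_map_corner)

text \<open>Scaling y_j to 1 multiplies z_i by y_j^(a_i); then z_l is scaled to 1. The scalar left
  in front does not change the point.\<close>

lemma scroll_map_normal_form:
  assumes j: "j \<le> 1" and l: "l \<le> 1" and y: "y \<in> nonzero_vecs 1" and z: "z \<in> nonzero_vecs 1"
    and nz: "y j \<noteq> 0" "z l \<noteq> 0"
  shows "scroll_map a0 a1 y z = (\<lambda>i. y j ^ adeg l * z l *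
    xv j l (y (1 - j) / y j, (y j ^ adeg (1 - l) * z (1 - l)) / (y j ^ adeg l * z l)) i)"
proof -
  define z' where "z' = (\<lambda>i. y j ^ adeg i * z i)"
  have z': "z' \<in> nonzero_vecs 1" "z' l \<noteq> 0" using z nz by (auto simp: z'_def nonzero_vecs_1)
  have "scroll_map a0 a1 y z = scroll_map a0 a1 (yv j (y (1 - j) / y j)) z'"
    by (subst vec_eq_yv[OF j y nz(1)]) (simp add: scroll_map_scale_base z'_def)
  also have "\<dots> = (\<lambda>i. z' l * scroll_map a0 a1 (yv j (y (1 - j) / y j)) (yv l (z' (1 - l) / z' l)) i)"
    by (subst vec_eq_yv[OF l z']) (simp add: scroll_map_scale_fibre)
  finally show ?thesis by (simp add: xv_def z'_def)
qed

lemma X_proj: "X = proj_variety (a0 + a1 + 1) pts"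
  by (simp add: scroll_def)

lemma topspace_X [simp]: "topspace (zar X) = pts"
  by (simp add: X_proj)

lemma points_nonempty: "P \<in> pts \<Longrightarrow> P \<noteq> {}"
  using pt_self by (auto simp: scroll_points_def)

lemma scroll_pointsE:
  assumes "P \<in> pts"
  obtains y z where "P = pt (scroll_map a0 a1 y z)" "y \<in> nonzero_vecs 1" "z \<in> nonzero_vecs 1"
  using assms unfolding scroll_points_def by blast

lemma chart_subset: "chart j l \<subseteq> pts"
  by (auto simp: chart_def)

lemma pt_in_chart: "pt x \<in> chart j l \<longleftrightarrow> pt x \<in> pts \<and> x (corner j l) \<noteq> 0"
proof -
  have "(\<forall>y\<in>pt x. y i \<noteq> 0) \<longleftrightarrow> x i \<noteq> 0" for i
    using pt_self[of x] by (auto elim: ptE)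
  then show ?thesis by (simp add: chart_def)
qed

lemma phi_in_chart [simp]: "j \<le> 1 \<Longrightarrow> l \<le> 1 \<Longrightarrow> phi j l u \<in> chart j l"
proof -
  assume jl: "j \<le> 1" "l \<le> 1"
  have "phi j l u \<in> pts"
    unfolding phi_def xv_def scroll_points_def
    by (intro CollectI exI conjI) (rule refl yv_nonzero jl)+
  then show ?thesis using jl by (simp add: pt_in_chart phi_def)
qed

lemma openin_chart [simp]: "j \<le> 1 \<Longrightarrow> l \<le> 1 \<Longrightarrow> openin (zar X) (chart j l)"
  unfolding X_proj chart_def by (rule openin_basic[OF form_coord]) (rule corner_le)

lemma chart_is_phi:
  assumes "j \<le> 1" "l \<le> 1" "P \<in> chart j l"
  obtains u where "P = phi j l u"
proof -
  obtain y z where P: "P = pt (scroll_map a0 a1 y z)" and yz: "y \<in> nonzero_vecs 1" "z \<in> nonzero_vecs 1"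
    by (rule scroll_pointsE[OF subsetD[OF chart_subset assms(3)]])
  have "scroll_map a0 a1 y z (corner j l) \<noteq> 0" using assms(3) unfolding P pt_in_chart by blast
  then have nz: "y j \<noteq> 0" "z l \<noteq> 0" using assms by (auto simp: scroll_map_corner)
  define u where "u = (y (1 - j) / y j, (y j ^ adeg (1 - l) * z (1 - l)) / (y j ^ adeg l * z l))"
  define c where "c = y j ^ adeg l * z l"
  have "scroll_map a0 a1 y z = (\<lambda>i. c * xv j l u i)"
    unfolding u_def c_def by (rule scroll_map_normal_form[OF assms(1,2) yz nz])
  moreover have "c \<noteq> 0" using nz by (simp add: c_def)
  ultimately have "P = phi j l u" unfolding P phi_def by (simp add: pt_scale)
  then show ?thesis by (rule that)
qed

lemma points_covered:
  assumes "P \<in> pts"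
  obtains j l where "j \<le> 1" "l \<le> 1" "P \<in> chart j l"
proof -
  obtain y z where P: "P = pt (scroll_map a0 a1 y z)" and yz: "y \<in> nonzero_vecs 1" "z \<in> nonzero_vecs 1"
    by (rule scroll_pointsE[OF assms])
  have ex: "\<exists>j\<le>1. y j \<noteq> 0" if "y \<in> nonzero_vecs 1" for y :: "nat \<Rightarrow> 'a"
  proof (cases "y 0 = 0")
    case True
    then show ?thesis using that by (intro exI[of _ 1]) (simp add: nonzero_vecs_1)
  qed (use zero_le in blast)
  obtain j where j: "j \<le> 1" "y j \<noteq> 0" using ex[OF yz(1)] by blast
  obtain l where l: "l \<le> 1" "z l \<noteq> 0" using ex[OF yz(2)] by blast
  note jl = j(1) l(1) j(2) l(2)
  then have "P \<in> chart j l" using assms unfolding P pt_in_chart by (simp add: scroll_map_corner)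
  then show ?thesis using that jl by blast
qed

lemma xi_phi [simp]:
  assumes "j \<le> 1" "l \<le> 1"
  shows "xi j l (phi j l u) = u"
proof -
  define x where "x = (SOME x. x \<in> phi j l u)"
  have "x \<in> pt (xv j l u)" unfolding x_def phi_def by (rule someI[of _ "xv j l u"]) (rule pt_self)
  then obtain c where "c \<noteq> 0" "x = (\<lambda>i. c * xv j l u i)" by (rule ptE)
  then show ?thesis
    using assms by (simp add: xi_def x_def[symmetric] Let_def xv_nbr xv_opposite_corner)
qed

lemma phi_xi: "j \<le> 1 \<Longrightarrow> l \<le> 1 \<Longrightarrow> P \<in> chart j l \<Longrightarrow> phi j l (xi j l P) = P"
proof -
  assume jl: "j \<le> 1" "l \<le> 1" and P: "P \<in> chart j l"
  obtain u where "P = phi j l u" by (rule chart_is_phi[OF jl P])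
  then show ?thesis using jl by simp
qed

lemma phi_inj [simp]: "j \<le> 1 \<Longrightarrow> l \<le> 1 \<Longrightarrow> phi j l u = phi j l v \<longleftrightarrow> u = v"
proof
  assume jl: "j \<le> 1" "l \<le> 1" and e: "phi j l u = phi j l v"
  show "u = v" using arg_cong[OF e, of "xi j l"] unfolding xi_phi[OF jl] .
qed simp

lemma scroll_proj_phi: "j \<le> 1 \<Longrightarrow> l \<le> 1 \<Longrightarrow> proj (phi j l u) = pt (yv j (fst u))"
  unfolding phi_def xv_def by (rule scroll_proj_pt) (simp_all add: a0 a1)

section \<open>Each chart is isomorphic to the affine plane, with matching open sets and regular
  functions\<close>

lemma xv_poly: "j \<le> 1 \<Longrightarrow> l \<le> 1 \<Longrightarrow> \<exists>P. \<forall>u. xv j l u i = ev P u"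
proof -
  have y: "\<exists>P. \<forall>u::'a \<times> 'a. yv j (fst u) i = ev P u" for j i
    unfolding yv_def
    by (rule exI[of _ "if i = j then 1 else if i = 1 - j then [:[:0, 1:]:] else 0"]) simp
  have z: "\<exists>P. \<forall>u::'a \<times> 'a. yv l (snd u) i = ev P u" for l i
    unfolding yv_def
    by (rule exI[of _ "if i = l then 1 else if i = 1 - l then [:0, 1:] else 0"]) simp
  obtain Y0 Y1 Z0 Z1 where *: "\<And>u::'a \<times> 'a. yv j (fst u) 0 = ev Y0 u" "\<And>u::'a \<times> 'a. yv j (fst u) 1 = ev Y1 u"
    "\<And>u::'a \<times> 'a. yv l (snd u) 0 = ev Z0 u" "\<And>u::'a \<times> 'a. yv l (snd u) 1 = ev Z1 u"
    using y[of j 0] y[of j 1] z[of l 0] z[of l 1] by metis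
  show ?thesis
    unfolding xv_def scroll_map_def *
    by (rule exI[of _ "if i \<le> a0 then Y0 ^ (a0 - i) * Y1 ^ i * Z0
     else if i \<le> a0 + a1 + 1 then Y0 ^ (a0 + a1 + 1 - i) * Y1 ^ (i - (a0 + 1)) * Z1 else 0"]) simp
qed

lemma form_poly:
  assumes "j \<le> 1" "l \<le> 1"
  shows "form n d F \<Longrightarrow> \<exists>P. \<forall>u. F (xv j l u) = ev P u"
proof (induction rule: form.induct)
  case (form_const c)
  show ?case by (rule exI[of _ "[:[:c:]:]"]) simp
next
  case (form_coord i)
  show ?case by (rule xv_poly[OF assms])
next
  case (form_add d F G)
  then obtain P Q where "\<forall>u. F (xv j l u) = ev P u" "\<forall>u. G (xv j l u) = ev Q u" by blast
  then show ?case by (intro exI[of _ "P + Q"]) simp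
next
  case (form_mult d F d' G)
  then obtain P Q where "\<forall>u. F (xv j l u) = ev P u" "\<forall>u. G (xv j l u) = ev Q u" by blast
  then show ?case by (intro exI[of _ "P * Q"]) simp
qed

lemma aopen_pullback:
  assumes jl: "j \<le> 1" "l \<le> 1" and U: "openin (zar X) U"
  shows "aopen {u. phi j l u \<in> U}"
  unfolding aopen_def
proof
  fix u assume "u \<in> {u. phi j l u \<in> U}"
  then obtain d F where F: "form (a0 + a1 + 1) d F" "\<forall>x\<in>phi j l u. F x \<noteq> 0"
      "{P \<in> pts. \<forall>x\<in>P. F x \<noteq> 0} \<subseteq> U"
    using openin_proj_basic[OF U[unfolded X_proj]] by blast
  obtain Q where "\<forall>u. F (xv j l u) = ev Q u" using form_poly[OF jl F(1)] by blast
  then have Q: "F (xv j l u) = ev Q u" for u by blast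
  have "phi j l v \<in> U" if "ev Q v \<noteq> 0" for v
  proof -
    have "\<forall>x\<in>phi j l v. F x \<noteq> 0"
      using that by (auto simp: phi_def form_homogeneous[OF F(1)] Q elim: ptE)
    then show ?thesis using F(3) phi_in_chart[OF jl, of v] chart_subset by blast
  qed
  moreover have "ev Q u \<noteq> 0" using F(2) pt_self by (auto simp: phi_def Q[symmetric])
  ultimately show "\<exists>Q. ev Q u \<noteq> 0 \<and> (\<forall>v. ev Q v \<noteq> 0 \<longrightarrow> v \<in> {u. phi j l u \<in> U})" by blast
qed

lemma areg_pullback:
  assumes jl: "j \<le> 1" "l \<le> 1" and f: "reg X U f"
  shows "areg {u. phi j l u \<in> U} (\<lambda>u. f (phi j l u))"
proof (rule aregI)
  show "aopen {u. phi j l u \<in> U}"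
    by (rule aopen_pullback[OF jl]) (use f reg_imp_openin X_proj in metis)
  fix u assume "u \<in> {u. phi j l u \<in> U}"
  then have "phi j l u \<in> U" by simp
  then obtain V where V: "openin (zar X) V" "phi j l u \<in> V" "V \<subseteq> U" "form_quotient (a0 + a1 + 1) V f"
    unfolding X_proj by (rule regE[OF f[unfolded X_proj]])
  obtain d F G where F: "form (a0 + a1 + 1) d F" "form (a0 + a1 + 1) d G"
    "\<forall>Q\<in>V. \<forall>x\<in>Q. G x \<noteq> 0 \<and> f Q = F x / G x" by (rule form_quotientE[OF V(4)])
  obtain P where P: "\<forall>u. F (xv j l u) = ev P u" using form_poly[OF jl F(1)] by blast
  obtain Q where Q: "\<forall>u. G (xv j l u) = ev Q u" using form_poly[OF jl F(2)] by blast
  have "u \<in> {u. phi j l u \<in> V}" using V(2) by simp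
  then obtain R where R: "ev R u \<noteq> 0" "\<And>v. ev R v \<noteq> 0 \<Longrightarrow> v \<in> {u. phi j l u \<in> V}"
    by (rule aopenE[OF aopen_pullback[OF jl V(1)]]) blast
  have val: "ev Q v \<noteq> 0 \<and> f (phi j l v) = ev P v / ev Q v" if "ev R v \<noteq> 0" for v
  proof -
    have "phi j l v \<in> V" using R(2)[OF that] by simp
    then have "G (xv j l v) \<noteq> 0 \<and> f (phi j l v) = F (xv j l v) / G (xv j l v)"
      using F(3) pt_self[of "xv j l v"] unfolding phi_def by blast
    then show ?thesis using P Q by simp
  qed
  \<comment> \<open>Expanding by R confines the fraction to the part of the plane over V, since
    \<open>rep\<close> demands validity wherever the denominator is nonzero.\<close>
  have "rep (\<lambda>u. f (phi j l u)) u (P * R) (Q * R)"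
    unfolding rep_def using val R(1) by auto
  then show "\<exists>P Q. rep (\<lambda>u. f (phi j l u)) u P Q" by blast
qed

text \<open>A coordinate x_i over the corner coordinate is a quotient of linear forms. Applied to
  the neighbouring and the opposite corner coordinate, this makes both chart coordinates
  regular.\<close>

lemma reg_chart_quotient:
  fixes h :: "'k::field \<times> 'k \<Rightarrow> 'k"
  assumes jl: "j \<le> 1" "l \<le> 1" and i: "i \<le> a0 + a1 + 1"
    and val: "\<And>u. xv j l u i = h u"
  shows "reg X (chart j l) (\<lambda>P. h (xi j l P))"
  unfolding X_proj
proof (rule form_quotient_imp_reg[OF _ form_quotientI[OF form_coord form_coord]])
  show "openin (zar (proj_variety (a0 + a1 + 1) pts)) (chart j l)"
    using openin_chart[OF jl] by (simp add: X_proj)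
  show "i \<le> a0 + a1 + 1" "corner j l \<le> a0 + a1 + 1" using i corner_le jl by auto
  fix Q :: "(nat \<Rightarrow> 'k) set" and x assume Q: "Q \<in> chart j l" and x: "x \<in> Q"
  obtain u where u: "Q = phi j l u" by (rule chart_is_phi[OF jl Q])
  obtain c where "c \<noteq> 0" "x = (\<lambda>i. c * xv j l u i)" using x unfolding u phi_def by (rule ptE)
  then show "x (corner j l) \<noteq> 0 \<and> h (xi j l Q) = x i / x (corner j l)"
    using jl by (simp add: u val)
qed

lemma reg_xi:
  assumes "j \<le> 1" "l \<le> 1"
  shows "reg X (chart j l) (\<lambda>P. fst (xi j l P))" "reg X (chart j l) (\<lambda>P. snd (xi j l P))"
  by (rule reg_chart_quotient[OF assms nbr_le[OF assms] xv_nbr[OF assms]])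
    (rule reg_chart_quotient[OF assms _ xv_opposite_corner[OF assms]], use assms in \<open>simp add: corner_le\<close>)

lemmas reg_X_const = reg_const[where S = "pts" and n = "a0 + a1 + 1", folded X_proj]
  and reg_X_add = reg_add[where S = "pts" and n = "a0 + a1 + 1", folded X_proj]
  and reg_X_mult = reg_mult[where S = "pts" and n = "a0 + a1 + 1", folded X_proj]
  and reg_X_divide = reg_divide[where S = "pts" and n = "a0 + a1 + 1", folded X_proj]
  and reg_X_cong = reg_cong[where S = "pts" and n = "a0 + a1 + 1", folded X_proj]
  and reg_X_subset = reg_subset[where S = "pts" and n = "a0 + a1 + 1", folded X_proj]
  and reg_X_local = reg_local[where S = "pts" and n = "a0 + a1 + 1", folded X_proj]
  and reg_X_imp_openin = reg_imp_openin[where S = "pts" and n = "a0 + a1 + 1", folded X_proj]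
  and openin_X_nonzero = openin_nonzero[where S = "pts" and n = "a0 + a1 + 1", folded X_proj, OF _ points_nonempty]

lemma reg_ev_xi:
  assumes jl: "j \<le> 1" "l \<le> 1"
  shows "reg X (chart j l) (\<lambda>P. ev Q (xi j l P))"
proof (induction Q)
  case 0
  show ?case using reg_X_const[OF openin_chart[OF jl], of 0] by simp
next
  case (pCons p Q)
  have "reg X (chart j l) (\<lambda>P. poly p (fst (xi j l P)))"
  proof (induction p)
    case 0
    show ?case using reg_X_const[OF openin_chart[OF jl], of 0] by simp
  next
    case (pCons c p)
    then show ?case
      using reg_X_add[OF reg_X_const[OF openin_chart[OF jl], of c] reg_X_mult[OF reg_xi(1)[OF jl] pCons.IH]] by simp
  qed
  then show ?case
    using reg_X_add[OF _ reg_X_mult[OF reg_xi(2)[OF jl] pCons.IH]] by (simp add: ev_pCons)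
qed

lemma openin_phi_image:
  assumes jl: "j \<le> 1" "l \<le> 1" and W: "aopen W"
  shows "openin (zar X) (phi j l ` W)"
proof (subst openin_subopen, rule ballI)
  fix P assume "P \<in> phi j l ` W"
  then obtain u where u: "u \<in> W" "P = phi j l u" by blast
  obtain Q where Q: "ev Q u \<noteq> 0" "\<And>v. ev Q v \<noteq> 0 \<Longrightarrow> v \<in> W" by (rule aopenE[OF W u(1)]) blast
  let ?T = "{P \<in> chart j l. ev Q (xi j l P) \<noteq> 0}"
  have "openin (zar X) ?T" by (rule openin_X_nonzero[OF reg_ev_xi[OF jl]])
  moreover have "P \<in> ?T" using u Q jl by simp
  moreover have "?T \<subseteq> phi j l ` W"
  proof
    fix R assume R: "R \<in> ?T"
    then have "phi j l (xi j l R) = R" using phi_xi[OF jl] by blast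
    then show "R \<in> phi j l ` W" using R Q(2) by (metis (mono_tags, lifting) imageI mem_Collect_eq)
  qed
  ultimately show "\<exists>T. openin (zar X) T \<and> P \<in> T \<and> T \<subseteq> phi j l ` W" by blast
qed

lemma reg_pushforward:
  assumes jl: "j \<le> 1" "l \<le> 1" and g: "areg W g"
  shows "reg X (phi j l ` W) (\<lambda>P. g (xi j l P))"
proof (rule reg_X_local)
  fix P assume "P \<in> phi j l ` W"
  then obtain u where u: "u \<in> W" "P = phi j l u" by blast
  obtain A B where r: "rep g u A B" "\<And>v. ev B v \<noteq> 0 \<Longrightarrow> v \<in> W" by (rule aregE[OF g u(1)]) blast
  let ?V = "phi j l ` {v. ev B v \<noteq> 0}"
  have V: "openin (zar X) ?V" by (rule openin_phi_image[OF jl aopen_ev])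
  have sub: "?V \<subseteq> chart j l" using phi_in_chart[OF jl] by blast
  have "reg X ?V (\<lambda>P. ev A (xi j l P) / ev B (xi j l P))"
    by (rule reg_X_divide) (use jl reg_X_subset[OF reg_ev_xi[OF jl] V sub] in auto)
  then have "reg X ?V (\<lambda>P. g (xi j l P))"
    by (rule reg_X_cong) (use r(1) jl in \<open>auto simp: rep_def\<close>)
  moreover have "P \<in> ?V" using u r by (auto simp: rep_def)
  moreover have "?V \<subseteq> phi j l ` W" using r by auto
  ultimately show "\<exists>V. P \<in> V \<and> V \<subseteq> phi j l ` W \<and> reg X V (\<lambda>P. g (xi j l P))"
    by (intro exI[of _ ?V] conjI)
qed

lemma regular_at_pullback:
  assumes jl: "j \<le> 1" "l \<le> 1" and f: "regular_at X (phi j l u) f"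
  obtains W where "u \<in> W" "areg W (\<lambda>u. f (phi j l u))"
proof -
  obtain U where U: "phi j l u \<in> U" "reg X U f" using f by (auto simp: regular_at_def)
  show ?thesis by (rule that[OF _ areg_pullback[OF jl U(2)]]) (use U in simp)
qed

lemma regular_at_pushforward:
  assumes jl: "j \<le> 1" "l \<le> 1" and "areg W g" "u \<in> W"
  shows "regular_at X (phi j l u) (\<lambda>P. g (xi j l P))"
  unfolding regular_at_def
  using reg_pushforward[OF jl assms(3)] reg_X_imp_openin assms(4) by blast

lemma reg_imp_regular_at: "reg X U f \<Longrightarrow> p \<in> U \<Longrightarrow> regular_at X p f"
  unfolding regular_at_def using reg_X_imp_openin by blast

text \<open>The value dt(v) for \<open>i = 0\<close> and dw(v) otherwise.\<close>

definition tc :: "nat \<Rightarrow> nat \<Rightarrow> nat \<Rightarrow> ((nat \<Rightarrow> 'k::field) set, 'k) tvec \<Rightarrow> 'k" where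
  "tc j l i v = v (\<lambda>P. if i = 0 then fst (xi j l P) else snd (xi j l P))"

text \<open>Pulled back to the plane, v becomes a point derivation there, and
  \<open>dd_total\<close> applies.\<close>

lemma tangent_chart:
  fixes v :: "((nat \<Rightarrow> 'k::field_char_0) set, 'k) tvec"
  assumes jl: "j \<le> 1" "l \<le> 1" and v: "tangent X (phi j l u) v" and f: "regular_at X (phi j l u) f"
  shows "v f = dd 0 (\<lambda>u. f (phi j l u)) u * tc j l 0 v + dd 1 (\<lambda>u. f (phi j l u)) u * tc j l 1 v"
proof -
  note T = tangentD[OF v]
  note R = regular_at_pushforward[OF jl]
  obtain W where W: "u \<in> W" "areg W (\<lambda>u. f (phi j l u))" by (rule regular_at_pullback[OF jl f])
  define v' where "v' = (\<lambda>g. v (\<lambda>P. g (xi j l P)))"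
  have "v' (\<lambda>u. f (phi j l u)) = dd 0 (\<lambda>u. f (phi j l u)) u * v' fst + dd 1 (\<lambda>u. f (phi j l u)) u * v' snd"
  proof (rule dd_total[OF _ _ _ _ W(2,1)])
    show "v' (\<lambda>x. f x + g x) = v' f + v' g" if "areg U f" "areg U g" "u \<in> U" for U f g
      unfolding v'_def by (rule T(2)) (use R that in blast)+
    show "v' (\<lambda>x. f x * g x) = f u * v' g + g u * v' f" if "areg U f" "areg U g" "u \<in> U" for U f g
      using T(3)[OF R[OF that(1,3)] R[OF that(2,3)]] jl by (simp add: v'_def)
    show "v' f = v' g" if h: "areg U f" "u \<in> U" "\<And>x. x \<in> U \<Longrightarrow> f x = g x" for U f g
      unfolding v'_def
      by (rule T(5)[OF openin_phi_image[OF jl areg_imp_aopen[OF h(1)]] _ R[OF h(1,2)]]) (use h jl in auto)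
    have 1: "regular_at X (phi j l u) (\<lambda>_. 1)"
      using R[OF areg_const[OF aopen_UNIV], of u 1] by simp
    have "v (\<lambda>_. 1) = 0" using T(3)[OF 1 1] by simp
    then show "v' (\<lambda>_. c) = 0" for c using T(4)[OF 1, of c] by (simp add: v'_def)
  qed
  \<comment> \<open>f and its version in chart coordinates agree on the chart only, so this is the
    locality of v.\<close>
  moreover have "v' (\<lambda>u. f (phi j l u)) = v f"
    unfolding v'_def
    by (rule T(5)[OF openin_chart[OF jl], symmetric]) (use f jl in \<open>auto simp: phi_xi\<close>)
  ultimately show ?thesis by (simp add: v'_def tc_def)
qed

text \<open>The witness is \<alpha> d/dt + \<beta> d/dw. It allows coefficients of forms to be
  isolated by evaluation on suitable tangent vectors.\<close>

lemma tangent_exists: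
  fixes \<alpha> \<beta> :: "'k::field_char_0"
  assumes jl: "j \<le> 1" "l \<le> 1"
  obtains v where "tangent X (phi j l u) v" "tc j l 0 v = \<alpha>" "tc j l 1 v = \<beta>"
proof -
  let ?p = "phi j l u"
  let ?d = "\<lambda>i f. dd i (\<lambda>u. f (phi j l u)) u"
  define v where "v = (\<lambda>f. if regular_at X ?p f then \<alpha> * ?d 0 f + \<beta> * ?d 1 f else 0)"
  have reg2: "\<exists>W. u \<in> W \<and> areg W (\<lambda>u. f (phi j l u)) \<and> areg W (\<lambda>u. g (phi j l u)) \<and>
      phi j l ` W \<subseteq> U \<and> phi j l ` W \<subseteq> U'" if "u \<in> {u. phi j l u \<in> U \<inter> U'}" "reg X U f" "reg X U' g" for f g U U'
  proof -
    have "aopen {u. phi j l u \<in> U \<inter> U'}"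
      by (rule aopen_pullback[OF jl openin_Int]) (use that reg_X_imp_openin in auto)
    then show ?thesis using that areg_subset[OF areg_pullback[OF jl that(2)]]  areg_subset[OF areg_pullback[OF jl that(3)]]
      by (intro exI[of _ "{u. phi j l u \<in> U \<inter> U'}"]) auto
  qed
  have both: "\<exists>W. u \<in> W \<and> areg W (\<lambda>u. f (phi j l u)) \<and> areg W (\<lambda>u. g (phi j l u)) \<and>
      regular_at X ?p (\<lambda>P. f P + g P) \<and> regular_at X ?p (\<lambda>P. f P * g P)"
    if fg: "regular_at X ?p f" "regular_at X ?p g" for f g
  proof -
    obtain U U' where U: "?p \<in> U" "reg X U f" "?p \<in> U'" "reg X U' g" using fg unfolding regular_at_def by blast
    have o: "openin (zar X) (U \<inter> U')" using U reg_X_imp_openin by blast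
    have r: "reg X (U \<inter> U') f" "reg X (U \<inter> U') g" using reg_X_subset[OF _ o] U by auto
    have "regular_at X ?p (\<lambda>P. f P + g P)" "regular_at X ?p (\<lambda>P. f P * g P)"
      using reg_imp_regular_at[OF reg_X_add[OF r]] reg_imp_regular_at[OF reg_X_mult[OF r]] U by auto
    then show ?thesis using reg2[OF _ U(2,4)] U by auto
  qed
  have "tangent X ?p v"
    unfolding tangent_def
  proof (intro conjI allI impI)
    show "v f = 0" if "\<not> regular_at X ?p f" for f using that by (simp add: v_def)
    fix f g assume fg: "regular_at X ?p f \<and> regular_at X ?p g"
    then obtain W where W: "u \<in> W" "areg W (\<lambda>u. f (phi j l u))" "areg W (\<lambda>u. g (phi j l u))"
      "regular_at X ?p (\<lambda>P. f P + g P)" "regular_at X ?p (\<lambda>P. f P * g P)" using both by blast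
    show "v (\<lambda>x. f x + g x) = v f + v g"
      using fg W(4) by (simp add: v_def dd_add[OF W(2,3,1)] algebra_simps)
    show "v (\<lambda>x. f x * g x) = f ?p * v g + g ?p * v f"
      using fg W(5) by (simp add: v_def dd_mult[OF W(2,3,1)] algebra_simps)
  next
    fix c f assume f: "regular_at X ?p f"
    have c: "regular_at X ?p (\<lambda>_. c)"
      using regular_at_pushforward[OF jl areg_const[OF aopen_UNIV], of u c] by simp
    obtain W where W: "u \<in> W" "areg W (\<lambda>u. f (phi j l u))"
      "regular_at X ?p (\<lambda>P. c * f P)" using both[OF c f] by blast
    show "v (\<lambda>x. c * f x) = c * v f"
      using f W(3) dd_mult[OF areg_const[OF areg_imp_aopen[OF W(2)], of c] W(2,1)]
      by (simp add: v_def algebra_simps)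
  next
    fix U f g assume *: "openin (zar X) U \<and> ?p \<in> U \<and> regular_at X ?p f \<and> (\<forall>x\<in>U. f x = g x)"
    then obtain U' where U': "?p \<in> U'" "reg X U' f" by (auto simp: regular_at_def)
    have o: "openin (zar X) (U \<inter> U')" using * U' reg_X_imp_openin by blast
    have rf: "reg X (U \<inter> U') f" by (rule reg_X_subset[OF U'(2) o]) simp
    have rg: "reg X (U \<inter> U') g" by (rule reg_X_cong[OF rf]) (use * in auto)
    have "?d i f = ?d i g" for i
      by (rule dd_cong[OF areg_pullback[OF jl rf]]) (use * U' in auto)
    \<comment> \<open>Since v is 0 on functions that are not regular at the point, locality also
      requires regularity of g.\<close>
    moreover have "regular_at X ?p g" using reg_imp_regular_at[OF rg] * U' by blast
    ultimately show "v f = v g" using * by (simp add: v_def)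
  qed
  moreover have "tc j l 0 v = \<alpha>" "tc j l 1 v = \<beta>"
    using regular_at_pushforward[OF jl areg_fst[OF aopen_UNIV], of u]
      regular_at_pushforward[OF jl areg_snd[OF aopen_UNIV], of u] dd_fst[of _ u] dd_snd[of _ u] jl
    by (simp_all add: v_def tc_def)
  ultimately show ?thesis by (rule that)
qed

section \<open>Differential forms in a chart\<close>

abbreviation wedge :: "nat \<Rightarrow> nat \<Rightarrow> ((nat \<Rightarrow> 'k::field) set, 'k) tvec \<Rightarrow> ((nat \<Rightarrow> 'k) set, 'k) tvec \<Rightarrow> 'k" where
  "wedge j l v w \<equiv> tc j l 0 v * tc j l 1 w - tc j l 0 w * tc j l 1 v"

definition coord :: "nat \<Rightarrow> nat \<Rightarrow> nat \<Rightarrow> (nat \<Rightarrow> 'k::field) set \<Rightarrow> 'k" where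
  "coord j l i P = (if i = 0 then fst (xi j l P) else snd (xi j l P))"

lemma tc_coord: "v (coord j l i) = tc j l i v"
  unfolding tc_def coord_def ..

lemma areg_pullback_subset:
  assumes jl: "j \<le> 1" "l \<le> 1" and f: "reg X V f" and W: "aopen W" "\<And>w. w \<in> W \<Longrightarrow> phi j l w \<in> V"
  shows "areg W (\<lambda>u. f (phi j l u))"
  by (rule areg_subset[OF areg_pullback[OF jl f] W(1)]) (use W(2) in auto)

lemma tangent_chart':
  fixes v :: "((nat \<Rightarrow> 'k::field_char_0) set, 'k) tvec"
  assumes "j \<le> 1" "l \<le> 1" and "tangent X (phi j l u) v" and "reg X V f" "phi j l u \<in> V"
  shows "v f = dd 0 (\<lambda>u. f (phi j l u)) u * tc j l 0 v + dd 1 (\<lambda>u. f (phi j l u)) u * tc j l 1 v"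
  by (rule tangent_chart[OF assms(1-3) reg_imp_regular_at[OF assms(4,5)]])

lemma sum_1form_chart:
  fixes v :: "((nat \<Rightarrow> 'k::field_char_0) set, 'k) tvec" and n :: nat
  assumes jl: "j \<le> 1" "l \<le> 1" and v: "tangent X (phi j l u) v" and u: "phi j l u \<in> V"
    and f: "\<And>i. i < n \<Longrightarrow> reg X V (f i)"
  shows "(\<Sum>i<n. c i * v (f i)) =
    (\<Sum>i<n. c i * dd 0 (\<lambda>u. f i (phi j l u)) u) * tc j l 0 v +
    (\<Sum>i<n. c i * dd 1 (\<lambda>u. f i (phi j l u)) u) * tc j l 1 v"
proof -
  have "(\<Sum>i<n. c i * v (f i)) = (\<Sum>i<n. c i * dd 0 (\<lambda>u. f i (phi j l u)) u * tc j l 0 v +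
      c i * dd 1 (\<lambda>u. f i (phi j l u)) u * tc j l 1 v)"
  proof (rule sum.cong[OF refl])
    fix i assume "i \<in> {..<n}"
    then have i: "reg X V (f i)" using f by simp
    show "c i * v (f i) = c i * dd 0 (\<lambda>u. f i (phi j l u)) u * tc j l 0 v +
      c i * dd 1 (\<lambda>u. f i (phi j l u)) u * tc j l 1 v"
      unfolding tangent_chart'[OF jl v i u] by (simp add: algebra_simps)
  qed
  then show ?thesis by (simp add: sum.distrib sum_distrib_right)
qed

text \<open>Expanding every df_i in dt and dw collects a presentation of any length into a dt + b
  dw.\<close>

lemma regular_1form_chart:
  fixes \<eta> :: "((nat \<Rightarrow> 'k::field_char_0) set, 'k) form1"
  assumes jl: "j \<le> 1" "l \<le> 1" and \<eta>: "regular_1form X V \<eta>" and u: "phi j l u \<in> V"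
  obtains W a b where "u \<in> W" "areg W a" "areg W b" "\<forall>w\<in>W. phi j l w \<in> V"
    "\<forall>w\<in>W. \<forall>v. tangent X (phi j l w) v \<longrightarrow> \<eta> (phi j l w) v = a w * tc j l 0 v + b w * tc j l 1 v"
proof -
  obtain V' and n :: nat and g f where V': "openin (zar X) V'" "phi j l u \<in> V'" "V' \<subseteq> V"
    and gf: "\<forall>i<n. reg X V' (g i) \<and> reg X V' (f i)"
    and eq: "\<forall>q\<in>V'. \<forall>v. tangent X q v \<longrightarrow> \<eta> q v = (\<Sum>i<n. g i q * v (f i))"
    using bspec[OF \<eta>[unfolded regular_1form_def] u] by (elim exE conjE) (rule that)
  define W where "W = {w. phi j l w \<in> V'}"
  have W: "aopen W" unfolding W_def by (rule aopen_pullback[OF jl V'(1)])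
  have pb: "areg W (\<lambda>u. g i (phi j l u))" "areg W (\<lambda>u. f i (phi j l u))" if "i < n" for i
    unfolding W_def using gf that by (auto intro!: areg_pullback[OF jl])
  have ar: "areg W (\<lambda>w. \<Sum>i<n. g i (phi j l w) * dd k (\<lambda>u. f i (phi j l u)) w)" for k
    by (rule areg_sum[OF W]) (auto intro!: areg_mult dd_areg pb)
  have "\<forall>w\<in>W. \<forall>v. tangent X (phi j l w) v \<longrightarrow> \<eta> (phi j l w) v =
     (\<Sum>i<n. g i (phi j l w) * dd 0 (\<lambda>u. f i (phi j l u)) w) * tc j l 0 v +
     (\<Sum>i<n. g i (phi j l w) * dd 1 (\<lambda>u. f i (phi j l u)) w) * tc j l 1 v"
  proof (intro ballI allI impI)
    fix w v assume w: "w \<in> W" and v: "tangent X (phi j l w) v"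
    have wV: "phi j l w \<in> V'" using w by (simp add: W_def)
    show "\<eta> (phi j l w) v =
     (\<Sum>i<n. g i (phi j l w) * dd 0 (\<lambda>u. f i (phi j l u)) w) * tc j l 0 v +
     (\<Sum>i<n. g i (phi j l w) * dd 1 (\<lambda>u. f i (phi j l u)) w) * tc j l 1 v"
      using eq wV v sum_1form_chart[OF jl v wV, where f = f and n = n] gf by simp
  qed
  then show ?thesis
    by (rule that[OF _ ar ar, rotated -1]) (use V' in \<open>auto simp: W_def\<close>)
qed

lemma sum_2form_chart:
  fixes v w :: "((nat \<Rightarrow> 'k::field_char_0) set, 'k) tvec" and n :: nat
  assumes jl: "j \<le> 1" "l \<le> 1" and v: "tangent X (phi j l u) v" "tangent X (phi j l u) w" and u: "phi j l u \<in> V"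
    and f: "\<And>i. i < n \<Longrightarrow> reg X V (f i)" "\<And>i. i < n \<Longrightarrow> reg X V (h i)"
  shows "(\<Sum>i<n. c i * (v (f i) * w (h i) - w (f i) * v (h i))) =
    (\<Sum>i<n. c i * (dd 0 (\<lambda>u. f i (phi j l u)) u * dd 1 (\<lambda>u. h i (phi j l u)) u -
                   dd 1 (\<lambda>u. f i (phi j l u)) u * dd 0 (\<lambda>u. h i (phi j l u)) u)) * wedge j l v w"
  unfolding sum_distrib_right
proof (rule sum.cong[OF refl])
  fix i assume "i \<in> {..<n}"
  then have i: "reg X V (f i)" "reg X V (h i)" using f by simp_all
  show "c i * (v (f i) * w (h i) - w (f i) * v (h i)) =
    c i * (dd 0 (\<lambda>u. f i (phi j l u)) u * dd 1 (\<lambda>u. h i (phi j l u)) u -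
                   dd 1 (\<lambda>u. f i (phi j l u)) u * dd 0 (\<lambda>u. h i (phi j l u)) u) * wedge j l v w"
    unfolding tangent_chart'[OF jl v(1) i(1) u] tangent_chart'[OF jl v(1) i(2) u]
      tangent_chart'[OF jl v(2) i(1) u] tangent_chart'[OF jl v(2) i(2) u]
    by (simp add: algebra_simps)
qed

lemma regular_2form_chart:
  fixes \<tau> :: "((nat \<Rightarrow> 'k::field_char_0) set, 'k) form2"
  assumes jl: "j \<le> 1" "l \<le> 1" and \<tau>: "regular_2form X V \<tau>" and u: "phi j l u \<in> V"
  obtains W c where "u \<in> W" "areg W c" "\<forall>w\<in>W. phi j l w \<in> V"
    "\<forall>w\<in>W. \<forall>v v'. tangent X (phi j l w) v \<and> tangent X (phi j l w) v' \<longrightarrow> \<tau> (phi j l w) v v' = c w * wedge j l v v'"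
proof -
  obtain V' and n :: nat and g f h where V': "openin (zar X) V'" "phi j l u \<in> V'" "V' \<subseteq> V"
    and gf: "\<forall>i<n. reg X V' (g i) \<and> reg X V' (f i) \<and> reg X V' (h i)"
    and eq: "\<forall>q\<in>V'. \<forall>v w. tangent X q v \<and> tangent X q w \<longrightarrow> \<tau> q v w = (\<Sum>i<n. g i q * (v (f i) * w (h i) - w (f i) * v (h i)))"
    using bspec[OF \<tau>[unfolded regular_2form_def] u] by (elim exE conjE) (rule that)
  define W where "W = {w. phi j l w \<in> V'}"
  have W: "aopen W" unfolding W_def by (rule aopen_pullback[OF jl V'(1)])
  have pb: "areg W (\<lambda>u. g i (phi j l u))" "areg W (\<lambda>u. f i (phi j l u))" "areg W (\<lambda>u. h i (phi j l u))" if "i < n" for i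
    unfolding W_def using gf that by (auto intro!: areg_pullback[OF jl])
  let ?c = "\<lambda>u. \<Sum>i<n. g i (phi j l u) * (dd 0 (\<lambda>u. f i (phi j l u)) u * dd 1 (\<lambda>u. h i (phi j l u)) u -
                   dd 1 (\<lambda>u. f i (phi j l u)) u * dd 0 (\<lambda>u. h i (phi j l u)) u)"
  have ar: "areg W ?c"
    by (rule areg_sum[OF W]) (auto intro!: areg_mult areg_diff dd_areg pb)
  have "\<forall>w\<in>W. \<forall>v v'. tangent X (phi j l w) v \<and> tangent X (phi j l w) v' \<longrightarrow> \<tau> (phi j l w) v v' = ?c w * wedge j l v v'"
  proof (intro ballI allI impI, elim conjE)
    fix w v v' assume w: "w \<in> W" and v: "tangent X (phi j l w) v" "tangent X (phi j l w) v'"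
    have wV: "phi j l w \<in> V'" using w by (simp add: W_def)
    have "\<tau> (phi j l w) v v' = (\<Sum>i<n. g i (phi j l w) * (v (f i) * v' (h i) - v' (f i) * v (h i)))"
      using eq wV v by blast
    also have "\<dots> = ?c w * wedge j l v v'"
      by (rule sum_2form_chart[OF jl v wV]) (use gf in auto)
    finally show "\<tau> (phi j l w) v v' = ?c w * wedge j l v v'" .
  qed
  then show ?thesis
    by (rule that[OF _ ar, rotated -1]) (use V' in \<open>auto simp: W_def\<close>)
qed

text \<open>The definition admits any local presentation by terms g_i df_i. Comparing coefficients,
  a is the sum of the g_i times the t-derivatives of the f_i, and b likewise with w; in the
  t-derivative of b minus the w-derivative of a the second derivatives of the f_i cancel.\<close>

lemma exterior_derivative_chart:
  fixes \<omega> :: "((nat \<Rightarrow> 'k::field_char_0) set, 'k) form1"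
  assumes jl: "j \<le> 1" "l \<le> 1" and d: "exterior_derivative X V \<omega> \<sigma>"
    and a: "areg W0 a" and b: "areg W0 b" and W0: "\<forall>w\<in>W0. phi j l w \<in> V"
    and \<omega>: "\<forall>w\<in>W0. \<forall>v. tangent X (phi j l w) v \<longrightarrow> \<omega> (phi j l w) v = a w * tc j l 0 v + b w * tc j l 1 v"
    and u: "u \<in> W0" and v: "tangent X (phi j l u) v" "tangent X (phi j l u) v'"
  shows "\<sigma> (phi j l u) v v' = (dd 0 b u - dd 1 a u) * wedge j l v v'"
proof -
  have uV: "phi j l u \<in> V" using W0 u by blast
  obtain V' and n :: nat and g f where V': "openin (zar X) V'" "phi j l u \<in> V'" "V' \<subseteq> V"
    and gf: "\<forall>i<n. reg X V' (g i) \<and> reg X V' (f i)"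
    and eq1: "\<forall>q\<in>V'. \<forall>v. tangent X q v \<longrightarrow> \<omega> q v = (\<Sum>i<n. g i q * v (f i))"
    and eq2: "\<forall>q\<in>V'. \<forall>v w. tangent X q v \<and> tangent X q w \<longrightarrow>
           \<sigma> q v w = (\<Sum>i<n. v (g i) * w (f i) - w (g i) * v (f i))"
    using bspec[OF d[unfolded exterior_derivative_def] uV] by (elim exE conjE) (rule that)
  define W where "W = W0 \<inter> {w. phi j l w \<in> V'}"
  have W: "aopen W" unfolding W_def by (rule aopen_Int[OF areg_imp_aopen[OF a] aopen_pullback[OF jl V'(1)]])
  have uW: "u \<in> W" using u V' by (simp add: W_def)
  define G F where "G = (\<lambda>i u. g i (phi j l u))" and "F = (\<lambda>i u. f i (phi j l u))"
  have pb: "areg W (G i)" "areg W (F i)" if "i < n" for i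
    unfolding G_def F_def
    by (rule areg_pullback_subset[OF jl _ W, of V'], use gf that in simp, simp add: W_def)+
  have val: "a w * tc j l 0 v + b w * tc j l 1 v =
     (\<Sum>i<n. G i w * dd 0 (F i) w) * tc j l 0 v + (\<Sum>i<n. G i w * dd 1 (F i) w) * tc j l 1 v"
    if w: "w \<in> W" and v: "tangent X (phi j l w) v" for w v
  proof -
    have wV: "phi j l w \<in> V'" using w by (simp add: W_def)
    have "a w * tc j l 0 v + b w * tc j l 1 v = \<omega> (phi j l w) v" using \<omega> w v by (simp add: W_def)
    also have "\<dots> = (\<Sum>i<n. g i (phi j l w) * v (f i))" using eq1 wV v by blast
    also have "\<dots> = (\<Sum>i<n. G i w * dd 0 (F i) w) * tc j l 0 v + (\<Sum>i<n. G i w * dd 1 (F i) w) * tc j l 1 v"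
      unfolding G_def F_def by (rule sum_1form_chart[OF jl v wV]) (use gf in auto)
    finally show ?thesis .
  qed
  \<comment> \<open>Evaluation on d/dt and on d/dw separates the two coefficients.\<close>
  have ab: "a w = (\<Sum>i<n. G i w * dd 0 (F i) w)" "b w = (\<Sum>i<n. G i w * dd 1 (F i) w)" if w: "w \<in> W" for w
  proof -
    obtain v :: "((nat \<Rightarrow> 'k) set, 'k) tvec" where v: "tangent X (phi j l w) v" "tc j l 0 v = 1" "tc j l 1 v = 0"
      by (rule tangent_exists[OF jl])
    show "a w = (\<Sum>i<n. G i w * dd 0 (F i) w)" using val[OF w v(1)] v by simp
    obtain v :: "((nat \<Rightarrow> 'k) set, 'k) tvec" where v: "tangent X (phi j l w) v" "tc j l 0 v = 0" "tc j l 1 v = 1"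
      by (rule tangent_exists[OF jl])
    show "b w = (\<Sum>i<n. G i w * dd 1 (F i) w)" using val[OF w v(1)] v by simp
  qed
  have aW: "areg W a" "areg W b"
    by (rule areg_subset[OF a W], simp add: W_def) (rule areg_subset[OF b W], simp add: W_def)
  have dsum: "dd k (\<lambda>w. \<Sum>i<n. G i w * dd m (F i) w) u = (\<Sum>i<n. G i u * dd k (dd m (F i)) u + dd m (F i) u * dd k (G i) u)" for k m
  proof -
    have ar: "areg W (\<lambda>w. G i w * dd m (F i) w)" if "i < n" for i
      using pb that by (intro areg_mult dd_areg) auto
    have "dd k (\<lambda>w. \<Sum>i<n. G i w * dd m (F i) w) u = (\<Sum>i<n. dd k (\<lambda>w. G i w * dd m (F i) w) u)"
      by (rule dd_sum[OF W uW]) (use ar in auto)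
    also have "\<dots> = (\<Sum>i<n. G i u * dd k (dd m (F i)) u + dd m (F i) u * dd k (G i) u)"
      by (rule sum.cong[OF refl], rule dd_mult[OF _ dd_areg uW]) (use pb in auto)
    finally show ?thesis .
  qed
  have "dd 1 a u = dd 1 (\<lambda>w. \<Sum>i<n. G i w * dd 0 (F i) w) u"
    by (rule dd_cong[OF aW(1) _ uW]) (use ab in auto)
  moreover have "dd 0 b u = dd 0 (\<lambda>w. \<Sum>i<n. G i w * dd 1 (F i) w) u"
    by (rule dd_cong[OF aW(2) _ uW]) (use ab in auto)
  ultimately have "dd 0 b u - dd 1 a u =
    (\<Sum>i<n. (G i u * dd 0 (dd 1 (F i)) u + dd 1 (F i) u * dd 0 (G i) u) - (G i u * dd 1 (dd 0 (F i)) u + dd 0 (F i) u * dd 1 (G i) u))"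
    unfolding dsum sum_subtractf by simp
  also have "\<dots> = (\<Sum>i<n. 1 * (dd 0 (G i) u * dd 1 (F i) u - dd 1 (G i) u * dd 0 (F i) u))"
  proof (rule sum.cong[OF refl])
    fix i assume "i \<in> {..<n}"
    then have "dd 0 (dd 1 (F i)) u = dd 1 (dd 0 (F i)) u" using dd_comm[OF pb(2) uW] by simp
    then show "(G i u * dd 0 (dd 1 (F i)) u + dd 1 (F i) u * dd 0 (G i) u) - (G i u * dd 1 (dd 0 (F i)) u + dd 0 (F i) u * dd 1 (G i) u)
      = 1 * (dd 0 (G i) u * dd 1 (F i) u - dd 1 (G i) u * dd 0 (F i) u)" by (simp add: algebra_simps)
  qed
  finally have e: "dd 0 b u - dd 1 a u = (\<Sum>i<n. 1 * (dd 0 (G i) u * dd 1 (F i) u - dd 1 (G i) u * dd 0 (F i) u))" .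
  have "\<sigma> (phi j l u) v v' = (\<Sum>i<n. 1 * (v (g i) * v' (f i) - v' (g i) * v (f i)))"
    using eq2 V'(2) v by simp
  also have "\<dots> = (dd 0 b u - dd 1 a u) * wedge j l v v'"
    unfolding e G_def F_def by (rule sum_2form_chart[OF jl v V'(2)]) (use gf in auto)
  finally show ?thesis .
qed

section \<open>Forms on the scroll obtained from coefficients in a chart\<close>

lemma reg_coord: "j \<le> 1 \<Longrightarrow> l \<le> 1 \<Longrightarrow> aopen W \<Longrightarrow> reg X (phi j l ` W) (coord j l i)"
  unfolding coord_def using reg_pushforward[OF _ _ areg_fst, of j l W] reg_pushforward[OF _ _ areg_snd, of j l W]
  by (cases "i = 0") simp_all

lemma tangent_pushforward:
  fixes v :: "((nat \<Rightarrow> 'k::field_char_0) set, 'k) tvec"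
  assumes "j \<le> 1" "l \<le> 1" and "tangent X (phi j l u) v" and "areg W g" "u \<in> W"
  shows "v (\<lambda>P. g (xi j l P)) = dd 0 g u * tc j l 0 v + dd 1 g u * tc j l 1 v"
  using tangent_chart[OF assms(1-3) regular_at_pushforward[OF assms(1,2,4,5)]] assms(1,2) by simp

lemma phi_image_ballI: "(\<And>w. w \<in> W \<Longrightarrow> Q (phi j l w)) \<Longrightarrow> \<forall>q\<in>phi j l ` W. Q q"
  by blast

lemma sum_lessThan_2: "(\<Sum>i<(2::nat). h i) = h 0 + (h 1 :: 'a::comm_monoid_add)"
  by (simp add: numeral_2_eq_2 One_nat_def)

lemma sum_lessThan_1: "(\<Sum>i<(1::nat). h i) = (h 0 :: 'a::comm_monoid_add)"
  by (simp add: One_nat_def)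

lemma regular_1form_pushforward:
  fixes \<eta> :: "((nat \<Rightarrow> 'k::field_char_0) set, 'k) form1"
  assumes jl: "j \<le> 1" "l \<le> 1" and a: "areg W a" and b: "areg W b"
    and eq: "\<And>w v. w \<in> W \<Longrightarrow> tangent X (phi j l w) v \<Longrightarrow> \<eta> (phi j l w) v = a w * tc j l 0 v + b w * tc j l 1 v"
  shows "regular_1form X (phi j l ` W) \<eta>"
  unfolding regular_1form_def
proof
  fix p assume p: "p \<in> phi j l ` W"
  have W: "aopen W" by (rule areg_imp_aopen[OF a])
  show "\<exists>V (n::nat) g f. openin (zar X) V \<and> p \<in> V \<and> V \<subseteq> phi j l ` W \<and> (\<forall>i<n. reg X V (g i) \<and> reg X V (f i)) \<and>
        (\<forall>q\<in>V. \<forall>v. tangent X q v \<longrightarrow> \<eta> q v = (\<Sum>i<n. g i q * v (f i)))"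
  proof (rule exI[of _ "phi j l ` W"], rule exI[of _ 2], rule exI[of _ "\<lambda>i P. if i = 0 then a (xi j l P) else b (xi j l P)"],
      rule exI[of _ "coord j l"], intro conjI)
    show "openin (zar X) (phi j l ` W)" by (rule openin_phi_image[OF jl W])
    have r: "reg X (phi j l ` W) (\<lambda>P. if i = 0 then a (xi j l P) else b (xi j l P))" for i :: nat
      by (cases "i = 0") (simp_all add: reg_pushforward[OF jl a] reg_pushforward[OF jl b])
    show "\<forall>i<2. reg X (phi j l ` W) (\<lambda>P. if i = 0 then a (xi j l P) else b (xi j l P)) \<and> reg X (phi j l ` W) (coord j l i)"
      using r reg_coord[OF jl W] by blast
    show "\<forall>q\<in>phi j l ` W. \<forall>v. tangent X q v \<longrightarrow> \<eta> q v = (\<Sum>i<2. (if i = 0 then a (xi j l q) else b (xi j l q)) * v (coord j l i))"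
      by (rule phi_image_ballI) (simp add: eq jl sum_lessThan_2 tc_coord)
  qed (use p in auto)
qed

lemma regular_2form_pushforward:
  fixes \<tau> :: "((nat \<Rightarrow> 'k::field_char_0) set, 'k) form2"
  assumes jl: "j \<le> 1" "l \<le> 1" and c: "areg W c"
    and eq: "\<And>w v v'. w \<in> W \<Longrightarrow> tangent X (phi j l w) v \<Longrightarrow> tangent X (phi j l w) v' \<Longrightarrow> \<tau> (phi j l w) v v' = c w * wedge j l v v'"
  shows "regular_2form X (phi j l ` W) \<tau>"
  unfolding regular_2form_def
proof
  fix p assume p: "p \<in> phi j l ` W"
  have W: "aopen W" by (rule areg_imp_aopen[OF c])
  show "\<exists>V (n::nat) g f h. openin (zar X) V \<and> p \<in> V \<and> V \<subseteq> phi j l ` W \<and>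
        (\<forall>i<n. reg X V (g i) \<and> reg X V (f i) \<and> reg X V (h i)) \<and>
        (\<forall>q\<in>V. \<forall>v w. tangent X q v \<and> tangent X q w \<longrightarrow>
           \<tau> q v w = (\<Sum>i<n. g i q * (v (f i) * w (h i) - w (f i) * v (h i))))"
  proof (rule exI[of _ "phi j l ` W"], rule exI[of _ 1], rule exI[of _ "\<lambda>i P. c (xi j l P)"],
      rule exI[of _ "\<lambda>_. coord j l 0"], rule exI[of _ "\<lambda>_. coord j l 1"], intro conjI)
    show "openin (zar X) (phi j l ` W)" by (rule openin_phi_image[OF jl W])
    show "\<forall>i<1::nat. reg X (phi j l ` W) (\<lambda>P. c (xi j l P)) \<and> reg X (phi j l ` W) (coord j l 0) \<and> reg X (phi j l ` W) (coord j l 1)"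
      using reg_pushforward[OF jl c] reg_coord[OF jl W] by blast
    show "\<forall>q\<in>phi j l ` W. \<forall>v w. tangent X q v \<and> tangent X q w \<longrightarrow>
           \<tau> q v w = (\<Sum>i<1::nat. c (xi j l q) * (v (coord j l 0) * w (coord j l 1) - w (coord j l 0) * v (coord j l 1)))"
      by (rule phi_image_ballI) (simp add: eq jl tc_coord sum_lessThan_1)
  qed (use p in auto)
qed

lemma exterior_derivative_pushforward:
  fixes \<omega> :: "((nat \<Rightarrow> 'k::field_char_0) set, 'k) form1"
  assumes jl: "j \<le> 1" "l \<le> 1" and a: "areg W a" and b: "areg W b"
    and eq1: "\<And>w v. w \<in> W \<Longrightarrow> tangent X (phi j l w) v \<Longrightarrow> \<omega> (phi j l w) v = a w * tc j l 0 v + b w * tc j l 1 v"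
    and eq2: "\<And>w v v'. w \<in> W \<Longrightarrow> tangent X (phi j l w) v \<Longrightarrow> tangent X (phi j l w) v' \<Longrightarrow>
       \<sigma> (phi j l w) v v' = (dd 0 b w - dd 1 a w) * wedge j l v v'"
  shows "exterior_derivative X (phi j l ` W) \<omega> \<sigma>"
  unfolding exterior_derivative_def
proof
  fix p assume p: "p \<in> phi j l ` W"
  have W: "aopen W" by (rule areg_imp_aopen[OF a])
  let ?g = "\<lambda>(i::nat) P. if i = 0 then a (xi j l P) else b (xi j l P)"
  show "\<exists>V (n::nat) g f. openin (zar X) V \<and> p \<in> V \<and> V \<subseteq> phi j l ` W \<and>
        (\<forall>i<n. reg X V (g i) \<and> reg X V (f i)) \<and>
        (\<forall>q\<in>V. \<forall>v. tangent X q v \<longrightarrow> \<omega> q v = (\<Sum>i<n. g i q * v (f i))) \<and>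
        (\<forall>q\<in>V. \<forall>v w. tangent X q v \<and> tangent X q w \<longrightarrow>
           \<sigma> q v w = (\<Sum>i<n. v (g i) * w (f i) - w (g i) * v (f i)))"
  proof (rule exI[of _ "phi j l ` W"], rule exI[of _ 2], rule exI[of _ ?g],
      rule exI[of _ "coord j l"], intro conjI)
    show "openin (zar X) (phi j l ` W)" by (rule openin_phi_image[OF jl W])
    have r: "reg X (phi j l ` W) (?g i)" for i :: nat
      by (cases "i = 0") (simp_all add: reg_pushforward[OF jl a] reg_pushforward[OF jl b])
    show "\<forall>i<2. reg X (phi j l ` W) (?g i) \<and> reg X (phi j l ` W) (coord j l i)"
      using r reg_coord[OF jl W] by blast
    show "\<forall>q\<in>phi j l ` W. \<forall>v. tangent X q v \<longrightarrow> \<omega> q v = (\<Sum>i<2. ?g i q * v (coord j l i))"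
      by (rule phi_image_ballI) (simp add: eq1 jl sum_lessThan_2 tc_coord)
    show "\<forall>q\<in>phi j l ` W. \<forall>v w. tangent X q v \<and> tangent X q w \<longrightarrow>
           \<sigma> q v w = (\<Sum>i<2. v (?g i) * w (coord j l i) - w (?g i) * v (coord j l i))"
    proof (rule phi_image_ballI, intro allI impI, elim conjE)
      fix u v w assume u: "u \<in> W" and v: "tangent X (phi j l u) v" "tangent X (phi j l u) w"
      have vg: "v (?g 0) = dd 0 a u * tc j l 0 v + dd 1 a u * tc j l 1 v"
        "v (?g 1) = dd 0 b u * tc j l 0 v + dd 1 b u * tc j l 1 v"
        "w (?g 0) = dd 0 a u * tc j l 0 w + dd 1 a u * tc j l 1 w"
        "w (?g 1) = dd 0 b u * tc j l 0 w + dd 1 b u * tc j l 1 w"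
        using tangent_pushforward[OF jl _ a u] tangent_pushforward[OF jl _ b u] v by simp_all
      show "\<sigma> (phi j l u) v w = (\<Sum>i<2. v (?g i) * w (coord j l i) - w (?g i) * v (coord j l i))"
        unfolding sum_lessThan_2 vg tc_coord eq2[OF u v] by (simp add: algebra_simps)
    qed
  qed (use p in auto)
qed

section \<open>Sections of the invertible sheaves\<close>

text \<open>The coefficient of a section with respect to the frame of the chart in which \<open>y\<^sub>j = z\<^sub>l = 1\<close>.\<close>

definition cf :: "nat \<Rightarrow> nat \<Rightarrow> ((nat \<Rightarrow> 'k::field) \<Rightarrow> (nat \<Rightarrow> 'k) \<Rightarrow> 'k) \<Rightarrow> 'k \<times> 'k \<Rightarrow> 'k" where
  "cf j l s u = s (xv j l u) (yv j (fst u))"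

text \<open>The vectors x of a point and y of its projection are chosen independently, hence two
  scalars. The support clause is the convention of extension by zero, under which equality of
  sections is equality of functions.\<close>

definition bihomogeneous ::
    "int \<Rightarrow> int \<Rightarrow> (nat \<Rightarrow> 'k::field) set set \<Rightarrow> ((nat \<Rightarrow> 'k) \<Rightarrow> (nat \<Rightarrow> 'k) \<Rightarrow> 'k) \<Rightarrow> bool" where
  "bihomogeneous m n U s \<longleftrightarrow>
     (\<forall>x y. \<not> (pt x \<in> U \<and> y \<in> proj (pt x)) \<longrightarrow> s x y = 0) \<and>
     (\<forall>x y c d. pt x \<in> U \<longrightarrow> y \<in> proj (pt x) \<longrightarrow> c \<noteq> 0 \<longrightarrow> d \<noteq> 0 \<longrightarrow>
        s (\<lambda>i. c * x i) (\<lambda>i. d * y i) = c powi m * d powi n * s x y)"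

lemma pt_mem_eq: "x \<in> pt x' \<Longrightarrow> pt x = pt x'"
  by (erule ptE) (simp add: pt_scale)

lemma point_eq_pt: "P \<in> pts \<Longrightarrow> x \<in> P \<Longrightarrow> pt x = P"
  by (erule scroll_pointsE) (simp add: pt_mem_eq)

lemma pt_scale_mem: "c \<noteq> 0 \<Longrightarrow> (\<lambda>i. c * x i) \<in> pt x"
  unfolding mem_pt by blast

lemma scroll_proj_scale:
  assumes P: "P \<in> pts" and y: "y \<in> proj P" and d: "d \<noteq> 0"
  shows "(\<lambda>i. d * y i) \<in> proj P"
proof -
  obtain y' z' where P': "P = pt (scroll_map a0 a1 y' z')" "y' \<in> nonzero_vecs 1" "z' \<in> nonzero_vecs 1"
    by (rule scroll_pointsE[OF P])
  have e: "proj P = pt y'" unfolding P'(1) by (rule scroll_proj_pt[OF a0 a1 P'(2,3)])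
  obtain c where "c \<noteq> 0" "y = (\<lambda>i. c * y' i)" using y unfolding e by (rule ptE)
  then have "(\<lambda>i. d * y i) = (\<lambda>i. (d * c) * y' i)" by (simp add: mult.assoc)
  moreover have "d * c \<noteq> 0" using \<open>c \<noteq> 0\<close> d by simp
  ultimately show ?thesis unfolding e mem_pt by blast
qed

lemma yv_in_scroll_proj: "j \<le> 1 \<Longrightarrow> l \<le> 1 \<Longrightarrow> yv j (fst u) \<in> proj (pt (xv j l u))"
  using scroll_proj_phi[of j l u] pt_self by (simp add: phi_def)

lemma representative_chart:
  assumes "j \<le> 1" "l \<le> 1" "x \<in> phi j l u" "y \<in> proj (phi j l u)"
  obtains c d where "c \<noteq> 0" "d \<noteq> 0" "x = (\<lambda>i. c * xv j l u i)" "y = (\<lambda>i. d * yv j (fst u) i)"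
proof -
  obtain c where c: "c \<noteq> 0" "x = (\<lambda>i. c * xv j l u i)" using assms(3) unfolding phi_def by (rule ptE)
  obtain d where d: "d \<noteq> 0" "y = (\<lambda>i. d * yv j (fst u) i)"
    using assms(4) unfolding scroll_proj_phi[OF assms(1,2)] by (rule ptE)
  show ?thesis by (rule that[OF c(1) d(1) c(2) d(2)])
qed

lemma sec_localE:
  assumes "s \<in> sec (Osh m n) U" "P \<in> U"
  obtains V g i j where "i \<le> a0 + a1 + 1" "j \<le> 1" "openin (zar X) V" "P \<in> V" "V \<subseteq> U" "reg X V g"
    "\<forall>Q\<in>V. \<forall>x\<in>Q. \<forall>y \<in> proj Q. x i \<noteq> 0 \<and> y j \<noteq> 0 \<and> s x y = g Q * x i powi m * y j powi n"
proof -
  have "\<forall>P\<in>U. \<exists>V g. \<exists>i \<le> a0 + a1 + 1. \<exists>j \<le> 1. openin (zar X) V \<and> P \<in> V \<and> V \<subseteq> U \<and> reg X V g \<and>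
    (\<forall>Q\<in>V. \<forall>x\<in>Q. \<forall>y \<in> proj Q. x i \<noteq> 0 \<and> y j \<noteq> 0 \<and> s x y = g Q * x i powi m * y j powi n)"
    using assms(1) by (simp add: scroll_O_def)
  from bspec[OF this assms(2)] show ?thesis by (elim exE conjE) (rule that)
qed

lemma sec_localI:
  assumes "\<And>x y. \<not> (pt x \<in> U \<and> y \<in> proj (pt x)) \<Longrightarrow> s x y = 0"
    and "\<And>P. P \<in> U \<Longrightarrow> \<exists>V g i j. i \<le> a0 + a1 + 1 \<and> j \<le> 1 \<and> openin (zar X) V \<and> P \<in> V \<and> V \<subseteq> U \<and> reg X V g \<and>
    (\<forall>Q\<in>V. \<forall>x\<in>Q. \<forall>y \<in> proj Q. x i \<noteq> 0 \<and> y j \<noteq> 0 \<and> s x y = g Q * x i powi m * y j powi n)"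
  shows "s \<in> sec (Osh m n) U"
proof -
  have "\<exists>V g. \<exists>i \<le> a0 + a1 + 1. \<exists>j \<le> 1. openin (zar X) V \<and> P \<in> V \<and> V \<subseteq> U \<and> reg X V g \<and>
    (\<forall>Q\<in>V. \<forall>x\<in>Q. \<forall>y \<in> proj Q. x i \<noteq> 0 \<and> y j \<noteq> 0 \<and> s x y = g Q * x i powi m * y j powi n)"
    if P: "P \<in> U" for P
    using assms(2)[OF P] by (elim exE conjE) (intro exI conjI)
  then show ?thesis using assms(1) by (simp add: scroll_O_def)
qed

lemma sec_support:
  "s \<in> sec (Osh m n) U \<Longrightarrow> \<not> (pt x \<in> U \<and> y \<in> proj (pt x)) \<Longrightarrow> s x y = 0"
  by (simp add: scroll_O_def)

lemma sec_bihomogeneous: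
  assumes U: "openin (zar X) U" and s: "s \<in> sec (Osh m n) U"
  shows "bihomogeneous m n U s"
  unfolding bihomogeneous_def
proof (intro conjI allI impI)
  fix x y show "s x y = 0" if "\<not> (pt x \<in> U \<and> y \<in> proj (pt x))" using sec_support[OF s that] .
next
  fix x y and c d :: 'a
  assume x: "pt x \<in> U" and y: "y \<in> proj (pt x)" and c: "c \<noteq> 0" and d: "d \<noteq> 0"
  obtain V g i j where V: "i \<le> a0 + a1 + 1" "j \<le> 1" "openin (zar X) V" "pt x \<in> V" "V \<subseteq> U" "reg X V g"
    "\<forall>Q\<in>V. \<forall>x\<in>Q. \<forall>y \<in> proj Q. x i \<noteq> 0 \<and> y j \<noteq> 0 \<and> s x y = g Q * x i powi m * y j powi n"
    by (rule sec_localE[OF s x])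
  have P: "pt x \<in> pts" using openin_subset[OF V(3)] V(4) by auto
  have "s x y = g (pt x) * x i powi m * y j powi n" using V(7) V(4) pt_self y by blast
  moreover have "s (\<lambda>i. c * x i) (\<lambda>i. d * y i) = g (pt x) * (c * x i) powi m * (d * y j) powi n"
    using V(7) V(4) pt_scale_mem[OF c] scroll_proj_scale[OF P y d] by blast
  ultimately show "s (\<lambda>i. c * x i) (\<lambda>i. d * y i) = c powi m * d powi n * s x y"
    by (simp add: power_int_mult_distrib)
qed

lemma areg_yv: "aopen W \<Longrightarrow> areg W (\<lambda>u. yv j (fst u) i)"
  unfolding yv_def by (cases "i = j"; cases "i = 1 - j") (simp_all add: areg_const areg_fst)

lemma areg_xv: "j \<le> 1 \<Longrightarrow> l \<le> 1 \<Longrightarrow> aopen W \<Longrightarrow> areg W (\<lambda>u. xv j l u i)"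
proof -
  assume jl: "j \<le> 1" "l \<le> 1" and W: "aopen W"
  obtain P where P: "\<forall>u::'a \<times> 'a. xv j l u i = ev P u" using xv_poly[OF jl] by blast
  show ?thesis by (rule areg_cong[OF areg_ev[OF W, of P]]) (simp add: P)
qed

lemma sec_areg_cf:
  assumes U: "openin (zar X) U" and s: "s \<in> sec (Osh m n) U" and jl: "j \<le> 1" "l \<le> 1"
  shows "areg {u. phi j l u \<in> U} (cf j l s)"
proof (rule areg_local)
  fix u assume "u \<in> {u. phi j l u \<in> U}"
  then have u: "phi j l u \<in> U" by simp
  obtain V g i j' where V: "i \<le> a0 + a1 + 1" "j' \<le> 1" "openin (zar X) V" "phi j l u \<in> V" "V \<subseteq> U" "reg X V g"
    "\<forall>Q\<in>V. \<forall>x\<in>Q. \<forall>y \<in> proj Q. x i \<noteq> 0 \<and> y j' \<noteq> 0 \<and> s x y = g Q * x i powi m * y j' powi n"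
    by (rule sec_localE[OF s u])
  define W where "W = {u. phi j l u \<in> V}"
  have W: "aopen W" unfolding W_def by (rule aopen_pullback[OF jl V(3)])
  have val: "xv j l w i \<noteq> 0 \<and> yv j (fst w) j' \<noteq> 0 \<and>
      cf j l s w = g (phi j l w) * xv j l w i powi m * yv j (fst w) j' powi n" if "w \<in> W" for w
  proof -
    have "pt (xv j l w) \<in> V" using that by (simp add: W_def phi_def)
    then show ?thesis using V(7) pt_self[of "xv j l w"] yv_in_scroll_proj[OF jl, of w]
      unfolding cf_def phi_def by blast
  qed
  have "areg W (\<lambda>w. g (phi j l w) * xv j l w i powi m * yv j (fst w) j' powi n)"
    by (intro areg_mult areg_powi areg_xv[OF jl W] areg_yv[OF W] areg_pullback_subset[OF jl V(6) W])
      (use val in \<open>auto simp: W_def\<close>)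
  then have "areg W (cf j l s)" by (rule areg_cong) (use val in simp)
  moreover have "u \<in> W" "W \<subseteq> {u. phi j l u \<in> U}" using V(4,5) by (auto simp: W_def)
  ultimately show "\<exists>W. u \<in> W \<and> W \<subseteq> {u. phi j l u \<in> U} \<and> areg W (cf j l s)"
    by (intro exI[of _ W] conjI)
qed

lemma bihomogeneous_chart:
  assumes "bihomogeneous m n U s" "j \<le> 1" "l \<le> 1" "phi j l u \<in> U" "c \<noteq> 0" "d \<noteq> 0"
  shows "s (\<lambda>i. c * xv j l u i) (\<lambda>i. d * yv j (fst u) i) = c powi m * d powi n * cf j l s u"
proof -
  have "pt (xv j l u) \<in> U" using assms(4) by (simp add: phi_def)
  then show ?thesis
    using assms(1) yv_in_scroll_proj[OF assms(2,3), of u] assms(5,6) unfolding bihomogeneous_def cf_def by blast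
qed

text \<open>The frame is the m-th power of the corner coordinate times the n-th power of y_j. It is
  1 on the normalised vectors, so g is the coefficient of s.\<close>

lemma sec_of_chart:
  assumes jl: "j \<le> 1" "l \<le> 1" and g: "areg W g"
    and supp: "\<And>x y. \<not> (pt x \<in> phi j l ` W \<and> y \<in> proj (pt x)) \<Longrightarrow> s x y = 0"
    and val: "\<And>u c d. u \<in> W \<Longrightarrow> c \<noteq> 0 \<Longrightarrow> d \<noteq> 0 \<Longrightarrow>
      s (\<lambda>i. c * xv j l u i) (\<lambda>i. d * yv j (fst u) i) = c powi m * d powi n * g u"
  shows "s \<in> sec (Osh m n) (phi j l ` W)"
proof (rule sec_localI)
  fix x y show "s x y = 0" if "\<not> (pt x \<in> phi j l ` W \<and> y \<in> proj (pt x))" using supp[OF that] .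
next
  fix P assume P: "P \<in> phi j l ` W"
  have W: "aopen W" by (rule areg_imp_aopen[OF g])
  have "\<forall>Q\<in>phi j l ` W. \<forall>x\<in>Q. \<forall>y \<in> proj Q. x (corner j l) \<noteq> 0 \<and> y j \<noteq> 0 \<and>
        s x y = g (xi j l Q) * x (corner j l) powi m * y j powi n"
  proof (rule phi_image_ballI, intro ballI)
    fix u x y assume u: "u \<in> W" and x: "x \<in> phi j l u" and y: "y \<in> proj (phi j l u)"
    obtain c d where cd: "c \<noteq> 0" "d \<noteq> 0" "x = (\<lambda>i. c * xv j l u i)" "y = (\<lambda>i. d * yv j (fst u) i)"
      by (rule representative_chart[OF jl x y])
    then have "x (corner j l) = c" "y j = d" using jl by simp_all
    moreover have "s x y = c powi m * d powi n * g u" unfolding cd(3,4) by (rule val[OF u cd(1,2)])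
    ultimately show "x (corner j l) \<noteq> 0 \<and> y j \<noteq> 0 \<and>
        s x y = g (xi j l (phi j l u)) * x (corner j l) powi m * y j powi n"
      using cd(1,2) jl by simp
  qed
  then show "\<exists>V g i k. i \<le> a0 + a1 + 1 \<and> k \<le> 1 \<and> openin (zar X) V \<and> P \<in> V \<and> V \<subseteq> phi j l ` W \<and> reg X V g \<and>
    (\<forall>Q\<in>V. \<forall>x\<in>Q. \<forall>y \<in> proj Q. x i \<noteq> 0 \<and> y k \<noteq> 0 \<and> s x y = g Q * x i powi m * y k powi n)"
    using P jl corner_le[OF jl] openin_phi_image[OF jl W] reg_pushforward[OF jl g]
    by (intro exI[of _ "phi j l ` W"] exI conjI) auto
qed

lemma sec_glue:
  assumes supp: "\<And>x y. \<not> (pt x \<in> U \<and> y \<in> proj (pt x)) \<Longrightarrow> s x y = 0"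
    and loc: "\<And>P. P \<in> U \<Longrightarrow> \<exists>V s'. P \<in> V \<and> V \<subseteq> U \<and> s' \<in> sec (Osh m n) V \<and>
      (\<forall>x y. pt x \<in> V \<longrightarrow> s x y = s' x y)"
    and U: "U \<subseteq> pts"
  shows "s \<in> sec (Osh m n) U"
proof (rule sec_localI)
  fix x y show "s x y = 0" if "\<not> (pt x \<in> U \<and> y \<in> proj (pt x))" using supp[OF that] .
next
  fix P assume P: "P \<in> U"
  obtain V s' where V: "P \<in> V" "V \<subseteq> U" "s' \<in> sec (Osh m n) V"
    and eq: "\<forall>x y. pt x \<in> V \<longrightarrow> s x y = s' x y" using loc[OF P] by (elim exE conjE) (rule that)
  obtain V' g i j where V': "i \<le> a0 + a1 + 1" "j \<le> 1" "openin (zar X) V'" "P \<in> V'" "V' \<subseteq> V" "reg X V' g"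
    "\<forall>Q\<in>V'. \<forall>x\<in>Q. \<forall>y \<in> proj Q. x i \<noteq> 0 \<and> y j \<noteq> 0 \<and> s' x y = g Q * x i powi m * y j powi n"
    by (rule sec_localE[OF V(3,1)])
  have "\<forall>Q\<in>V'. \<forall>x\<in>Q. \<forall>y \<in> proj Q. x i \<noteq> 0 \<and> y j \<noteq> 0 \<and> s x y = g Q * x i powi m * y j powi n"
  proof (intro ballI)
    fix Q x y assume Q: "Q \<in> V'" and x: "x \<in> Q" and y: "y \<in> proj Q"
    have "pt x = Q" using point_eq_pt[OF _ x] Q V'(5) V(2) U by blast
    then have "s x y = s' x y" using eq Q V'(5) by blast
    then show "x i \<noteq> 0 \<and> y j \<noteq> 0 \<and> s x y = g Q * x i powi m * y j powi n" using V'(7) Q x y by simp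
  qed
  then show "\<exists>V g i j. i \<le> a0 + a1 + 1 \<and> j \<le> 1 \<and> openin (zar X) V \<and> P \<in> V \<and> V \<subseteq> U \<and> reg X V g \<and>
    (\<forall>Q\<in>V. \<forall>x\<in>Q. \<forall>y \<in> proj Q. x i \<noteq> 0 \<and> y j \<noteq> 0 \<and> s x y = g Q * x i powi m * y j powi n)"
    using V' subset_trans[OF V'(5) V(2)] by (intro exI conjI)
qed

text \<open>Reduces a section to four regular functions on the plane: bihomogeneity recovers s from
  its values at the normalised vectors, and being a section is a local property.\<close>

lemma sec_iff:
  assumes U: "openin (zar X) U"
  shows "s \<in> sec (Osh m n) U \<longleftrightarrow>
    bihomogeneous m n U s \<and> (\<forall>j\<le>1. \<forall>l\<le>1. areg {u. phi j l u \<in> U} (cf j l s))"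
proof
  assume "s \<in> sec (Osh m n) U"
  then show "bihomogeneous m n U s \<and> (\<forall>j\<le>1. \<forall>l\<le>1. areg {u. phi j l u \<in> U} (cf j l s))"
    using sec_bihomogeneous[OF U] sec_areg_cf[OF U] by blast
next
  assume *: "bihomogeneous m n U s \<and> (\<forall>j\<le>1. \<forall>l\<le>1. areg {u. phi j l u \<in> U} (cf j l s))"
  have sub: "U \<subseteq> pts" using openin_subset[OF U] by simp
  show "s \<in> sec (Osh m n) U"
  proof (rule sec_glue[OF _ _ sub])
    fix x y show "s x y = 0" if "\<not> (pt x \<in> U \<and> y \<in> proj (pt x))"
      using * that unfolding bihomogeneous_def by blast
  next
    fix P assume P: "P \<in> U"
    then have "P \<in> pts" using sub by blast
    then obtain j l where jl: "j \<le> 1" "l \<le> 1" and c: "P \<in> chart j l" by (rule points_covered)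
    define W where "W = {u. phi j l u \<in> U}"
    define s' where "s' = (\<lambda>x y. if pt x \<in> phi j l ` W then s x y else 0)"
    have "s' \<in> sec (Osh m n) (phi j l ` W)"
    proof (rule sec_of_chart[OF jl])
      show "areg W (cf j l s)" using * jl by (simp add: W_def)
      fix x y show "s' x y = 0" if "\<not> (pt x \<in> phi j l ` W \<and> y \<in> proj (pt x))"
        using that * unfolding s'_def bihomogeneous_def by (cases "pt x \<in> phi j l ` W") auto
    next
      fix u and c d :: 'a assume u: "u \<in> W" and cd: "c \<noteq> 0" "d \<noteq> 0"
      have "pt (\<lambda>i. c * xv j l u i) = phi j l u" using cd by (simp add: pt_scale phi_def)
      then have "s' (\<lambda>i. c * xv j l u i) (\<lambda>i. d * yv j (fst u) i) = s (\<lambda>i. c * xv j l u i) (\<lambda>i. d * yv j (fst u) i)"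
        using u by (simp add: s'_def)
      also have "\<dots> = c powi m * d powi n * cf j l s u"
        by (rule bihomogeneous_chart[OF _ jl _ cd]) (use * u in \<open>auto simp: W_def\<close>)
      finally show "s' (\<lambda>i. c * xv j l u i) (\<lambda>i. d * yv j (fst u) i) = c powi m * d powi n * cf j l s u" .
    qed
    moreover obtain u where u: "P = phi j l u" by (rule chart_is_phi[OF jl c])
    then have "P \<in> phi j l ` W" using P by (auto simp: W_def)
    moreover have "phi j l ` W \<subseteq> U" by (auto simp: W_def)
    ultimately show "\<exists>V s'. P \<in> V \<and> V \<subseteq> U \<and> s' \<in> sec (Osh m n) V \<and> (\<forall>x y. pt x \<in> V \<longrightarrow> s x y = s' x y)"
      by (intro exI[of _ "phi j l ` W"] exI[of _ s'] conjI) (auto simp: s'_def)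
  qed
qed

lemma sec_eqI:
  assumes U: "openin (zar X) U" and s: "bihomogeneous m n U s" and s': "bihomogeneous m n U s'"
    and eq: "\<And>j l u. j \<le> 1 \<Longrightarrow> l \<le> 1 \<Longrightarrow> phi j l u \<in> U \<Longrightarrow> cf j l s u = cf j l s' u"
  shows "s = s'"
proof (intro ext)
  fix x y
  show "s x y = s' x y"
  proof (cases "pt x \<in> U \<and> y \<in> proj (pt x)")
    case False
    then show ?thesis using s s' unfolding bihomogeneous_def by metis
  next
    case True
    then have "pt x \<in> pts" using openin_subset[OF U] by auto
    then obtain j l where jl: "j \<le> 1" "l \<le> 1" and c: "pt x \<in> chart j l" by (rule points_covered)
    obtain u where u: "pt x = phi j l u" by (rule chart_is_phi[OF jl c])
    have "x \<in> phi j l u" "y \<in> proj (phi j l u)" using pt_self[of x] True by (simp_all add: u)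
    then obtain c d where cd: "c \<noteq> 0" "d \<noteq> 0" and xy: "x = (\<lambda>i. c * xv j l u i)" "y = (\<lambda>i. d * yv j (fst u) i)"
      by (rule representative_chart[OF jl])
    have uU: "phi j l u \<in> U" using True u by simp
    show ?thesis
      unfolding xy bihomogeneous_chart[OF s jl uU cd] bihomogeneous_chart[OF s' jl uU cd] eq[OF jl uU] ..
  qed
qed

section \<open>The sheaf operations on chart coefficients and on sections\<close>

lemma cf_add: "cf j l (add (Osh m n) s s') u = cf j l s u + cf j l s' u"
  by (simp add: cf_def scroll_O_def)

lemma cf_act: "cf j l (act (Osh m n) g s) u = g (phi j l u) * cf j l s u"
  by (simp add: cf_def phi_def scroll_O_def)

lemma cf_res: "cf j l (res (Osh m n) W s) u = (if phi j l u \<in> W then cf j l s u else 0)"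
  by (simp add: cf_def phi_def scroll_O_def)

lemma sec_add:
  assumes U: "openin (zar X) U" and s: "s \<in> sec (Osh m n) U" and s': "s' \<in> sec (Osh m n) U"
  shows "add (Osh m n) s s' \<in> sec (Osh m n) U"
proof -
  have e: "add (Osh m n) s s' = (\<lambda>x y. s x y + s' x y)" by (simp add: scroll_O_def)
  have "bihomogeneous m n U (\<lambda>x y. s x y + s' x y)"
    using sec_bihomogeneous[OF U s] sec_bihomogeneous[OF U s'] unfolding bihomogeneous_def
    by (simp add: distrib_left)
  moreover have "areg {u. phi j l u \<in> U} (cf j l (\<lambda>x y. s x y + s' x y))" if "j \<le> 1" "l \<le> 1" for j l
    by (rule areg_cong[OF areg_add[OF sec_areg_cf[OF U s that] sec_areg_cf[OF U s' that]]]) (simp add: cf_def)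
  ultimately show ?thesis unfolding e sec_iff[OF U] by blast
qed

lemma sec_act:
  assumes U: "openin (zar X) U" and s: "s \<in> sec (Osh m n) U" and g: "reg X U g"
  shows "act (Osh m n) g s \<in> sec (Osh m n) U"
proof -
  have e: "act (Osh m n) g s = (\<lambda>x y. g (pt x) * s x y)" by (simp add: scroll_O_def)
  have "bihomogeneous m n U (\<lambda>x y. g (pt x) * s x y)"
    using sec_bihomogeneous[OF U s] unfolding bihomogeneous_def by (simp add: pt_scale)
  moreover have "areg {u. phi j l u \<in> U} (cf j l (\<lambda>x y. g (pt x) * s x y))" if "j \<le> 1" "l \<le> 1" for j l
    by (rule areg_cong[OF areg_mult[OF areg_pullback[OF that g] sec_areg_cf[OF U s that]]]) (simp add: cf_def phi_def)
  ultimately show ?thesis unfolding e sec_iff[OF U] by blast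
qed

lemma sec_res:
  assumes U: "openin (zar X) U" and s: "s \<in> sec (Osh m n) U" and W: "openin (zar X) W" "W \<subseteq> U"
  shows "res (Osh m n) W s \<in> sec (Osh m n) W"
proof -
  have e: "res (Osh m n) W s = (\<lambda>x y. if pt x \<in> W then s x y else 0)" by (simp add: scroll_O_def)
  have "bihomogeneous m n W (\<lambda>x y. if pt x \<in> W then s x y else 0)"
    using sec_bihomogeneous[OF U s] W(2) unfolding bihomogeneous_def by (auto simp: pt_scale)
  moreover have "areg {u. phi j l u \<in> W} (cf j l (\<lambda>x y. if pt x \<in> W then s x y else 0))" if "j \<le> 1" "l \<le> 1" for j l
  proof (rule areg_cong[OF areg_subset[OF sec_areg_cf[OF U s that]]])
    show "aopen {u. phi j l u \<in> W}" by (rule aopen_pullback[OF that W(1)])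
  qed (use W(2) in \<open>auto simp: cf_def phi_def\<close>)
  ultimately show ?thesis unfolding e sec_iff[OF W(1)] by blast
qed

section \<open>Changing charts\<close>

text \<open>The coordinates of a point in the chart \<open>(1 - j, l)\<close> in terms of those in \<open>(j, l)\<close>, and likewise
  for \<open>(j, 1 - l)\<close>.\<close>

definition swap_base :: "nat \<Rightarrow> 'k::field \<times> 'k \<Rightarrow> 'k \<times> 'k" where
  "swap_base l u = (1 / fst u, fst u ^ adeg (1 - l) * snd u / fst u ^ adeg l)"

definition swap_fibre :: "'k::field \<times> 'k \<Rightarrow> 'k \<times> 'k" where
  "swap_fibre u = (fst u, 1 / snd u)"

lemma one_minus_le: "1 - (j::nat) \<le> 1"
  by simp

lemma xv_swap_base:
  assumes jl: "j \<le> 1" "l \<le> 1" and t: "fst u \<noteq> 0"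
  shows "xv j l u = (\<lambda>i. fst u ^ adeg l * xv (1 - j) l (swap_base l u) i)"
    and "yv j (fst u) = (\<lambda>i. fst u * yv (1 - j) (fst (swap_base l u)) i)"
    and "phi j l u = phi (1 - j) l (swap_base l u)"
proof -
  have j': "1 - (1 - j) = j" using jl by simp
  show x: "xv j l u = (\<lambda>i. fst u ^ adeg l * xv (1 - j) l (swap_base l u) i)"
    using scroll_map_normal_form[OF one_minus_le[of j] jl(2) yv_nonzero[OF jl(1), of "fst u"] yv_nonzero[OF jl(2), of "snd u"]] jl t
    unfolding xv_def swap_base_def j' by simp
  show "yv j (fst u) = (\<lambda>i. fst u * yv (1 - j) (fst (swap_base l u)) i)"
    using vec_eq_yv[OF one_minus_le[of j] yv_nonzero[OF jl(1), of "fst u"]] jl t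
    unfolding swap_base_def j' by simp
  show "phi j l u = phi (1 - j) l (swap_base l u)"
    unfolding phi_def x by (rule pt_scale) (use t in simp)
qed

lemma xv_swap_fibre:
  assumes jl: "j \<le> 1" "l \<le> 1" and w: "snd u \<noteq> 0"
  shows "xv j l u = (\<lambda>i. snd u * xv j (1 - l) (swap_fibre u) i)"
    and "phi j l u = phi j (1 - l) (swap_fibre u)"
proof -
  have l': "1 - (1 - l) = l" using jl by simp
  show x: "xv j l u = (\<lambda>i. snd u * xv j (1 - l) (swap_fibre u) i)"
    using scroll_map_normal_form[OF jl(1) one_minus_le[of l] yv_nonzero[OF jl(1), of "fst u"] yv_nonzero[OF jl(2), of "snd u"]] jl w
    unfolding xv_def swap_fibre_def l' by simp
  show "phi j l u = phi j (1 - l) (swap_fibre u)"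
    unfolding phi_def x by (rule pt_scale) (use w in simp)
qed

lemma chart_overlap_base:
  assumes jl: "j \<le> 1" "l \<le> 1" and "phi j l u \<in> chart (1 - j) l"
  shows "fst u \<noteq> 0"
proof -
  have "xv j l u (corner (1 - j) l) \<noteq> 0" using assms(3) unfolding phi_def pt_in_chart by simp
  then show ?thesis using jl by (auto simp: xv_def scroll_map_corner)
qed

lemma chart_overlap_fibre:
  assumes jl: "j \<le> 1" "l \<le> 1" and "phi j l u \<in> chart j (1 - l)"
  shows "snd u \<noteq> 0"
proof -
  have "xv j l u (corner j (1 - l)) \<noteq> 0" using assms(3) unfolding phi_def pt_in_chart by simp
  then show ?thesis using jl by (auto simp: xv_def scroll_map_corner)
qed

text \<open>The corner coordinate of the opposite chart is a positive power of t times w at a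
  normalised vector. So a common point of opposite charts lies in all four.\<close>

lemma chart_overlap_both:
  assumes jl: "j \<le> 1" "l \<le> 1" and "phi j l u \<in> chart (1 - j) (1 - l)"
  shows "fst u \<noteq> 0" "snd u \<noteq> 0"
proof -
  have "xv j l u (corner (1 - j) (1 - l)) \<noteq> 0" using assms(3) unfolding phi_def pt_in_chart by simp
  then show "fst u \<noteq> 0" "snd u \<noteq> 0" using jl adeg_pos[of "1 - l"] by (auto simp: xv_def scroll_map_corner)
qed

text \<open>The scalars are those of \<open>xv_swap_base\<close>: t^(a_l) for the vector x and t for
  the vector y.\<close>

lemma cf_swap_base:
  assumes s: "bihomogeneous m n U s" and jl: "j \<le> 1" "l \<le> 1" and t: "fst u \<noteq> 0" and u: "phi j l u \<in> U"
  shows "cf j l s u = (fst u ^ adeg l) powi m * fst u powi n * cf (1 - j) l s (swap_base l u)"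
  unfolding cf_def[of j l] xv_swap_base(1)[OF jl t] xv_swap_base(2)[OF jl t]
  by (rule bihomogeneous_chart[OF s one_minus_le jl(2)]) (use u t xv_swap_base(3)[OF jl t] in auto)

lemma cf_swap_fibre:
  assumes s: "bihomogeneous m n U s" and jl: "j \<le> 1" "l \<le> 1" and w: "snd u \<noteq> 0" and u: "phi j l u \<in> U"
  shows "cf j l s u = snd u powi m * cf j (1 - l) s (swap_fibre u)"
proof -
  have "s (\<lambda>i. snd u * xv j (1 - l) (swap_fibre u) i) (\<lambda>i. 1 * yv j (fst (swap_fibre u)) i) =
      snd u powi m * 1 powi n * cf j (1 - l) s (swap_fibre u)"
    by (rule bihomogeneous_chart[OF s jl(1) one_minus_le]) (use u w xv_swap_fibre(2)[OF jl w] in auto)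
  then show ?thesis unfolding cf_def[of j l] xv_swap_fibre(1)[OF jl w] by (simp add: swap_fibre_def)
qed

text \<open>Chain rule, with h the expression of a coordinate of the other chart in the coordinates
  of the present one.\<close>

lemma tc_transition:
  fixes v :: "((nat \<Rightarrow> 'k::field_char_0) set, 'k) tvec"
  assumes jl: "j \<le> 1" "l \<le> 1" and jl': "j' \<le> 1" "l' \<le> 1" and v: "tangent X (phi j l u) v"
    and h: "areg W h" "u \<in> W" and W: "\<And>w. w \<in> W \<Longrightarrow> phi j l w \<in> chart j' l' \<and> coord j' l' i (phi j l w) = h w"
  shows "tc j' l' i v = dd 0 h u * tc j l 0 v + dd 1 h u * tc j l 1 v"
proof -
  have im: "phi j' l' ` UNIV = chart j' l'"
  proof
    show "phi j' l' ` UNIV \<subseteq> chart j' l'" using phi_in_chart[OF jl'] by blast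
    show "chart j' l' \<subseteq> phi j' l' ` UNIV"
    proof
      fix P assume "P \<in> chart j' l'"
      then have "phi j' l' (xi j' l' P) = P" by (rule phi_xi[OF jl'])
      then show "P \<in> phi j' l' ` UNIV" by (metis rangeI)
    qed
  qed
  have r: "reg X (chart j' l') (coord j' l' i)" using reg_coord[OF jl' aopen_UNIV, of i] unfolding im .
  have "tc j' l' i v = v (coord j' l' i)" by (simp add: tc_coord)
  also have "\<dots> = dd 0 (\<lambda>u. coord j' l' i (phi j l u)) u * tc j l 0 v + dd 1 (\<lambda>u. coord j' l' i (phi j l u)) u * tc j l 1 v"
    by (rule tangent_chart'[OF jl v r]) (use W h(2) in blast)
  also have "\<dots> = dd 0 h u * tc j l 0 v + dd 1 h u * tc j l 1 v"
  proof -
    have "dd k (\<lambda>u. coord j' l' i (phi j l u)) u = dd k h u" for k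
      by (rule dd_cong[OF h(1) _ h(2), symmetric]) (use W in auto)
    then show ?thesis by simp
  qed
  finally show ?thesis .
qed

text \<open>Jacobian of (t, w) -> (1/t, t^(a' - a) w) with a = a_l and a' = a_(1-l). The extra term
  (a' - a) w dt / t is what the Euler correction has to absorb.\<close>

lemma tc_swap_base:
  fixes v :: "((nat \<Rightarrow> 'k::field_char_0) set, 'k) tvec"
  assumes jl: "j \<le> 1" "l \<le> 1" and v: "tangent X (phi j l u) v" and t: "fst u \<noteq> 0"
  shows "tc (1 - j) l 0 v = - tc j l 0 v / (fst u)\<^sup>2"
    and "tc (1 - j) l 1 v = fst u ^ adeg (1 - l) / fst u ^ adeg l *
      ((of_nat (adeg (1 - l)) - of_nat (adeg l)) * snd u / fst u * tc j l 0 v + tc j l 1 v)"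
proof -
  define W where "W = {w :: 'k \<times> 'k. fst w \<noteq> 0}"
  have W: "aopen W" using aopen_nonzero[OF areg_fst[OF aopen_UNIV]] by (simp add: W_def)
  have uW: "u \<in> W" using t by (simp add: W_def)
  have tr: "phi j l w \<in> chart (1 - j) l \<and> coord (1 - j) l i (phi j l w) = (if i = 0 then fst (swap_base l w) else snd (swap_base l w))"
    if "w \<in> W" for w i
  proof -
    have e: "phi j l w = phi (1 - j) l (swap_base l w)" by (rule xv_swap_base(3)[OF jl]) (use that in \<open>simp add: W_def\<close>)
    show ?thesis using phi_in_chart[OF one_minus_le[of j] jl(2), of "swap_base l w"] jl
      unfolding e coord_def by simp
  qed
  define p where "p = (\<lambda>n (w :: 'k \<times> 'k). fst w ^ n)"
  have p_poly: "p n = (\<lambda>w. poly (monom 1 n) (fst w))" for n by (simp add: p_def poly_monom)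
  have p: "areg W (p n)" for n unfolding p_poly by (rule areg_poly[OF W])
  \<comment> \<open>Multiplied by t in order to avoid the exponent n - 1, which would be truncated
    at n = 0.\<close>
  have dp: "dd 0 (p n) u * fst u = of_nat n * fst u ^ n" "dd 1 (p n) u = 0" for n
    unfolding p_poly dd_poly by (cases n; simp add: pderiv_monom poly_monom)+
  have nz: "p n w \<noteq> 0" if "w \<in> W" for n w using that by (simp add: p_def W_def)
  have f: "areg W (\<lambda>w. 1 / fst w)" by (rule areg_divide[OF areg_const[OF W] areg_fst[OF W]]) (simp add: W_def)
  have d: "dd k (\<lambda>w. 1 / fst w) u = - dd k fst u / (fst u)\<^sup>2" for k
    using dd_divide[OF areg_const[OF W, of 1] areg_fst[OF W] _ uW, of k] by (simp add: W_def)
  have "tc (1 - j) l 0 v = dd 0 (\<lambda>w. 1 / fst w) u * tc j l 0 v + dd 1 (\<lambda>w. 1 / fst w) u * tc j l 1 v"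
    by (rule tc_transition[OF jl one_minus_le jl(2) v f uW]) (use tr[of _ 0] in \<open>simp add: swap_base_def\<close>)
  then show "tc (1 - j) l 0 v = - tc j l 0 v / (fst u)\<^sup>2" by (simp add: d dd_fst)
  define a' a where "a' = adeg (1 - l)" and "a = adeg l"
  define h where "h = (\<lambda>w. p a' w * snd w / p a w)"
  have pm: "areg W (\<lambda>w. p a' w * snd w)" by (rule areg_mult[OF p areg_snd[OF W]])
  have h: "areg W h" unfolding h_def by (rule areg_divide[OF pm p]) (rule nz)
  have dm: "dd k (\<lambda>w. p a' w * snd w) u = p a' u * dd k snd u + snd u * dd k (p a') u" for k
    by (rule dd_mult[OF p areg_snd[OF W] uW])
  have dh: "dd k h u = ((p a' u * dd k snd u + snd u * dd k (p a') u) * p a u - p a' u * snd u * dd k (p a) u) / (p a u)\<^sup>2" for k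
    unfolding h_def dm[symmetric] by (rule dd_divide[OF pm p nz uW])
  have "tc (1 - j) l 1 v = dd 0 h u * tc j l 0 v + dd 1 h u * tc j l 1 v"
    by (rule tc_transition[OF jl one_minus_le jl(2) v h uW])
      (use tr[of _ 1] in \<open>simp add: swap_base_def h_def p_def a'_def a_def\<close>)
  moreover have "dd 1 h u = p a' u / p a u"
    unfolding dh using nz[OF uW, of a] by (simp add: dd_snd dp power2_eq_square)
  moreover have "dd 0 h u = p a' u / p a u * ((of_nat a' - of_nat a) * snd u / fst u)"
  proof -
    have e: "dd 0 (p n) u = of_nat n * p n u / fst u" for n using dp(1)[of n] t by (simp add: field_simps p_def)
    show ?thesis unfolding dh e using nz[OF uW, of a] t by (simp add: dd_snd field_simps power2_eq_square)
  qed
  ultimately show "tc (1 - j) l 1 v = fst u ^ adeg (1 - l) / fst u ^ adeg l *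
      ((of_nat (adeg (1 - l)) - of_nat (adeg l)) * snd u / fst u * tc j l 0 v + tc j l 1 v)"
    by (simp add: p_def a_def a'_def algebra_simps)
qed

lemma tc_swap_fibre:
  fixes v :: "((nat \<Rightarrow> 'k::field_char_0) set, 'k) tvec"
  assumes jl: "j \<le> 1" "l \<le> 1" and v: "tangent X (phi j l u) v" and w: "snd u \<noteq> 0"
  shows "tc j (1 - l) 0 v = tc j l 0 v"
    and "tc j (1 - l) 1 v = - tc j l 1 v / (snd u)\<^sup>2"
proof -
  define W where "W = {w :: 'k \<times> 'k. snd w \<noteq> 0}"
  have W: "aopen W" using aopen_nonzero[OF areg_snd[OF aopen_UNIV]] by (simp add: W_def)
  have uW: "u \<in> W" using w by (simp add: W_def)
  have tr: "phi j l w \<in> chart j (1 - l) \<and> coord j (1 - l) i (phi j l w) = (if i = 0 then fst (swap_fibre w) else snd (swap_fibre w))"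
    if "w \<in> W" for w i
  proof -
    have e: "phi j l w = phi j (1 - l) (swap_fibre w)" by (rule xv_swap_fibre(2)[OF jl]) (use that in \<open>simp add: W_def\<close>)
    show ?thesis using phi_in_chart[OF jl(1) one_minus_le[of l], of "swap_fibre w"] jl
      unfolding e coord_def by simp
  qed
  have f: "areg W (\<lambda>w. 1 / snd w)" by (rule areg_divide[OF areg_const[OF W] areg_snd[OF W]]) (simp add: W_def)
  have d: "dd k (\<lambda>w. 1 / snd w) u = - dd k snd u / (snd u)\<^sup>2" for k
    using dd_divide[OF areg_const[OF W, of 1] areg_snd[OF W] _ uW, of k] by (simp add: W_def)
  have "tc j (1 - l) 0 v = dd 0 fst u * tc j l 0 v + dd 1 fst u * tc j l 1 v"
    by (rule tc_transition[OF jl jl(1) one_minus_le v areg_fst[OF W] uW]) (use tr[of _ 0] in \<open>simp add: swap_fibre_def\<close>)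
  then show "tc j (1 - l) 0 v = tc j l 0 v" by (simp add: dd_fst)
  have "tc j (1 - l) 1 v = dd 0 (\<lambda>w. 1 / snd w) u * tc j l 0 v + dd 1 (\<lambda>w. 1 / snd w) u * tc j l 1 v"
    by (rule tc_transition[OF jl jl(1) one_minus_le v f uW]) (use tr[of _ 1] in \<open>simp add: swap_fibre_def\<close>)
  then show "tc j (1 - l) 1 v = - tc j l 1 v / (snd u)\<^sup>2" by (simp add: d dd_snd)
qed

section \<open>Logarithmic forms along fibres\<close>

lemma linear_form_on_fibre:
  assumes "j \<le> 1" "l \<le> 1"
  shows "(\<forall>y\<in>proj (phi j l u). b 0 * y 0 + b 1 * y 1 = 0) \<longleftrightarrow> b j + b (1 - j) * fst u = 0"
proof -
  have e: "b 0 * yv j (fst u) 0 + b 1 * yv j (fst u) 1 = b j + b (1 - j) * fst u"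
    using assms(1) by (elim le_1_cases) (simp_all add: algebra_simps)
  show ?thesis unfolding scroll_proj_phi[OF assms]
  proof
    assume "\<forall>y\<in>pt (yv j (fst u)). b 0 * y 0 + b 1 * y 1 = 0"
    then show "b j + b (1 - j) * fst u = 0" using pt_self e by metis
  next
    assume z: "b j + b (1 - j) * fst u = 0"
    show "\<forall>y\<in>pt (yv j (fst u)). b 0 * y 0 + b 1 * y 1 = 0"
    proof
      fix y assume "y \<in> pt (yv j (fst u))"
      then obtain c where "y = (\<lambda>i. c * yv j (fst u) i)" by (rule ptE)
      then have "b 0 * y 0 + b 1 * y 1 = c * (b j + b (1 - j) * fst u)"
        unfolding e[symmetric] by (simp add: algebra_simps)
      then show "b 0 * y 0 + b 1 * y 1 = 0" using z by simp
    qed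
  qed
qed

lemma exists_sec_of_chart:
  fixes g :: "'k::field \<times> 'k \<Rightarrow> 'k"
  assumes jl: "j \<le> 1" "l \<le> 1" and g: "areg W g"
  obtains s where "s \<in> sec (Osh m n) (phi j l ` W)" "\<And>u. u \<in> W \<Longrightarrow> cf j l s u = g u"
proof -
  define s where "s = (\<lambda>x y. if pt x \<in> phi j l ` W \<and> y \<in> proj (pt x)
    then g (xi j l (pt x)) * x (corner j l) powi m * y j powi n else 0)"
  have val: "s (\<lambda>i. c * xv j l u i) (\<lambda>i. d * yv j (fst u) i) = c powi m * d powi n * g u"
    if u: "u \<in> W" and c: "c \<noteq> 0" and d: "d \<noteq> 0" for u c d
  proof -
    have p: "pt (\<lambda>i. c * xv j l u i) = phi j l u" using c by (simp add: pt_scale phi_def)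
    have y: "(\<lambda>i. d * yv j (fst u) i) \<in> proj (phi j l u)"
      unfolding scroll_proj_phi[OF jl] by (rule pt_scale_mem[OF d])
    show ?thesis unfolding s_def p using y u jl by simp
  qed
  have "s \<in> sec (Osh m n) (phi j l ` W)"
    by (rule sec_of_chart[OF jl g _ val]) (auto simp: s_def)
  moreover have "cf j l s u = g u" if "u \<in> W" for u
    using val[OF that, of 1 1] by (simp add: cf_def)
  ultimately show ?thesis by (rule that)
qed

end

text \<open>Here every member of D already comes with a linear form \<open>lf L\<close> that cuts it
  out. \<open>L1\<close> is the fibre whose form serves as l in the splitting.\<close>

locale fibre_arrangement = scroll_surface a0 a1 for a0 a1 :: nat +
  fixes D :: "(nat \<Rightarrow> 'k::field_char_0) set set set"
    and lf :: "(nat \<Rightarrow> 'k) set set \<Rightarrow> nat \<Rightarrow> 'k"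
    and L1 :: "(nat \<Rightarrow> 'k) set set"
  assumes finite_D: "finite D" and L1: "L1 \<in> D"
    and lf_nonzero: "L \<in> D \<Longrightarrow> lf L 0 \<noteq> 0 \<or> lf L 1 \<noteq> 0"
    and fibre: "L \<in> D \<Longrightarrow>
      L = {P \<in> pts. \<forall>y\<in>proj P. lf L 0 * y 0 + lf L 1 * y 1 = 0}"
begin

text \<open>The linear form of L at y_j = 1, y_(1-j) = t. It is a nonzero constant if L is the fibre
  y_j = 0, which the chart misses.\<close>

definition lin :: "(nat \<Rightarrow> 'k) set set \<Rightarrow> nat \<Rightarrow> 'k poly" where
  "lin L j = [:lf L j, lf L (1 - j):]"

definition Fp :: "nat \<Rightarrow> 'k poly" where
  "Fp j = (\<Prod>L\<in>D. lin L j)"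

text \<open>The cofactor of the form of \<open>L1\<close> in \<open>Fp\<close>; it appears when dl /
  l is written with denominator \<open>Fp\<close>.\<close>

definition Gp :: "nat \<Rightarrow> 'k poly" where
  "Gp j = (\<Prod>L\<in>D - {L1}. lin L j)"

lemma Fp_eq: "Fp j = lin L1 j * Gp j"
  unfolding Fp_def Gp_def by (rule prod.remove[OF finite_D L1])

lemma lin_nonzero: "L \<in> D \<Longrightarrow> j \<le> 1 \<Longrightarrow> lin L j \<noteq> 0"
  using lf_nonzero by (elim le_1_cases) (auto simp: lin_def)

lemma phi_in_fibre:
  assumes "L \<in> D" and jl: "j \<le> 1" "l \<le> 1"
  shows "phi j l u \<in> L \<longleftrightarrow> poly (lin L j) (fst u) = 0"
proof -
  have "phi j l u \<in> pts" using phi_in_chart[OF jl] chart_subset by blast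
  then have "phi j l u \<in> L \<longleftrightarrow> (\<forall>y\<in>proj (phi j l u). lf L 0 * y 0 + lf L 1 * y 1 = 0)"
    by (subst fibre[OF assms(1)]) simp
  then show ?thesis unfolding linear_form_on_fibre[OF jl] by (simp add: lin_def mult.commute)
qed

lemma phi_in_union:
  assumes "j \<le> 1" "l \<le> 1"
  shows "phi j l u \<in> \<Union>D \<longleftrightarrow> poly (Fp j) (fst u) = 0"
  using phi_in_fibre[OF _ assms] finite_D by (auto simp: Fp_def poly_prod)

lemma Fp_nonzero: "j \<le> 1 \<Longrightarrow> Fp j \<noteq> 0"
  using finite_D lin_nonzero by (simp add: Fp_def)

text \<open>A linear form whose dehomogenisation vanishes at t is a nonzero multiple of y_(1-j) - t
  y_j, so the root determines the fibre.\<close>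

lemma fibre_eqI:
  assumes L: "L \<in> D" "L' \<in> D" and j: "j \<le> 1" and z: "poly (lin L j) t = 0" "poly (lin L' j) t = 0"
  shows "L = L'"
proof -
  have slope: "lf M (1 - j) \<noteq> 0 \<and> lf M j = - lf M (1 - j) * t" if "M \<in> D" "poly (lin M j) t = 0" for M
    using lf_nonzero[OF that(1)] that(2) j
    by (elim le_1_cases) (auto simp: lin_def add_eq_0_iff2 mult.commute)
  have "(lf M 0 * y 0 + lf M 1 * y 1 = 0) \<longleftrightarrow> y (1 - j) = t * y j" if "M \<in> D" "poly (lin M j) t = 0" for M y
  proof -
    have "lf M 0 * y 0 + lf M 1 * y 1 = lf M (1 - j) * (y (1 - j) - t * y j)"
      using j slope[OF that] by (elim le_1_cases) (simp_all add: algebra_simps)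
    then show ?thesis using slope[OF that] by simp
  qed
  then have "{P \<in> pts. \<forall>y\<in>proj P. lf L 0 * y 0 + lf L 1 * y 1 = 0} =
    {P \<in> pts. \<forall>y\<in>proj P. lf L' 0 * y 0 + lf L' 1 * y 1 = 0}"
    using L z by simp
  then show ?thesis using fibre[OF L(1)] fibre[OF L(2)] by simp
qed

text \<open>Distinct fibres have no root in common, so exactly one linear factor vanishes at t, and
  its slope is nonzero.\<close>

lemma Fp_simple_roots:
  assumes j: "j \<le> 1" and z: "poly (Fp j) t = 0"
  shows "poly (pderiv (Fp j)) t \<noteq> 0"
proof -
  obtain L where L: "L \<in> D" "poly (lin L j) t = 0" using z finite_D by (auto simp: Fp_def poly_prod)
  have "poly (lin M j) t \<noteq> 0" if "M \<in> D - {L}" for M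
    using fibre_eqI[OF L(1) _ j L(2), of M] that by auto
  then have r: "poly (\<Prod>M\<in>D - {L}. lin M j) t \<noteq> 0" using finite_D by (simp add: poly_prod)
  have "lf L (1 - j) \<noteq> 0"
  proof
    assume "lf L (1 - j) = 0"
    moreover from this have "lf L j = 0" using L(2) by (simp add: lin_def)
    ultimately show False using lf_nonzero[OF L(1)] j by (elim le_1_cases) auto
  qed
  moreover have "Fp j = lin L j * (\<Prod>M\<in>D - {L}. lin M j)"
    unfolding Fp_def by (rule prod.remove[OF finite_D L(1)])
  moreover have "pderiv (lin L j) = [:lf L (1 - j):]" by (simp add: lin_def pderiv_pCons)
  ultimately show ?thesis using r L(2) by (simp add: pderiv_mult)
qed

lemma lin_swap: "j \<le> 1 \<Longrightarrow> t \<noteq> 0 \<Longrightarrow> poly (lin L (1 - j)) (1 / t) = poly (lin L j) t / t"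
  by (elim le_1_cases) (simp_all add: lin_def field_simps)

lemma Fp_swap: "j \<le> 1 \<Longrightarrow> t \<noteq> 0 \<Longrightarrow> poly (Fp (1 - j)) (1 / t) = poly (Fp j) t / t ^ card D"
  by (simp add: Fp_def poly_prod lin_swap prod_dividef)

text \<open>The sign with which y0 dy1 - y1 dy0 restricts to dt on y_j = 1, and in the same way for
  z0 dz1 - z1 dz0 on z_l = 1.\<close>

definition sg :: "nat \<Rightarrow> 'k" where
  "sg j = (if j = 0 then 1 else - 1)"

text \<open>The exponent of t in the transition of the fibre coordinate. Its product with
  \<open>sg l\<close> is a1 - a0 for both values of l.\<close>

definition ex :: "nat \<Rightarrow> 'k" where
  "ex l = of_nat (adeg (1 - l)) - of_nat (adeg l)"

text \<open>The coefficient of dt in dl / l for the linear form l of \<open>L1\<close>.\<close>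

definition theta :: "nat \<Rightarrow> 'k \<Rightarrow> 'k" where
  "theta j t = lf L1 (1 - j) / poly (lin L1 j) t"

text \<open>
  In the homogeneous coordinates \<open>(y, z)\<close> this is
  \<open>A (y\<^sub>0 dy\<^sub>1 - y\<^sub>1 dy\<^sub>0) / F + B (z\<^sub>0 dz\<^sub>1 - z\<^sub>1 dz\<^sub>0 + (a\<^sub>1 - a\<^sub>0) z\<^sub>0 z\<^sub>1 d\<lambda> / \<lambda>)\<close>
  restricted to \<open>y\<^sub>j = z\<^sub>l = 1\<close>, where \<open>F\<close> is the product of the linear forms of the fibres and \<open>\<lambda>\<close>
  is one of these linear forms. The last summand makes the coefficient of \<open>B\<close> vanish on the Euler
  vector fields.
\<close>

definition psi ::
    "nat \<Rightarrow> nat \<Rightarrow> ((nat \<Rightarrow> 'k) \<Rightarrow> (nat \<Rightarrow> 'k) \<Rightarrow> 'k) \<Rightarrow> ((nat \<Rightarrow> 'k) \<Rightarrow> (nat \<Rightarrow> 'k) \<Rightarrow> 'k) \<Rightarrow>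
     'k \<times> 'k \<Rightarrow> ((nat \<Rightarrow> 'k) set, 'k) tvec \<Rightarrow> 'k" where
  "psi j l A B u v = sg j * cf j l A u / poly (Fp j) (fst u) * tc j l 0 v +
     sg l * cf j l B u * (tc j l 1 v + ex l * snd u * theta j (fst u) * tc j l 0 v)"

abbreviation SA :: "((nat \<Rightarrow> 'k) set, 'k, (nat \<Rightarrow> 'k) \<Rightarrow> (nat \<Rightarrow> 'k) \<Rightarrow> 'k) mod_sheaf" where
  "SA \<equiv> Osh 0 (int (card D) - 2)"

abbreviation SB :: "((nat \<Rightarrow> 'k) set, 'k, (nat \<Rightarrow> 'k) \<Rightarrow> (nat \<Rightarrow> 'k) \<Rightarrow> 'k) mod_sheaf" where
  "SB \<equiv> Osh (- 2) (int a0 + int a1)"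

abbreviation OmegaD :: "((nat \<Rightarrow> 'k) set, 'k, ((nat \<Rightarrow> 'k) set, 'k) form1) mod_sheaf" where
  "OmegaD \<equiv> log_1forms X (\<Union>D)"

lemma sg_swap: "j \<le> 1 \<Longrightarrow> sg (1 - j) = - sg j"
  by (elim le_1_cases) (simp_all add: sg_def)

lemma sg_square [simp]: "sg j * sg j = 1" "sg j * (sg j * x) = x"
  by (simp_all add: sg_def)

lemma sg_nonzero [simp]: "sg j \<noteq> 0"
  by (simp add: sg_def)

text \<open>Each summand is invariant by itself. For A the factor t^a / t^2 of the section is
  matched by t^a from F and -1 / t^2 from dt, the sign being taken up by \<open>sg\<close>. For B
  the extra Jacobian term is matched by the change of \<open>theta\<close>.\<close>

lemma psi_swap_base:
  assumes A: "bihomogeneous 0 (int (card D) - 2) U A" and B: "bihomogeneous (- 2) (int a0 + int a1) U B"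
    and jl: "j \<le> 1" "l \<le> 1" and t: "fst u \<noteq> 0" and u: "phi j l u \<in> U" "phi j l u \<notin> \<Union>D"
    and v: "tangent X (phi j l u) v"
  shows "psi j l A B u v = psi (1 - j) l A B (swap_base l u) v"
proof -
  define t w where tw: "t = fst u" "w = snd u"
  define T where "T = t ^ adeg (1 - l) / t ^ adeg l"
  define f where "f = poly (Fp j) t"
  define q where "q = poly (lin L1 j) t"
  define \<alpha> \<beta> where "\<alpha> = cf (1 - j) l A (swap_base l u)" and "\<beta> = cf (1 - j) l B (swap_base l u)"
  have t0: "t \<noteq> 0" using t by (simp add: tw)
  have f0: "f \<noteq> 0" using u(2) phi_in_union[OF jl, of u] by (simp add: f_def tw)
  then have q0: "q \<noteq> 0" by (simp add: f_def q_def Fp_eq)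
  have qe: "q = lf L1 j + t * lf L1 (1 - j)" by (simp add: q_def lin_def)
  have N: "t powi (int (card D) - 2) = t ^ card D / t\<^sup>2"
    using t0 by (simp add: power_int_diff)
  have cA: "cf j l A u = t ^ card D / t\<^sup>2 * \<alpha>"
    using cf_swap_base[OF A jl t u(1)] unfolding N[symmetric] \<alpha>_def by (simp add: tw)
  have s: "int a0 + int a1 = int (adeg l) + int (adeg (1 - l))"
    using jl(2) by (elim le_1_cases) (simp_all add: adeg_def)
  \<comment> \<open>The transition factor of a section of -2H + cf is the one by which the fibre
    coordinate changes; this is what the twist of the second summand is for.\<close>
  have T0: "(t ^ adeg l) powi (- 2) * t powi (int a0 + int a1) = T"
    unfolding s T_def using t0 by (simp add: power_int_minus power_int_add power2_eq_square field_simps)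
  have cB: "cf j l B u = T * \<beta>"
    unfolding T0[symmetric] \<beta>_def tw by (rule cf_swap_base[OF B jl t u(1)])
  have sb: "fst (swap_base l u) = 1 / t" "snd (swap_base l u) = T * w"
    by (simp_all add: swap_base_def T_def tw)
  have th': "theta (1 - j) (1 / t) = lf L1 j * t / q"
    using jl(1) lin_swap[OF jl(1) t0, of L1] by (simp add: theta_def q_def)
  have th: "theta j t = lf L1 (1 - j) / q" by (simp add: theta_def q_def)
  have f': "poly (Fp (1 - j)) (1 / t) = f / t ^ card D" unfolding f_def by (rule Fp_swap[OF jl(1) t0])
  define x0 x1 where "x0 = tc j l 0 v" and "x1 = tc j l 1 v"
  have tc: "tc (1 - j) l 0 v = - x0 / t\<^sup>2" "tc (1 - j) l 1 v = T * (ex l * w / t * x0 + x1)"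
    using tc_swap_base[OF jl v t] by (simp_all add: x0_def x1_def tw T_def ex_def)
  \<comment> \<open>The dehomogenisations of l in the two charts differ by a factor t, so their
    logarithmic differentials differ by dt / t. Multiplied by \<open>ex l * w\<close> this is the
    extra term in \<open>tc_swap_base\<close>.\<close>
  have k: "theta j t = 1 / t - lf L1 j * t / q / t\<^sup>2"
  proof -
    have e: "lf L1 j = q - t * lf L1 (1 - j)" by (simp add: qe)
    show ?thesis unfolding th e using t0 q0 by (simp add: field_simps power2_eq_square)
  qed
  have "psi j l A B u v = sg j * (t ^ card D / t\<^sup>2 * \<alpha>) / f * x0 + sg l * (T * \<beta>) * (x1 + ex l * w * theta j t * x0)"
    unfolding psi_def cA cB by (simp add: f_def tw x0_def x1_def)
  moreover have "psi (1 - j) l A B (swap_base l u) v =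
    - sg j * \<alpha> / (f / t ^ card D) * (- x0 / t\<^sup>2) +
     sg l * \<beta> * (T * (ex l * w / t * x0 + x1) + ex l * (T * w) * (lf L1 j * t / q) * (- x0 / t\<^sup>2))"
    unfolding psi_def sb tc th' f' sg_swap[OF jl(1)] \<alpha>_def \<beta>_def ..
  moreover have "sg j * (t ^ card D / t\<^sup>2 * \<alpha>) / f * x0 = - sg j * \<alpha> / (f / t ^ card D) * (- x0 / t\<^sup>2)"
    by (simp add: mult_ac)
  moreover have "sg l * (T * \<beta>) * (x1 + ex l * w * theta j t * x0) =
     sg l * \<beta> * (T * (ex l * w / t * x0 + x1) + ex l * (T * w) * (lf L1 j * t / q) * (- x0 / t\<^sup>2))"
    unfolding k by (simp add: algebra_simps)
  ultimately show ?thesis by simp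
qed

lemma psi_swap_fibre:
  assumes A: "bihomogeneous 0 (int (card D) - 2) U A" and B: "bihomogeneous (- 2) (int a0 + int a1) U B"
    and jl: "j \<le> 1" "l \<le> 1" and w: "snd u \<noteq> 0" and u: "phi j l u \<in> U"
    and v: "tangent X (phi j l u) v"
  shows "psi j l A B u v = psi j (1 - l) A B (swap_fibre u) v"
proof -
  have cA: "cf j l A u = cf j (1 - l) A (swap_fibre u)" using cf_swap_fibre[OF A jl w u] by simp
  have cB: "cf j l B u = cf j (1 - l) B (swap_fibre u) / (snd u)\<^sup>2"
    using cf_swap_fibre[OF B jl w u] by (simp add: power_int_minus field_simps)
  have e: "ex (1 - l) = - ex l" using jl(2) by (elim le_1_cases) (simp_all add: ex_def)
  have sf: "fst (swap_fibre u) = fst u" "snd (swap_fibre u) = 1 / snd u" by (simp_all add: swap_fibre_def)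
  show ?thesis
    unfolding psi_def cA cB sf e tc_swap_fibre[OF jl v w] sg_swap[OF jl(2)]
    using w by (simp add: field_simps power2_eq_square)
qed

lemma psi_eq:
  assumes A: "bihomogeneous 0 (int (card D) - 2) U A" and B: "bihomogeneous (- 2) (int a0 + int a1) U B"
    and jl: "j \<le> 1" "l \<le> 1" and jl': "j' \<le> 1" "l' \<le> 1" and e: "phi j l u = phi j' l' u'"
    and u: "phi j l u \<in> U" "phi j l u \<notin> \<Union>D" and v: "tangent X (phi j l u) v"
  shows "psi j l A B u v = psi j' l' A B u' v"
proof -
  have c: "phi j l u \<in> chart j' l'" unfolding e by (rule phi_in_chart[OF jl'])
  have base: "psi j l A B u v = psi (1 - j) l A B u' v" if "phi j l u = phi (1 - j) l u'" for u'
  proof -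
    have t: "fst u \<noteq> 0" by (rule chart_overlap_base[OF jl]) (use that jl in simp)
    have "u' = swap_base l u" using xv_swap_base(3)[OF jl t] that phi_inj[OF one_minus_le jl(2)] by metis
    then show ?thesis using psi_swap_base[OF A B jl t u v] by simp
  qed
  have fib: "psi i l A B u v = psi i (1 - l) A B u' v"
    if "phi i l u = phi i (1 - l) u'" "i \<le> 1" "phi i l u \<in> U" "tangent X (phi i l u) v" for u u' i
  proof -
    have w: "snd u \<noteq> 0" by (rule chart_overlap_fibre[OF that(2) jl(2)]) (use that jl in simp)
    have "u' = swap_fibre u" using xv_swap_fibre(2)[OF that(2) jl(2) w] that phi_inj[OF that(2) one_minus_le] by metis
    then show ?thesis using psi_swap_fibre[OF A B that(2) jl(2) w that(3,4)] by simp
  qed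
  have j: "j' = j \<or> j' = 1 - j" and l: "l' = l \<or> l' = 1 - l" using jl jl' by linarith+
  from j l consider "j' = j" "l' = l" | "j' = 1 - j" "l' = l" | "j' = j" "l' = 1 - l" | "j' = 1 - j" "l' = 1 - l" by blast
  then show ?thesis
  proof cases
    case 1
    have "u = u'" using e unfolding 1 phi_inj[OF jl] .
    then show ?thesis using 1 by simp
  next
    case 2
    then show ?thesis using base[of u'] e by simp
  next
    case 3
    then show ?thesis using fib[of j u u'] e jl u v by simp
  next
    case 4
    \<comment> \<open>One index is changed at a time; by this inequality the point also lies in the
      intermediate chart with indices \<open>1 - j\<close> and \<open>l\<close>.\<close>
    have t: "fst u \<noteq> 0" by (rule chart_overlap_both[OF jl]) (use c 4 in simp)
    define u'' where "u'' = swap_base l u"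
    have u'': "phi j l u = phi (1 - j) l u''" unfolding u''_def by (rule xv_swap_base(3)[OF jl t])
    have "psi j l A B u v = psi (1 - j) l A B u'' v" by (rule base[OF u''])
    also have "\<dots> = psi (1 - j) (1 - l) A B u' v"
      by (rule fib) (use u'' e 4 u v in auto)
    finally show ?thesis using 4 by simp
  qed
qed

text \<open>The global form is assembled pointwise from a chart chosen at each point;
  \<open>psi_eq\<close> makes the choice irrelevant.\<close>

definition chart_at :: "(nat \<Rightarrow> 'k) set \<Rightarrow> nat \<times> nat" where
  "chart_at P = (SOME jl. fst jl \<le> 1 \<and> snd jl \<le> 1 \<and> P \<in> chart (fst jl) (snd jl))"

lemma chart_at:
  assumes "P \<in> pts"
  shows "fst (chart_at P) \<le> 1" "snd (chart_at P) \<le> 1" "P \<in> chart (fst (chart_at P)) (snd (chart_at P))"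
proof -
  obtain j l where "j \<le> 1" "l \<le> 1" "P \<in> chart j l" by (rule points_covered[OF assms])
  then have "\<exists>jl. fst jl \<le> 1 \<and> snd jl \<le> 1 \<and> P \<in> chart (fst jl) (snd jl)" by (intro exI[of _ "(j, l)"]) simp
  from someI_ex[OF this] show "fst (chart_at P) \<le> 1" "snd (chart_at P) \<le> 1" "P \<in> chart (fst (chart_at P)) (snd (chart_at P))"
    unfolding chart_at_def by blast+
qed

text \<open>The default value 0, taken on D, outside U and on functionals that are not tangent
  vectors, is the one prescribed for sections of \<open>log_1forms\<close>.\<close>

definition Psi :: "(nat \<Rightarrow> 'k) set set \<Rightarrow>
    ((nat \<Rightarrow> 'k) \<Rightarrow> (nat \<Rightarrow> 'k) \<Rightarrow> 'k) \<times> ((nat \<Rightarrow> 'k) \<Rightarrow> (nat \<Rightarrow> 'k) \<Rightarrow> 'k) \<Rightarrow> ((nat \<Rightarrow> 'k) set, 'k) form1" where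
  "Psi U AB = (\<lambda>p v. if p \<in> U - \<Union>D \<and> tangent X p v
     then psi (fst (chart_at p)) (snd (chart_at p)) (fst AB) (snd AB) (xi (fst (chart_at p)) (snd (chart_at p)) p) v
     else 0)"

lemma Psi_chart:
  assumes A: "bihomogeneous 0 (int (card D) - 2) U A" and B: "bihomogeneous (- 2) (int a0 + int a1) U B"
    and jl: "j \<le> 1" "l \<le> 1" and u: "phi j l u \<in> U" "phi j l u \<notin> \<Union>D" and v: "tangent X (phi j l u) v"
  shows "Psi U (A, B) (phi j l u) v = psi j l A B u v"
proof -
  have P: "phi j l u \<in> pts" using phi_in_chart[OF jl] chart_subset by blast
  note c = chart_at[OF P]
  have "psi j l A B u v = psi (fst (chart_at (phi j l u))) (snd (chart_at (phi j l u))) A B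
      (xi (fst (chart_at (phi j l u))) (snd (chart_at (phi j l u))) (phi j l u)) v"
    by (rule psi_eq[OF A B jl c(1,2) _ u v]) (rule phi_xi[OF c, symmetric])
  then show ?thesis using u v by (simp add: Psi_def)
qed

text \<open>Since its roots are simple, \<open>Fp\<close> generates the ideal of the union and does
  not merely cut it out as a set; the quotient comes from \<open>areg_divisible\<close>.\<close>

lemma local_equation_chart:
  assumes jl: "j \<le> 1" "l \<le> 1" and W: "aopen W"
  shows "local_equation X (\<Union>D) (phi j l ` W) (\<lambda>P. poly (Fp j) (fst (xi j l P)))"
  unfolding local_equation_def
proof (intro conjI ballI allI impI)
  show "openin (zar X) (phi j l ` W)" by (rule openin_phi_image[OF jl W])
  show "reg X (phi j l ` W) (\<lambda>P. poly (Fp j) (fst (xi j l P)))"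
    by (rule reg_pushforward[OF jl areg_poly[OF W]])
  show "poly (Fp j) (fst (xi j l x)) = 0" if x: "x \<in> phi j l ` W \<inter> \<Union>D" for x
  proof -
    obtain w where "x = phi j l w" using x by blast
    then show ?thesis using x phi_in_union[OF jl, of w] jl by simp
  qed
  fix q U f assume q: "q \<in> phi j l ` W"
    and *: "openin (zar X) U \<and> q \<in> U \<and> U \<subseteq> phi j l ` W \<and> reg X U f \<and> (\<forall>x\<in>U \<inter> \<Union>D. f x = 0)"
  obtain u where u: "u \<in> W" "q = phi j l u" using q by blast
  have f: "areg {u. phi j l u \<in> U} (\<lambda>u. f (phi j l u))" by (rule areg_pullback[OF jl]) (use * in blast)
  obtain W' c where W': "u \<in> W'" "W' \<subseteq> {u. phi j l u \<in> U}" "areg W' c"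
      "\<And>x. x \<in> W' \<Longrightarrow> f (phi j l x) = c x * poly (Fp j) (fst x)"
  proof (rule areg_divisible[OF f Fp_nonzero[OF jl(1)] Fp_simple_roots[OF jl(1)]])
    show "f (phi j l x) = 0" if "x \<in> {u. phi j l u \<in> U}" "poly (Fp j) (fst x) = 0" for x
      using * that phi_in_union[OF jl] by blast
    show "u \<in> {u. phi j l u \<in> U}" using * u by simp
  qed blast+
  show "\<exists>W' g. openin (zar X) W' \<and> q \<in> W' \<and> W' \<subseteq> U \<and> reg X W' g \<and>
      (\<forall>x\<in>W'. f x = g x * poly (Fp j) (fst (xi j l x)))"
  proof (intro exI[of _ "phi j l ` W'"] exI[of _ "\<lambda>P. c (xi j l P)"] conjI)
    show "openin (zar X) (phi j l ` W')" by (rule openin_phi_image[OF jl areg_imp_aopen[OF W'(3)]])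
    show "q \<in> phi j l ` W'" using u W'(1) by blast
    show "phi j l ` W' \<subseteq> U" using W'(2) by blast
    show "reg X (phi j l ` W') (\<lambda>P. c (xi j l P))" by (rule reg_pushforward[OF jl W'(3)])
    show "\<forall>x\<in>phi j l ` W'. f x = c (xi j l x) * poly (Fp j) (fst (xi j l x))"
      by (rule phi_image_ballI) (simp add: W'(4) jl)
  qed
qed

lemma log_sec_iff:
  "\<omega> \<in> sec OmegaD U \<longleftrightarrow>
     (\<forall>p v. \<not> (p \<in> U - \<Union>D \<and> tangent X p v) \<longrightarrow> \<omega> p v = 0) \<and>
     (\<forall>p\<in>U. \<exists>V h \<eta> \<sigma> \<tau>. p \<in> V \<and> V \<subseteq> U \<and> local_equation X (\<Union>D) V h \<and>
        regular_1form X V \<eta> \<and> (\<forall>q \<in> V - \<Union>D. \<forall>v. tangent X q v \<longrightarrow> \<eta> q v = h q * \<omega> q v) \<and>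
        exterior_derivative X (V - \<Union>D) \<omega> \<sigma> \<and>
        regular_2form X V \<tau> \<and>
        (\<forall>q \<in> V - \<Union>D. \<forall>v w. tangent X q v \<and> tangent X q w \<longrightarrow> \<tau> q v w = h q * \<sigma> q v w))"
  by (simp add: log_1forms_def)

lemma Psi_in_log:
  assumes U: "openin (zar X) U" and A: "A \<in> sec SA U" and B: "B \<in> sec SB U"
  shows "Psi U (A, B) \<in> sec OmegaD U"
  unfolding log_sec_iff
proof (intro conjI allI impI ballI)
  show "Psi U (A, B) p v = 0" if "\<not> (p \<in> U - \<Union>D \<and> tangent X p v)" for p v
    using that unfolding Psi_def by (rule if_not_P)
  note hA = sec_bihomogeneous[OF U A] and hB = sec_bihomogeneous[OF U B]
  fix p assume p: "p \<in> U"
  then have "p \<in> pts" using openin_subset[OF U] by auto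
  then obtain j l where jl: "j \<le> 1" "l \<le> 1" and c: "p \<in> chart j l" by (rule points_covered)
  obtain u where u: "p = phi j l u" by (rule chart_is_phi[OF jl c])
  define W where "W = {u. phi j l u \<in> U}"
  have W: "aopen W" unfolding W_def by (rule aopen_pullback[OF jl U])
  define F where "F = (\<lambda>u :: 'k \<times> 'k. poly (Fp j) (fst u))"
  define W0 where "W0 = {w \<in> W. F w \<noteq> 0}"
  have F: "areg W F" unfolding F_def by (rule areg_poly[OF W])
  have W0: "aopen W0" unfolding W0_def by (rule aopen_nonzero[OF F])
  have W0W: "W0 \<subseteq> W" by (auto simp: W0_def)
  have cA: "areg W (cf j l A)" and cB: "areg W (cf j l B)"
    unfolding W_def by (rule sec_areg_cf[OF U A jl], rule sec_areg_cf[OF U B jl])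
  \<comment> \<open>\<open>theta\<close> equals \<open>lf L1 (1 - j)\<close> times \<open>Gp\<close>
    over \<open>Fp\<close>, so a / F is the entire coefficient of dt and a itself is
    regular.\<close>
  define a where "a = (\<lambda>u. sg j * cf j l A u + sg l * cf j l B u * (ex l * snd u * (lf L1 (1 - j) * poly (Gp j) (fst u))))"
  define b where "b = (\<lambda>u. sg l * cf j l B u)"
  have a: "areg W a" unfolding a_def
    by (intro areg_add areg_mult areg_const areg_snd areg_poly W cA cB)
  have b: "areg W b" unfolding b_def by (intro areg_mult areg_const W cB)
  have aF: "areg W0 (\<lambda>u. a u / F u)"
    by (rule areg_divide[OF areg_subset[OF a W0 W0W] areg_subset[OF F W0 W0W]]) (simp add: W0_def)
  have diff: "phi j l ` W - \<Union>D = phi j l ` W0"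
  proof -
    have inD: "phi j l w \<in> \<Union>D \<longleftrightarrow> F w = 0" for w unfolding F_def by (rule phi_in_union[OF jl])
    show ?thesis unfolding W0_def using inD by blast
  qed
  have val: "Psi U (A, B) (phi j l w) v = a w / F w * tc j l 0 v + b w * tc j l 1 v"
    if w: "w \<in> W0" and v: "tangent X (phi j l w) v" for w v
  proof -
    have nz: "poly (Fp j) (fst w) \<noteq> 0" using w by (simp add: W0_def F_def)
    then have "phi j l w \<notin> \<Union>D" unfolding phi_in_union[OF jl] .
    moreover have "phi j l w \<in> U" using w by (simp add: W0_def W_def)
    ultimately have "Psi U (A, B) (phi j l w) v = psi j l A B w v" using Psi_chart[OF hA hB jl] v by blast
    also have "\<dots> = a w / F w * tc j l 0 v + b w * tc j l 1 v"
      using nz by (simp add: psi_def a_def b_def F_def Fp_eq theta_def field_simps)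
    finally show ?thesis .
  qed
  define \<eta> where "\<eta> = (\<lambda>p v. a (xi j l p) * tc j l 0 v + F (xi j l p) * b (xi j l p) * tc j l 1 v)"
  define \<sigma> where "\<sigma> = (\<lambda>p v v'. (dd 0 b (xi j l p) - dd 1 (\<lambda>u. a u / F u) (xi j l p)) * wedge j l v v')"
  define \<tau> where "\<tau> = (\<lambda>p v v'. (F (xi j l p) * dd 0 b (xi j l p) - dd 1 a (xi j l p)) * wedge j l v v')"
  \<comment> \<open>F depends on t only, so differentiating a / F in w does not raise the order of
    the pole.\<close>
  have dF: "dd 1 (\<lambda>u. a u / F u) w = dd 1 a w / F w" if w: "w \<in> W0" for w
  proof -
    have "dd 1 F w = 0" unfolding F_def dd_poly by simp
    then show ?thesis
      using dd_divide[OF areg_subset[OF a W0 W0W] areg_subset[OF F W0 W0W] _ w, of 1] w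
      by (simp add: W0_def power2_eq_square)
  qed
  show "\<exists>V h \<eta> \<sigma> \<tau>. p \<in> V \<and> V \<subseteq> U \<and> local_equation X (\<Union>D) V h \<and>
        regular_1form X V \<eta> \<and> (\<forall>q \<in> V - \<Union>D. \<forall>v. tangent X q v \<longrightarrow> \<eta> q v = h q * Psi U (A, B) q v) \<and>
        exterior_derivative X (V - \<Union>D) (Psi U (A, B)) \<sigma> \<and>
        regular_2form X V \<tau> \<and>
        (\<forall>q \<in> V - \<Union>D. \<forall>v w. tangent X q v \<and> tangent X q w \<longrightarrow> \<tau> q v w = h q * \<sigma> q v w)"
  proof (rule exI[of _ "phi j l ` W"], rule exI[of _ "\<lambda>P. poly (Fp j) (fst (xi j l P))"], rule exI[of _ \<eta>],
      rule exI[of _ \<sigma>], rule exI[of _ \<tau>], unfold diff, intro conjI)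
    show "p \<in> phi j l ` W" using u p by (simp add: W_def)
    show "phi j l ` W \<subseteq> U" by (auto simp: W_def)
    show "local_equation X (\<Union>D) (phi j l ` W) (\<lambda>P. poly (Fp j) (fst (xi j l P)))"
      by (rule local_equation_chart[OF jl W])
    show "regular_1form X (phi j l ` W) \<eta>"
      by (rule regular_1form_pushforward[OF jl a areg_mult[OF F b]]) (simp add: \<eta>_def jl)
    show "\<forall>q\<in>phi j l ` W0. \<forall>v. tangent X q v \<longrightarrow> \<eta> q v = poly (Fp j) (fst (xi j l q)) * Psi U (A, B) q v"
    proof (rule phi_image_ballI, intro allI impI)
      fix w v assume w: "w \<in> W0" and v: "tangent X (phi j l w) v"
      have "F w \<noteq> 0" using w by (simp add: W0_def)
      then show "\<eta> (phi j l w) v = poly (Fp j) (fst (xi j l (phi j l w))) * Psi U (A, B) (phi j l w) v"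
        unfolding val[OF w v] \<eta>_def using jl by (simp add: F_def[symmetric] distrib_left)
          (simp add: F_def)
    qed
    show "exterior_derivative X (phi j l ` W0) (Psi U (A, B)) \<sigma>"
      by (rule exterior_derivative_pushforward[OF jl aF areg_subset[OF b W0 W0W] val]) (simp_all add: \<sigma>_def jl)
    show "regular_2form X (phi j l ` W) \<tau>"
      by (rule regular_2form_pushforward[OF jl areg_diff[OF areg_mult[OF F dd_areg[OF b, of 0]] dd_areg[OF a, of 1]]])
        (simp add: \<tau>_def jl)
    show "\<forall>q\<in>phi j l ` W0. \<forall>v w. tangent X q v \<and> tangent X q w \<longrightarrow> \<tau> q v w = poly (Fp j) (fst (xi j l q)) * \<sigma> q v w"
    proof (rule phi_image_ballI, intro allI impI)
      fix u v w assume u: "u \<in> W0"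
      have "F u \<noteq> 0" using u by (simp add: W0_def)
      then have "F u * dd 0 b u - dd 1 a u = F u * (dd 0 b u - dd 1 (\<lambda>u. a u / F u) u)"
        unfolding dF[OF u] by (simp add: right_diff_distrib)
      then show "\<tau> (phi j l u) v w = poly (Fp j) (fst (xi j l (phi j l u))) * \<sigma> (phi j l u) v w"
        unfolding \<tau>_def \<sigma>_def using jl by (simp add: F_def mult.assoc[symmetric])
    qed
  qed
qed

text \<open>Off D, evaluation on d/dw isolates B, and then d/dt gives A. The coefficients are
  regular across D as well, where equality follows by density.\<close>

lemma Psi_injective:
  assumes U: "openin (zar X) U" and A: "A \<in> sec SA U" and B: "B \<in> sec SB U"
    and A': "A' \<in> sec SA U" and B': "B' \<in> sec SB U"
    and eq: "\<And>q v. q \<in> U \<Longrightarrow> q \<notin> \<Union>D \<Longrightarrow> tangent X q v \<Longrightarrow> Psi U (A, B) q v = Psi U (A', B') q v"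
  shows "A = A'" "B = B'"
proof -
  note h = sec_bihomogeneous[OF U A] sec_bihomogeneous[OF U B] sec_bihomogeneous[OF U A'] sec_bihomogeneous[OF U B']
  have "cf j l A u = cf j l A' u \<and> cf j l B u = cf j l B' u" if jl: "j \<le> 1" "l \<le> 1" and u: "phi j l u \<in> U" for j l u
  proof -
    let ?W = "{u. phi j l u \<in> U}"
    have off: "cf j l A w = cf j l A' w \<and> cf j l B w = cf j l B' w"
      if w: "w \<in> ?W" and nz: "poly (Fp j) (fst w) \<noteq> 0" for w
    proof -
      have nD: "phi j l w \<notin> \<Union>D" using nz unfolding phi_in_union[OF jl] .
      have wU: "phi j l w \<in> U" using w by simp
      have e: "psi j l A B w v = psi j l A' B' w v" if "tangent X (phi j l w) v" for v
        using eq[OF wU nD that] Psi_chart[OF h(1,2) jl wU nD that] Psi_chart[OF h(3,4) jl wU nD that] by simp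
      obtain v :: "((nat \<Rightarrow> 'k) set, 'k) tvec" where v: "tangent X (phi j l w) v" "tc j l 0 v = 0" "tc j l 1 v = 1"
        by (rule tangent_exists[OF jl])
      have eB: "cf j l B w = cf j l B' w" using e[OF v(1)] v by (simp add: psi_def)
      obtain v :: "((nat \<Rightarrow> 'k) set, 'k) tvec" where v: "tangent X (phi j l w) v" "tc j l 0 v = 1" "tc j l 1 v = 0"
        by (rule tangent_exists[OF jl])
      have "cf j l A w = cf j l A' w" using e[OF v(1)] v eB nz by (simp add: psi_def)
      then show ?thesis using eB by blast
    qed
    have dense: "cf j l s u = cf j l s' u"
      if "s \<in> sec (Osh m n) U" "s' \<in> sec (Osh m n) U"
        "\<And>w. w \<in> ?W \<Longrightarrow> poly (Fp j) (fst w) \<noteq> 0 \<Longrightarrow> cf j l s w = cf j l s' w" for s s' m n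
    proof -
      have "(\<lambda>w. cf j l s w - cf j l s' w) u = 0"
      proof (rule areg_dense[OF areg_diff[OF sec_areg_cf[OF U that(1) jl] sec_areg_cf[OF U that(2) jl]]])
        show "[:Fp j:] \<noteq> 0" using Fp_nonzero[OF jl(1)] by simp
        show "cf j l s w - cf j l s' w = 0" if "w \<in> ?W" "ev [:Fp j:] w \<noteq> 0" for w
          using \<open>\<And>w. w \<in> ?W \<Longrightarrow> poly (Fp j) (fst w) \<noteq> 0 \<Longrightarrow> cf j l s w = cf j l s' w\<close>[OF that(1)] that(2) by simp
        show "u \<in> ?W" using u by simp
      qed
      then show ?thesis by simp
    qed
    show ?thesis using dense[OF A A'] dense[OF B B'] off by blast
  qed
  then show "A = A'" "B = B'" using sec_eqI[OF U h(1,3)] sec_eqI[OF U h(2,4)] by blast+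
qed

lemma Psi_locally_surjective:
  assumes \<omega>: "\<omega> \<in> sec OmegaD U" and U: "openin (zar X) U" and p: "p \<in> U"
  obtains V A B where "openin (zar X) V" "p \<in> V" "V \<subseteq> U" "A \<in> sec SA V" "B \<in> sec SB V"
    "\<And>q v. q \<in> V \<Longrightarrow> q \<notin> \<Union>D \<Longrightarrow> tangent X q v \<Longrightarrow> \<omega> q v = Psi V (A, B) q v"
proof -
  obtain V h \<eta> \<sigma> \<tau> where V: "p \<in> V" "V \<subseteq> U" "local_equation X (\<Union>D) V h" "regular_1form X V \<eta>"
    and \<eta>: "\<forall>q \<in> V - \<Union>D. \<forall>v. tangent X q v \<longrightarrow> \<eta> q v = h q * \<omega> q v"
    and \<sigma>: "exterior_derivative X (V - \<Union>D) \<omega> \<sigma>" and \<tau>: "regular_2form X V \<tau>"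
    and \<tau>\<sigma>: "\<forall>q \<in> V - \<Union>D. \<forall>v w. tangent X q v \<and> tangent X q w \<longrightarrow> \<tau> q v w = h q * \<sigma> q v w"
    using bspec[OF conjunct2[OF \<omega>[unfolded log_sec_iff]] p] by (elim exE conjE) (rule that)
  have Vo: "openin (zar X) V" using V(3) by (simp add: local_equation_def)
  have "p \<in> pts" using openin_subset[OF U] p by auto
  then obtain j l where jl: "j \<le> 1" "l \<le> 1" and c: "p \<in> chart j l" by (rule points_covered)
  obtain u where u: "p = phi j l u" by (rule chart_is_phi[OF jl c])
  define F where "F = (\<lambda>u :: 'k \<times> 'k. poly (Fp j) (fst u))"
  have Fe: "F w = poly (Fp j) (fst w)" for w by (simp add: F_def)
  have inD: "phi j l w \<in> \<Union>D \<longleftrightarrow> F w = 0" for w unfolding Fe by (rule phi_in_union[OF jl])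
  define W4 where "W4 = {w. phi j l w \<in> V}"
  have W4: "aopen W4" unfolding W4_def by (rule aopen_pullback[OF jl Vo])
  have imW4: "phi j l ` W4 \<subseteq> V" by (auto simp: W4_def)
  \<comment> \<open>A logarithmic form comes with some local equation h. As F vanishes on D it is a
    multiple g h near p, and multiplying the regular forms belonging to h by g gives those for
    F.\<close>
  have "\<exists>W' g. openin (zar X) W' \<and> p \<in> W' \<and> W' \<subseteq> phi j l ` W4 \<and> reg X W' g \<and>
      (\<forall>x\<in>W'. poly (Fp j) (fst (xi j l x)) = g x * h x)"
  proof -
    have "openin (zar X) (phi j l ` W4) \<and> p \<in> phi j l ` W4 \<and> phi j l ` W4 \<subseteq> V \<and>
       reg X (phi j l ` W4) (\<lambda>P. poly (Fp j) (fst (xi j l P))) \<and>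
       (\<forall>x \<in> phi j l ` W4 \<inter> \<Union>D. poly (Fp j) (fst (xi j l x)) = 0)"
      using openin_phi_image[OF jl W4] imW4 u V(1) local_equation_chart[OF jl W4]
      by (simp add: local_equation_def W4_def)
    then show ?thesis using V(3) V(1) unfolding local_equation_def by blast
  qed
  then obtain W' g where W': "openin (zar X) W'" "p \<in> W'" "W' \<subseteq> phi j l ` W4" "reg X W' g"
    and Fgh: "\<forall>x\<in>W'. poly (Fp j) (fst (xi j l x)) = g x * h x" by (elim exE conjE) (rule that)
  have uV: "phi j l u \<in> V" using u V(1) by simp
  obtain W1 a1 b1 where W1: "u \<in> W1" "areg W1 a1" "areg W1 b1" "\<forall>w\<in>W1. phi j l w \<in> V"
    and \<eta>1: "\<forall>w\<in>W1. \<forall>v. tangent X (phi j l w) v \<longrightarrow> \<eta> (phi j l w) v = a1 w * tc j l 0 v + b1 w * tc j l 1 v"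
    by (rule regular_1form_chart[OF jl V(4) uV])
  obtain W2 c2 where W2: "u \<in> W2" "areg W2 c2" "\<forall>w\<in>W2. phi j l w \<in> V"
    and \<tau>2: "\<forall>w\<in>W2. \<forall>v v'. tangent X (phi j l w) v \<and> tangent X (phi j l w) v' \<longrightarrow> \<tau> (phi j l w) v v' = c2 w * wedge j l v v'"
    by (rule regular_2form_chart[OF jl \<tau> uV])
  define W where "W = W1 \<inter> W2 \<inter> {w. phi j l w \<in> W'}"
  have W: "aopen W" unfolding W_def
    by (intro aopen_Int aopen_pullback[OF jl W'(1)] areg_imp_aopen[OF W1(2)] areg_imp_aopen[OF W2(2)])
  have uW: "u \<in> W" using W1(1) W2(1) W'(2) u by (simp add: W_def)
  define a b c where "a = (\<lambda>w. g (phi j l w) * a1 w)" and "b = (\<lambda>w. g (phi j l w) * b1 w)"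
    and "c = (\<lambda>w. g (phi j l w) * c2 w)"
  have gW: "areg W (\<lambda>w. g (phi j l w))"
    by (rule areg_pullback_subset[OF jl W'(4) W]) (simp add: W_def)
  have a: "areg W a" and b: "areg W b" and c: "areg W c"
    unfolding a_def b_def c_def
    by (intro areg_mult gW areg_subset[OF W1(2) W] areg_subset[OF W1(3) W] areg_subset[OF W2(2) W]; auto simp: W_def)+
  have F: "areg W F" unfolding F_def by (rule areg_poly[OF W])
  have Fg: "F w = g (phi j l w) * h (phi j l w)" if "w \<in> W" for w
  proof -
    have "phi j l w \<in> W'" using that by (simp add: W_def)
    from bspec[OF Fgh this] show ?thesis using jl by (simp add: F_def)
  qed
  have WV: "phi j l w \<in> V" if "w \<in> W" for w using W1(4) that by (simp add: W_def)
  have F\<omega>: "F w * \<omega> (phi j l w) v = a w * tc j l 0 v + b w * tc j l 1 v"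
    if w: "w \<in> W" and nz: "F w \<noteq> 0" and v: "tangent X (phi j l w) v" for w v
  proof -
    have "phi j l w \<in> V - \<Union>D" using WV[OF w] nz inD by blast
    then have "\<eta> (phi j l w) v = h (phi j l w) * \<omega> (phi j l w) v" using \<eta> v by blast
    moreover have "w \<in> W1" using w by (simp add: W_def)
    then have "\<eta> (phi j l w) v = a1 w * tc j l 0 v + b1 w * tc j l 1 v" using \<eta>1 v by blast
    ultimately have "h (phi j l w) * \<omega> (phi j l w) v = a1 w * tc j l 0 v + b1 w * tc j l 1 v" by simp
    then show ?thesis unfolding Fg[OF w] a_def b_def by (simp add: mult.assoc distrib_left)
  qed
  define W0 where "W0 = {w \<in> W. F w \<noteq> 0}"
  have W0: "aopen W0" unfolding W0_def by (rule aopen_nonzero[OF F])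
  have W0W: "W0 \<subseteq> W" by (auto simp: W0_def)
  note a0' = areg_subset[OF a W0 W0W] and b0' = areg_subset[OF b W0 W0W] and F0 = areg_subset[OF F W0 W0W]
  have nz0: "F w \<noteq> 0" if "w \<in> W0" for w using that by (simp add: W0_def)
  have aF: "areg W0 (\<lambda>u. a u / F u)" and bF: "areg W0 (\<lambda>u. b u / F u)"
    by (rule areg_divide[OF a0' F0 nz0], assumption, rule areg_divide[OF b0' F0 nz0], assumption)
  define F' where "F' = (\<lambda>u :: 'k \<times> 'k. poly (pderiv (Fp j)) (fst u))"
  have dF: "dd 0 F w = F' w" "dd 1 F w = 0" for w unfolding F_def F'_def dd_poly by simp_all
  \<comment> \<open>With \<omega> = (a dt + b dw) / F, the vanishing of k is the equation F
    d\<omega> = c dt dw cleared of denominators.\<close>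
  define k where "k = (\<lambda>w. dd 0 b w * F w - b w * F' w - dd 1 a w * F w - c w * F w)"
  have kreg: "areg W k" unfolding k_def F'_def by (intro areg_diff areg_mult dd_areg a b c F areg_poly[OF W])
  have k0: "k w = 0" if w: "w \<in> W0" for w
  proof -
    obtain v :: "((nat \<Rightarrow> 'k) set, 'k) tvec" where v: "tangent X (phi j l w) v" "tc j l 0 v = 1" "tc j l 1 v = 0"
      by (rule tangent_exists[OF jl])
    obtain v' :: "((nat \<Rightarrow> 'k) set, 'k) tvec" where v': "tangent X (phi j l w) v'" "tc j l 0 v' = 0" "tc j l 1 v' = 1"
      by (rule tangent_exists[OF jl])
    have wW: "w \<in> W" and nz: "F w \<noteq> 0" using w by (auto simp: W0_def)
    have "\<sigma> (phi j l w) v v' = (dd 0 (\<lambda>u. b u / F u) w - dd 1 (\<lambda>u. a u / F u) w) * wedge j l v v'"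
    proof (rule exterior_derivative_chart[OF jl \<sigma> aF bF _ _ w v(1) v'(1)])
      show "\<forall>w\<in>W0. phi j l w \<in> V - \<Union>D" using WV inD by (auto simp: W0_def)
      show "\<forall>w\<in>W0. \<forall>v. tangent X (phi j l w) v \<longrightarrow> \<omega> (phi j l w) v = a w / F w * tc j l 0 v + b w / F w * tc j l 1 v"
      proof (intro ballI allI impI)
        fix w v assume "w \<in> W0" and v: "tangent X (phi j l w) v"
        then have "w \<in> W" "F w \<noteq> 0" by (auto simp: W0_def)
        then show "\<omega> (phi j l w) v = a w / F w * tc j l 0 v + b w / F w * tc j l 1 v"
          using F\<omega>[OF _ _ v] by (simp add: field_simps)
      qed
    qed
    moreover have "F w * \<sigma> (phi j l w) v v' = c w * wedge j l v v'"
    proof -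
      have "phi j l w \<in> V - \<Union>D" using WV[OF wW] nz inD by blast
      then have "\<tau> (phi j l w) v v' = h (phi j l w) * \<sigma> (phi j l w) v v'" using \<tau>\<sigma> v(1) v'(1) by blast
      moreover have "w \<in> W2" using wW by (simp add: W_def)
      then have "\<tau> (phi j l w) v v' = c2 w * wedge j l v v'" using \<tau>2 v(1) v'(1) by blast
      ultimately have "h (phi j l w) * \<sigma> (phi j l w) v v' = c2 w * wedge j l v v'" by simp
      then show ?thesis unfolding Fg[OF wW] c_def by (simp add: mult.assoc)
    qed
    ultimately have "F w * (dd 0 (\<lambda>u. b u / F u) w - dd 1 (\<lambda>u. a u / F u) w) = c w"
      using v v' by simp
    then have "F w * ((dd 0 b w * F w - b w * F' w) / (F w)\<^sup>2 - dd 1 a w * F w / (F w)\<^sup>2) = c w"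
      using dd_divide[OF a0' F0 nz0 w, of 1] dd_divide[OF b0' F0 nz0 w, of 0] by (simp add: dF)
    moreover have "F w * ((dd 0 b w * F w - b w * F' w) / (F w)\<^sup>2 - dd 1 a w * F w / (F w)\<^sup>2) =
        (dd 0 b w * F w - b w * F' w - dd 1 a w * F w) / F w"
      using nz by (simp add: diff_divide_distrib right_diff_distrib power2_eq_square)
    ultimately have "(dd 0 b w * F w - b w * F' w - dd 1 a w * F w) / F w = c w" by simp
    then have "dd 0 b w * F w - b w * F' w - dd 1 a w * F w = c w * F w" using nz by (simp add: divide_eq_eq)
    then show "k w = 0" by (simp add: k_def)
  qed
  \<comment> \<open>k is regular on all of W, so the identity extends from the complement of D to D
    itself.\<close>
  have kW: "k w = 0" if w: "w \<in> W" for w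
  proof (rule areg_dense[OF kreg _ _ w])
    show "[:Fp j:] \<noteq> 0" using Fp_nonzero[OF jl(1)] by simp
    show "k x = 0" if "x \<in> W" "ev [:Fp j:] x \<noteq> 0" for x
      by (rule k0) (use that in \<open>simp add: W0_def F_def\<close>)
  qed
  obtain W3 b' where W3: "u \<in> W3" "W3 \<subseteq> W" "areg W3 b'" "\<And>x. x \<in> W3 \<Longrightarrow> b x = b' x * poly (Fp j) (fst x)"
  proof (rule areg_divisible[OF b Fp_nonzero[OF jl(1)] Fp_simple_roots[OF jl(1)] _ uW])
    \<comment> \<open>On the zeros of F only the term b F' of k survives, and F' is nonzero
      there.\<close>
    show "b x = 0" if "x \<in> W" "poly (Fp j) (fst x) = 0" for x
      using kW[OF that(1)] Fp_simple_roots[OF jl(1) that(2)] that(2) by (simp add: k_def F_def F'_def)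
  qed blast+
  have W3o: "aopen W3" by (rule areg_imp_aopen[OF W3(3)])
  \<comment> \<open>Solves the formula of \<open>psi\<close> for its coefficients, given \<omega> =
    (a / F) dt + b' dw: B is read off from dw, and A is what remains in dt. \<open>sg\<close> is its
    own inverse.\<close>
  obtain A where A: "A \<in> sec SA (phi j l ` W3)"
    "\<And>w. w \<in> W3 \<Longrightarrow> cf j l A w = sg j * (a w - b' w * (ex l * snd w * (lf L1 (1 - j) * poly (Gp j) (fst w))))"
  proof (rule exists_sec_of_chart[OF jl])
    show "areg W3 (\<lambda>w. sg j * (a w - b' w * (ex l * snd w * (lf L1 (1 - j) * poly (Gp j) (fst w)))))"
      by (intro areg_diff areg_mult areg_const areg_snd areg_poly W3o W3(3) areg_subset[OF a W3o W3(2)])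
  qed blast
  obtain B where B: "B \<in> sec SB (phi j l ` W3)" "\<And>w. w \<in> W3 \<Longrightarrow> cf j l B w = sg l * b' w"
  proof (rule exists_sec_of_chart[OF jl])
    show "areg W3 (\<lambda>w. sg l * b' w)" by (intro areg_mult areg_const W3o W3(3))
  qed blast
  have V3: "openin (zar X) (phi j l ` W3)" by (rule openin_phi_image[OF jl W3o])
  show ?thesis
  proof (rule that[OF V3 _ _ A(1) B(1)])
    show "p \<in> phi j l ` W3" using u W3(1) by blast
    show "phi j l ` W3 \<subseteq> U" using WV W3(2) V(2) by blast
    fix q v assume "q \<in> phi j l ` W3" and qD: "q \<notin> \<Union>D" and v: "tangent X q v"
    then obtain w where w: "w \<in> W3" "q = phi j l w" by blast
    have nz: "F w \<noteq> 0" using qD inD w by blast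
    have wW: "w \<in> W" using w W3(2) by blast
    have v': "tangent X (phi j l w) v" and wD: "phi j l w \<notin> \<Union>D" using v w qD by auto
    have "Psi (phi j l ` W3) (A, B) (phi j l w) v = psi j l A B w v"
      by (rule Psi_chart[OF sec_bihomogeneous[OF V3 A(1)] sec_bihomogeneous[OF V3 B(1)] jl _ wD v']) (use w in blast)
    also have "F w * \<dots> = a w * tc j l 0 v + b w * tc j l 1 v"
      using nz unfolding psi_def A(2)[OF w(1)] B(2)[OF w(1)] W3(4)[OF w(1)] Fe Fp_eq theta_def
      by (simp add: field_simps)
    also have "\<dots> = F w * \<omega> (phi j l w) v" using F\<omega>[OF wW nz v'] by simp
    finally show "\<omega> q v = Psi (phi j l ` W3) (A, B) q v" using nz w by simp
  qed
qed

section \<open>The isomorphism\<close>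

lemma chart_at_xi:
  "P \<in> pts \<Longrightarrow> phi (fst (chart_at P)) (snd (chart_at P)) (xi (fst (chart_at P)) (snd (chart_at P)) P) = P"
  by (rule phi_xi) (rule chart_at; assumption)+

lemma Psi_add:
  "Psi U (add (direct_sum SA SB) s t) = add OmegaD (Psi U s) (Psi U t)"
proof (intro ext)
  fix p v
  have "psi j l (add SA (fst s) (fst t)) (add SB (snd s) (snd t)) u v =
      psi j l (fst s) (snd s) u v + psi j l (fst t) (snd t) u v" for j l u
    by (simp add: psi_def cf_add add_divide_distrib algebra_simps)
  then show "Psi U (add (direct_sum SA SB) s t) p v = add OmegaD (Psi U s) (Psi U t) p v"
    by (simp add: Psi_def direct_sum_def log_1forms_def)
qed

lemma Psi_act:
  assumes "U \<subseteq> pts"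
  shows "Psi U (act (direct_sum SA SB) g s) = act OmegaD g (Psi U s)"
proof (intro ext)
  fix p v
  have "psi j l (act SA g (fst s)) (act SB g (snd s)) u v = g (phi j l u) * psi j l (fst s) (snd s) u v" for j l u
    by (simp add: psi_def cf_act algebra_simps)
  then show "Psi U (act (direct_sum SA SB) g s) p v = act OmegaD g (Psi U s) p v"
    using chart_at_xi[of p] assms by (auto simp: Psi_def direct_sum_def log_1forms_def)
qed

lemma Psi_res_eq:
  assumes "W \<subseteq> U" "U \<subseteq> pts" "p \<in> W"
  shows "Psi W (res SA W A, res SB W B) p v = Psi U (A, B) p v"
proof -
  have "p \<in> pts" using assms by blast
  note x = chart_at_xi[OF this]
  show ?thesis using assms(1,3) by (auto simp: Psi_def psi_def cf_res x)
qed

lemma Psi_res: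
  assumes "W \<subseteq> U" "U \<subseteq> pts"
  shows "Psi W (res (direct_sum SA SB) W s) = res OmegaD W (Psi U s)"
proof (intro ext)
  fix p v
  show "Psi W (res (direct_sum SA SB) W s) p v = res OmegaD W (Psi U s) p v"
  proof (cases "p \<in> W")
    case True
    then show ?thesis using Psi_res_eq[OF assms True, of "fst s" "snd s" v]
      by (simp add: direct_sum_def log_1forms_def)
  next
    case False
    then show ?thesis by (simp add: Psi_def log_1forms_def)
  qed
qed

text \<open>By \<open>Psi_injective\<close>, applied on intersections, the local preimages chosen at
  different points agree wherever both are defined, so they glue.\<close>

lemma Psi_surjective:
  assumes \<omega>: "\<omega> \<in> sec OmegaD U" and U: "openin (zar X) U"
  obtains A B where "A \<in> sec SA U" "B \<in> sec SB U" "Psi U (A, B) = \<omega>"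
proof -
  have US: "U \<subseteq> pts" using openin_subset[OF U] by simp
  define good where "good = (\<lambda>V A B. openin (zar X) V \<and> V \<subseteq> U \<and> A \<in> sec SA V \<and> B \<in> sec SB V \<and>
    (\<forall>q v. q \<in> V \<longrightarrow> q \<notin> \<Union>D \<longrightarrow> tangent X q v \<longrightarrow> \<omega> q v = Psi V (A, B) q v))"
  have "\<forall>p\<in>U. \<exists>VAB. p \<in> fst VAB \<and> good (fst VAB) (fst (snd VAB)) (snd (snd VAB))"
  proof
    fix p assume "p \<in> U"
    then obtain V A B where *: "openin (zar X) V" "p \<in> V" "V \<subseteq> U" "A \<in> sec SA V" "B \<in> sec SB V"
      "\<And>q v. q \<in> V \<Longrightarrow> q \<notin> \<Union>D \<Longrightarrow> tangent X q v \<Longrightarrow> \<omega> q v = Psi V (A, B) q v"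
      by (rule Psi_locally_surjective[OF \<omega> U]) blast
    have "good V A B" unfolding good_def using * by blast
    then show "\<exists>VAB. p \<in> fst VAB \<and> good (fst VAB) (fst (snd VAB)) (snd (snd VAB))"
      using *(2) by (intro exI[of _ "(V, A, B)"]) simp
  qed
  then obtain f where f: "\<forall>p\<in>U. p \<in> fst (f p) \<and> good (fst (f p)) (fst (snd (f p))) (snd (snd (f p)))"
    by (rule bchoice[THEN exE])
  define Vf Af Bf where "Vf = (\<lambda>p. fst (f p))" and "Af = (\<lambda>p. fst (snd (f p)))" and "Bf = (\<lambda>p. snd (snd (f p)))"
  have g: "p \<in> Vf p" "good (Vf p) (Af p) (Bf p)" if "p \<in> U" for p
    using f that by (simp_all add: Vf_def Af_def Bf_def)
  have agree: "A x y = A' x y \<and> B x y = B' x y"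
    if 1: "good V A B" and 2: "good V' A' B'" and x: "pt x \<in> V" "pt x \<in> V'" for V V' A A' B B' x y
  proof -
    define W where "W = V \<inter> V'"
    have V: "openin (zar X) V" "openin (zar X) V'" "A \<in> sec SA V" "B \<in> sec SB V" "A' \<in> sec SA V'" "B' \<in> sec SB V'"
      using 1 2 unfolding good_def by blast+
    have VS: "V \<subseteq> pts" "V' \<subseteq> pts" using 1 2 US unfolding good_def by blast+
    have W: "openin (zar X) W" "W \<subseteq> V" "W \<subseteq> V'" unfolding W_def using V by auto
    have eq: "Psi W (res SA W A, res SB W B) q v = Psi W (res SA W A', res SB W B') q v"
      if q: "q \<in> W" "q \<notin> \<Union>D" "tangent X q v" for q v
    proof -
      have "q \<in> V" "q \<in> V'" using q W by auto
      then have "\<omega> q v = Psi V (A, B) q v" "\<omega> q v = Psi V' (A', B') q v"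
        using 1 2 q unfolding good_def by blast+
      then show ?thesis
        using Psi_res_eq[OF W(2) VS(1) q(1), of A B v] Psi_res_eq[OF W(3) VS(2) q(1), of A' B' v] by simp
    qed
    note i = Psi_injective[OF W(1) sec_res[OF V(1,3) W(1,2)] sec_res[OF V(1,4) W(1,2)]
        sec_res[OF V(2,5) W(1,3)] sec_res[OF V(2,6) W(1,3)] eq]
    have "res SA W A = res SA W A'" "res SB W B = res SB W B'" by (rule i; assumption)+
    then have "res SA W A x y = res SA W A' x y" "res SB W B x y = res SB W B' x y" by simp_all
    moreover have "pt x \<in> W" using x by (simp add: W_def)
    ultimately show ?thesis by (simp add: scroll_O_def)
  qed
  \<comment> \<open>At a vector x the glued section uses the local section that was chosen at the
    point of x itself.\<close>
  define A B where "A = (\<lambda>x y. if pt x \<in> U then Af (pt x) x y else 0)"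
    and "B = (\<lambda>x y. if pt x \<in> U then Bf (pt x) x y else 0)"
  have VU: "Vf p \<subseteq> U" "Af p \<in> sec SA (Vf p)" "Bf p \<in> sec SB (Vf p)" if "p \<in> U" for p
    using g(2)[OF that] unfolding good_def by blast+
  have glue: "C \<in> sec (Osh m n) U"
    if C: "C = (\<lambda>x y. if pt x \<in> U then Cf (pt x) x y else 0)"
      and Cf: "\<And>p. p \<in> U \<Longrightarrow> Cf p \<in> sec (Osh m n) (Vf p)"
      and ag: "\<And>p x y. p \<in> U \<Longrightarrow> pt x \<in> U \<Longrightarrow> pt x \<in> Vf p \<Longrightarrow> Cf (pt x) x y = Cf p x y" for C Cf m n
  proof (rule sec_glue[OF _ _ US])
    fix x y assume n: "\<not> (pt x \<in> U \<and> y \<in> proj (pt x))"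
    show "C x y = 0"
    proof (cases "pt x \<in> U")
      case True
      then show ?thesis using sec_support[OF Cf[OF True], of x y] n by (simp add: C)
    qed (simp add: C)
  next
    fix P assume P: "P \<in> U"
    show "\<exists>V s'. P \<in> V \<and> V \<subseteq> U \<and> s' \<in> sec (Osh m n) V \<and> (\<forall>x y. pt x \<in> V \<longrightarrow> C x y = s' x y)"
    proof (rule exI[of _ "Vf P"], rule exI[of _ "Cf P"], intro conjI allI impI)
      fix x y assume x: "pt x \<in> Vf P"
      then have "pt x \<in> U" using VU(1)[OF P] by blast
      then show "C x y = Cf P x y" using ag[OF P _ x] by (simp add: C)
    qed (use g VU P Cf in auto)
  qed
  have A: "A \<in> sec SA U" by (rule glue[OF A_def VU(2)]) (use agree g in blast)+
  have B: "B \<in> sec SB U" by (rule glue[OF B_def VU(3)]) (use agree g in blast)+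
  have "Psi U (A, B) p v = \<omega> p v" for p v
  proof (cases "p \<in> U - \<Union>D \<and> tangent X p v")
    case False
    have "\<omega> p v = 0" using \<omega> False unfolding log_sec_iff by blast
    moreover have "Psi U (A, B) p v = 0" unfolding Psi_def by (rule if_not_P) (rule False)
    ultimately show ?thesis by simp
  next
    case True
    then have pU: "p \<in> U" by blast
    then have pS: "p \<in> pts" using US by blast
    have x: "phi (fst (chart_at p)) (snd (chart_at p)) (xi (fst (chart_at p)) (snd (chart_at p)) p) = p"
      by (rule chart_at_xi[OF pS])
    have "cf j l A u = cf j l (Af p) u" "cf j l B u = cf j l (Bf p) u" if "phi j l u = p" for j l u
      using that pU by (simp_all add: cf_def A_def B_def phi_def)
    then have "Psi U (A, B) p v = Psi (Vf p) (Af p, Bf p) p v"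
      using x True g(1)[OF pU] by (simp add: Psi_def psi_def)
    also have "\<dots> = \<omega> p v" using g[OF pU] True unfolding good_def by simp
    finally show ?thesis .
  qed
  then have "Psi U (A, B) = \<omega>" by blast
  then show ?thesis by (rule that[OF A B])
qed

lemma sec_direct_sum: "s \<in> sec (direct_sum F G) U \<longleftrightarrow> fst s \<in> sec F U \<and> snd s \<in> sec G U"
  by (simp add: direct_sum_def mem_Times_iff)

lemma Psi_bij_betw:
  assumes U: "openin (zar X) U"
  shows "bij_betw (Psi U) (sec (direct_sum SA SB) U) (sec OmegaD U)"
  unfolding bij_betw_def
proof
  show "inj_on (Psi U) (sec (direct_sum SA SB) U)"
  proof (rule inj_onI)
    fix s t assume *: "s \<in> sec (direct_sum SA SB) U" "t \<in> sec (direct_sum SA SB) U" "Psi U s = Psi U t"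
    have "fst s = fst t" "snd s = snd t"
      by (rule Psi_injective[OF U, of "fst s" "snd s" "fst t" "snd t"]; use * in \<open>simp add: sec_direct_sum\<close>)+
    then show "s = t" by (rule prod_eqI)
  qed
  show "Psi U ` sec (direct_sum SA SB) U = sec OmegaD U"
  proof
    show "Psi U ` sec (direct_sum SA SB) U \<subseteq> sec OmegaD U"
    proof
      fix \<omega> assume "\<omega> \<in> Psi U ` sec (direct_sum SA SB) U"
      then obtain s where "s \<in> sec (direct_sum SA SB) U" "\<omega> = Psi U s" by blast
      then show "\<omega> \<in> sec OmegaD U" using Psi_in_log[OF U, of "fst s" "snd s"] by (simp add: sec_direct_sum)
    qed
    show "sec OmegaD U \<subseteq> Psi U ` sec (direct_sum SA SB) U"
    proof
      fix \<omega> assume "\<omega> \<in> sec OmegaD U"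
      then obtain A B where "A \<in> sec SA U" "B \<in> sec SB U" "Psi U (A, B) = \<omega>"
        by (rule Psi_surjective[OF _ U])
      then show "\<omega> \<in> Psi U ` sec (direct_sum SA SB) U"
        by (intro image_eqI[of _ _ "(A, B)"]) (simp_all add: sec_direct_sum)
    qed
  qed
qed

text \<open>Allows the inverse of \<open>Psi\<close> to be evaluated on sums, multiples and
  restrictions.\<close>

lemma sec_direct_sum_closed:
  assumes U: "openin (zar X) U" and s: "s \<in> sec (direct_sum SA SB) U"
  shows "t \<in> sec (direct_sum SA SB) U \<Longrightarrow> add (direct_sum SA SB) s t \<in> sec (direct_sum SA SB) U"
    and "reg X U g \<Longrightarrow> act (direct_sum SA SB) g s \<in> sec (direct_sum SA SB) U"
    and "openin (zar X) W \<Longrightarrow> W \<subseteq> U \<Longrightarrow> res (direct_sum SA SB) W s \<in> sec (direct_sum SA SB) W"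
  using s sec_add[OF U] sec_act[OF U] sec_res[OF U]
  by (simp_all add: direct_sum_def mem_Times_iff)

text \<open>The required map starts from the logarithmic forms, so the inverse of \<open>Psi\<close>
  is taken; its compatibilities are transferred from those of \<open>Psi\<close>.\<close>

lemma log_forms_isomorphic: "sheaf_isomorphic X OmegaD (direct_sum SA SB)"
proof -
  let ?S = "direct_sum SA SB"
  define \<Phi> where "\<Phi> = (\<lambda>U. inv_into (sec ?S U) (Psi U))"
  have inv: "\<Phi> U (Psi U s) = s" if "openin (zar X) U" "s \<in> sec ?S U" for U s
    unfolding \<Phi>_def using Psi_bij_betw[OF that(1)] that(2) by (auto simp: bij_betw_def)
  have ex: "\<exists>s \<in> sec ?S U. \<omega> = Psi U s" if "openin (zar X) U" "\<omega> \<in> sec OmegaD U" for U \<omega>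
    using Psi_bij_betw[OF that(1)] that(2) unfolding bij_betw_def by blast
  have sub: "U \<subseteq> pts" if "openin (zar X) U" for U :: "(nat \<Rightarrow> 'k) set set"
    using openin_subset[OF that] by simp
  show ?thesis
    unfolding sheaf_isomorphic_def
  proof (rule exI[of _ \<Phi>], intro allI impI conjI ballI)
    fix U :: "(nat \<Rightarrow> 'k) set set" assume U: "openin (zar X) U"
    note closed = sec_direct_sum_closed[OF U]
    show "bij_betw (\<Phi> U) (sec OmegaD U) (sec ?S U)"
      unfolding \<Phi>_def by (rule bij_betw_inv_into[OF Psi_bij_betw[OF U]])
    show "\<Phi> U (add OmegaD \<omega> \<omega>') = add ?S (\<Phi> U \<omega>) (\<Phi> U \<omega>')"
      if w: "\<omega> \<in> sec OmegaD U" "\<omega>' \<in> sec OmegaD U" for \<omega> \<omega>'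
    proof -
      obtain s where s: "s \<in> sec ?S U" "\<omega> = Psi U s" using ex[OF U w(1)] by blast
      obtain t where t: "t \<in> sec ?S U" "\<omega>' = Psi U t" using ex[OF U w(2)] by blast
      show ?thesis
        unfolding s(2) t(2) Psi_add[symmetric] inv[OF U s(1)] inv[OF U t(1)]
        by (rule inv[OF U closed(1)[OF s(1) t(1)]])
    qed
    show "\<Phi> U (act OmegaD g \<omega>) = act ?S g (\<Phi> U \<omega>)" if g: "reg X U g" and w: "\<omega> \<in> sec OmegaD U" for g \<omega>
    proof -
      obtain s where s: "s \<in> sec ?S U" "\<omega> = Psi U s" using ex[OF U w] by blast
      show ?thesis
        unfolding s(2) Psi_act[OF sub[OF U], symmetric] inv[OF U s(1)]
        by (rule inv[OF U closed(2)[OF s(1) g]])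
    qed
    show "\<Phi> W (res OmegaD W \<omega>) = res ?S W (\<Phi> U \<omega>)"
      if W: "openin (zar X) W \<and> W \<subseteq> U" and w: "\<omega> \<in> sec OmegaD U" for W \<omega>
    proof -
      obtain s where s: "s \<in> sec ?S U" "\<omega> = Psi U s" using ex[OF U w] by blast
      show ?thesis
        unfolding s(2) Psi_res[OF conjunct2[OF W] sub[OF U], symmetric] inv[OF U s(1)]
        by (rule inv[OF conjunct1[OF W] closed(3)[OF s(1) conjunct1[OF W] conjunct2[OF W]]])
    qed
  qed
qed

end

section \<open>The divisors in the fibre class\<close>

text \<open>Take a fraction for h with denominator q of least degree. A nonconstant q has a root t
  by algebraic closedness; comparison with a fraction valid at t shows that the numerator vanishes
  there too, and cancelling x - t contradicts minimality.\<close>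

lemma regular_on_line_imp_poly:
  fixes h :: "'k::{alg_closed_field, field_char_0} \<Rightarrow> 'k"
  assumes loc: "\<And>t. \<exists>p q. poly q t \<noteq> 0 \<and> (\<forall>x. poly q x \<noteq> 0 \<longrightarrow> h x = poly p x / poly q x)"
  obtains p where "\<And>x. h x = poly p x"
proof -
  define Q where "Q = (\<lambda>pq. snd pq \<noteq> 0 \<and> (\<forall>x. poly (snd pq) x \<noteq> 0 \<longrightarrow> h x = poly (fst pq) x / poly (snd pq) x))"
  obtain p0 q0 where pq0: "poly q0 0 \<noteq> 0" "\<forall>x. poly q0 x \<noteq> 0 \<longrightarrow> h x = poly p0 x / poly q0 x" using loc by blast
  then have "Q (p0, q0)" by (auto simp: Q_def)
  then obtain pq where pq: "Q pq" "\<forall>pq'. Q pq' \<longrightarrow> degree (snd pq) \<le> degree (snd pq')"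
    using ex_has_least_nat[of Q _ "\<lambda>pq. degree (snd pq)"] by blast
  define p q where "p = fst pq" and "q = snd pq"
  have q: "q \<noteq> 0" "\<forall>x. poly q x \<noteq> 0 \<longrightarrow> h x = poly p x / poly q x" using pq(1) by (auto simp: Q_def p_def q_def)
  have "degree q = 0"
  proof (rule ccontr)
    assume "degree q \<noteq> 0"
    then obtain t where t: "poly q t = 0" using alg_closed_imp_poly_has_root[of q] by auto
    obtain p1 q1 where pq1: "poly q1 t \<noteq> 0" "\<forall>x. poly q1 x \<noteq> 0 \<longrightarrow> h x = poly p1 x / poly q1 x" using loc by blast
    have "(p * q1 - p1 * q) * (q * q1) = 0"
    proof (rule poly_all_0_iff_0[THEN iffD1], rule allI)
      fix x
      show "poly ((p * q1 - p1 * q) * (q * q1)) x = 0"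
      proof (cases "poly q x = 0 \<or> poly q1 x = 0")
        case False
        then have "poly p x / poly q x = poly p1 x / poly q1 x" using q(2) pq1(2) by metis
        then show ?thesis using False by (simp add: field_simps)
      qed auto
    qed
    moreover have "q1 \<noteq> 0" using pq1(1) by auto
    ultimately have e: "p * q1 = p1 * q" using q(1) by simp
    have "poly p t * poly q1 t = 0" using arg_cong[OF e, of "\<lambda>r. poly r t"] t by simp
    then have "poly p t = 0" using pq1(1) by simp
    then obtain p' where p': "p = [:- t, 1:] * p'" by (auto simp: poly_eq_0_iff_dvd dvd_def)
    obtain q' where q': "q = [:- t, 1:] * q'" using t by (auto simp: poly_eq_0_iff_dvd dvd_def)
    have "[:- t, 1:] * (p' * q1) = [:- t, 1:] * (p1 * q')" using e unfolding p' q' by (simp only: mult_ac)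
    moreover have "[:- t, 1:] \<noteq> (0 :: 'k poly)" by simp
    ultimately have e': "p' * q1 = p1 * q'" by (metis mult_left_cancel)
    have q'0: "q' \<noteq> 0" using q(1) q' by auto
    have "Q (p', q')"
      unfolding Q_def fst_conv snd_conv
    proof (intro conjI allI impI)
      show "q' \<noteq> 0" by (rule q'0)
      fix x assume x: "poly q' x \<noteq> 0"
      show "h x = poly p' x / poly q' x"
      proof (cases "x = t")
        case True
        \<comment> \<open>The cancelled fraction may have t in its domain, where the old one says
          nothing; the value comes from the fraction valid at t.\<close>
        have "h t = poly p1 t / poly q1 t" using pq1 by blast
        also have "\<dots> = poly p' t / poly q' t"
          using arg_cong[OF e', of "\<lambda>r. poly r t"] x True pq1(1) by (simp add: field_simps)
        finally show ?thesis using True by simp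
      next
        case False
        then have "poly q x \<noteq> 0" using x by (simp add: q')
        then have "h x = poly p x / poly q x" using q(2) by blast
        also have "\<dots> = ((x - t) * poly p' x) / ((x - t) * poly q' x)" by (simp add: p' q' left_diff_distrib)
        also have "\<dots> = poly p' x / poly q' x"
          by (rule mult_divide_mult_cancel_left) (use False in simp)
        finally show ?thesis .
      qed
    qed
    then have "degree q \<le> degree q'" using pq(2) by (auto simp: q_def)
    moreover have "degree q = Suc (degree q')" unfolding q' by (subst degree_mult_eq) (use q'0 in auto)
    ultimately show False by simp
  qed
  then obtain c where c: "q = [:c:]" by (rule degree_eq_zeroE)
  then have "c \<noteq> 0" using q(1) by auto
  then have "h x = poly (smult (inverse c) p) x" for x using q(2) c by (simp add: field_simps)
  then show ?thesis by (rule that)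
qed

text \<open>If deg p = n + m with m > 0, then x^m q is the reflection of p. Its value at 0 is the
  leading coefficient of p, which would have to vanish.\<close>

lemma degree_le_of_inversion:
  fixes p q :: "'k::field_char_0 poly"
  assumes "\<And>x. x \<noteq> 0 \<Longrightarrow> poly q x = x ^ n * poly p (1 / x)"
  shows "degree p \<le> n"
proof (rule ccontr)
  assume "\<not> degree p \<le> n"
  then obtain m where m: "degree p = n + Suc m" by (metis add_Suc_right less_imp_Suc_add not_le)
  \<comment> \<open>The factor x makes the identity hold also at x = 0, about which the hypothesis
    is silent.\<close>
  have "monom 1 1 * (monom 1 (Suc m) * q - reflect_poly p) = 0"
  proof (rule poly_all_0_iff_0[THEN iffD1], rule allI)
    fix x :: 'k
    show "poly (monom 1 1 * (monom 1 (Suc m) * q - reflect_poly p)) x = 0"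
    proof (cases "x = 0")
      case False
      then show ?thesis using assms[OF False]
        by (simp add: poly_monom poly_reflect_poly_nz m power_add inverse_eq_divide algebra_simps)
    qed (simp add: poly_monom)
  qed
  moreover have "monom 1 1 \<noteq> (0 :: 'k poly)" by (simp add: monom_eq_0_iff)
  ultimately have "monom 1 (Suc m) * q = reflect_poly p" by simp
  then have "poly (reflect_poly p) 0 = 0" by (simp add: poly_monom flip: \<open>monom 1 (Suc m) * q = reflect_poly p\<close>)
  then have "p = 0" by simp
  then show False using m by simp
qed

lemma areg_UNIV_slice_snd:
  fixes f :: "'k::{alg_closed_field, field_char_0} \<times> 'k \<Rightarrow> 'k"
  assumes "areg UNIV f"
  obtains p where "\<And>w. f (t, w) = poly p w"
proof (rule regular_on_line_imp_poly[of "\<lambda>w. f (t, w)"])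
  have s: "poly (map_poly (\<lambda>p. poly p t) P) w = ev P (t, w)" for P :: "'k poly poly" and w
    by (induction P) (simp_all add: map_poly_pCons ev_pCons)
  fix w0
  obtain P Q where r: "rep f (t, w0) P Q" using areg_rep[OF assms, of "(t, w0)"] by auto
  show "\<exists>p q. poly q w0 \<noteq> 0 \<and> (\<forall>x. poly q x \<noteq> 0 \<longrightarrow> f (t, x) = poly p x / poly q x)"
    by (rule exI[of _ "map_poly (\<lambda>p. poly p t) P"], rule exI[of _ "map_poly (\<lambda>p. poly p t) Q"])
      (use r in \<open>simp add: s rep_def\<close>)
qed (rule that)

lemma areg_UNIV_slice_fst:
  fixes f :: "'k::{alg_closed_field, field_char_0} \<times> 'k \<Rightarrow> 'k"
  assumes "areg UNIV f"
  obtains p where "\<And>t. f (t, w) = poly p t"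
proof (rule regular_on_line_imp_poly[of "\<lambda>t. f (t, w)"])
  have s: "poly (poly P [:w:]) t = ev P (t, w)" for P :: "'k poly poly" and t
    by (simp add: ev_def)
  fix t0
  obtain P Q where r: "rep f (t0, w) P Q" using areg_rep[OF assms, of "(t0, w)"] by auto
  show "\<exists>p q. poly q t0 \<noteq> 0 \<and> (\<forall>x. poly q x \<noteq> 0 \<longrightarrow> f (x, w) = poly p x / poly q x)"
    by (rule exI[of _ "poly P [:w:]"], rule exI[of _ "poly Q [:w:]"])
      (use r in \<open>simp add: s rep_def\<close>)
qed (rule that)

section \<open>Global sections of O(f) and their divisors\<close>

context scroll_surface
begin

lemma phi_in_points: "j \<le> 1 \<Longrightarrow> l \<le> 1 \<Longrightarrow> phi j l u \<in> pts"
  using phi_in_chart chart_subset by blast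

lemma openin_points: "openin (zar X) pts"
  using openin_topspace[of "zar X"] by simp

text \<open>A section of \<open>O(f)\<close> is constant along the fibres, and along the curve \<open>z\<^sub>1 = 0\<close> it is a section of
  \<open>O(1)\<close> on the projective line.\<close>

lemma global_section_fibre_class:
  fixes s :: "(nat \<Rightarrow> 'k::{alg_closed_field, field_char_0}) \<Rightarrow> (nat \<Rightarrow> 'k) \<Rightarrow> 'k"
  assumes s: "s \<in> sec (Osh 0 1) pts"
  obtains b where "\<And>j l u. j \<le> 1 \<Longrightarrow> l \<le> 1 \<Longrightarrow> cf j l s u = b j + b (1 - j) * fst u"
proof -
  note h = sec_bihomogeneous[OF openin_points s]
  have reg: "areg UNIV (cf j l s)" if "j \<le> 1" "l \<le> 1" for j l
  proof -
    have "{u. phi j l u \<in> pts} = (UNIV :: ('k \<times> 'k) set)" using phi_in_points[OF that] by blast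
    then show ?thesis using sec_areg_cf[OF openin_points s that] by simp
  qed
  have const: "cf j l s (t, w) = cf j 0 s (t, 0)" if j: "j \<le> 1" and l: "l \<le> 1" for j l t w
  proof -
    obtain p where p: "\<And>w. cf j 0 s (t, w) = poly p w" by (rule areg_UNIV_slice_snd[OF reg[OF j zero_le]]) blast
    obtain q where q: "\<And>w. cf j 1 s (t, w) = poly q w" by (rule areg_UNIV_slice_snd[OF reg[OF j order_refl]]) blast
    have pq: "poly p w = poly q (1 / w)" if "w \<noteq> 0" for w
      using cf_swap_fibre[OF h j, of 0 "(t, w)"] that phi_in_points[OF j zero_le, of "(t, w)"]
      by (simp add: swap_fibre_def p q)
    \<comment> \<open>O(f) has degree 0 along a fibre, so the two coefficients are polynomials with
      p(w) = q(1/w); both are constant.\<close>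
    have "degree q \<le> 0" by (rule degree_le_of_inversion[of p 0 q]) (simp add: pq)
    moreover have "degree p \<le> 0"
      by (rule degree_le_of_inversion[of q 0 p]) (use pq[of "1 / x" for x] in simp)
    ultimately obtain c d where cd: "p = [:c:]" "q = [:d:]" by (metis degree_eq_zeroE le_zero_eq)
    have "c = d" using pq[of 1] by (simp add: cd)
    then show ?thesis using l p q by (elim le_1_cases) (simp_all add: cd)
  qed
  obtain p where p: "\<And>t. cf 0 0 s (t, 0) = poly p t" by (rule areg_UNIV_slice_fst[OF reg[OF zero_le zero_le]]) blast
  obtain q where q: "\<And>t. cf 1 0 s (t, 0) = poly q t" by (rule areg_UNIV_slice_fst[OF reg[OF order_refl zero_le]]) blast
  have pq: "poly p t = t * poly q (1 / t)" if "t \<noteq> 0" for t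
    using cf_swap_base[OF h, of 0 0 "(t, 0)"] that phi_in_points[OF zero_le zero_le, of "(t, 0)"]
    by (simp add: swap_base_def p q)
  have qp: "poly q x = x * poly p (1 / x)" if "x \<noteq> 0" for x
    using pq[of "1 / x"] that by (simp add: field_simps)
  have dp: "degree p \<le> 1" by (rule degree_le_of_inversion[of q 1 p]) (simp add: qp)
  have p': "p = [:coeff p 0, coeff p 1:]"
    by (rule poly_eqI) (use dp in \<open>auto simp: coeff_pCons coeff_eq_0 One_nat_def split: nat.splits\<close>)
  have "monom 1 1 * (q - [:coeff p 1, coeff p 0:]) = 0"
  proof (rule poly_all_0_iff_0[THEN iffD1], rule allI)
    fix x
    show "poly (monom 1 1 * (q - [:coeff p 1, coeff p 0:])) x = 0"
    proof (cases "x = 0")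
      case False
      have "poly p (1 / x) = coeff p 0 + coeff p 1 / x" by (subst p') simp
      then show ?thesis using qp[OF False] False by (simp add: field_simps)
    qed (simp add: poly_monom)
  qed
  moreover have "monom 1 1 \<noteq> (0 :: 'k poly)" by (simp add: monom_eq_0_iff)
  ultimately have q': "q = [:coeff p 1, coeff p 0:]" by simp
  have "cf j l s u = coeff p j + coeff p (1 - j) * fst u" if j: "j \<le> 1" and l: "l \<le> 1" for j l u
  proof -
    have "cf j l s u = cf j 0 s (fst u, 0)" using const[OF j l, of "fst u" "snd u"] by simp
    also have "\<dots> = coeff p j + coeff p (1 - j) * fst u"
      using j
    proof (elim le_1_cases)
      assume "j = 0"
      moreover have "poly p (fst u) = coeff p 0 + coeff p 1 * fst u" by (subst p') simp
      ultimately show ?thesis by (simp add: p)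
    next
      assume "j = 1"
      moreover have "poly q (fst u) = coeff p 1 + coeff p 0 * fst u" by (subst q') simp
      ultimately show ?thesis by (simp add: q)
    qed
    finally show ?thesis .
  qed
  then show ?thesis by (rule that)
qed

text \<open>L is exactly the zero set of a section s: a frame has no zeros, and a local equation of
  a closed set vanishes on that set alone. \<open>global_section_fibre_class\<close> then supplies
  the linear form, which is nonzero because s is.\<close>

lemma linear_system_fibre_class:
  fixes L :: "(nat \<Rightarrow> 'k::{alg_closed_field, field_char_0}) set set"
  assumes L: "L \<in> linear_system X (Osh 0 1)" and closed: "closedin (zar X) L"
  obtains b :: "nat \<Rightarrow> 'k" where "b 0 \<noteq> 0 \<or> b 1 \<noteq> 0"
    "L = {P \<in> pts. \<forall>y\<in>proj P. b 0 * y 0 + b 1 * y 1 = 0}"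
proof -
  let ?S = "Osh 0 1 :: ((nat \<Rightarrow> 'k) set, 'k, (nat \<Rightarrow> 'k) \<Rightarrow> (nat \<Rightarrow> 'k) \<Rightarrow> 'k) mod_sheaf"
  obtain s where s: "s \<in> sec ?S pts" "s \<noteq> act ?S (\<lambda>_. 0) s"
    and frames: "\<forall>p \<in> pts. \<exists>V e g. p \<in> V \<and> local_frame X ?S V e \<and>
              local_equation X L V g \<and> res ?S V s = act ?S g e"
    using L unfolding linear_system_def topspace_X by blast
  obtain b where b: "\<And>j l u. j \<le> 1 \<Longrightarrow> l \<le> 1 \<Longrightarrow> cf j l s u = b j + b (1 - j) * fst u"
    by (rule global_section_fibre_class[OF s(1)]) blast
  have zero: "phi j l u \<in> L \<longleftrightarrow> cf j l s u = 0" if jl: "j \<le> 1" "l \<le> 1" for j l u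
  proof -
    obtain V e g where V: "phi j l u \<in> V" "local_frame X ?S V e" "local_equation X L V g" "res ?S V s = act ?S g e"
      using bspec[OF frames phi_in_points[OF jl, of u]] by (elim exE conjE) (rule that)
    have Vo: "openin (zar X) V" using V(3) by (simp add: local_equation_def)
    have "cf j l (res ?S V s) u = cf j l (act ?S g e) u" using V(4) by simp
    then have val: "cf j l s u = g (phi j l u) * cf j l e u" using V(1) by (simp add: cf_res cf_act)
    define W where "W = {u. phi j l u \<in> V}"
    have W: "aopen W" unfolding W_def by (rule aopen_pullback[OF jl Vo])
    have uW: "u \<in> W" using V(1) by (simp add: W_def)
    have WV: "phi j l ` W \<subseteq> V" by (auto simp: W_def)
    \<comment> \<open>The local section with coefficient 1 is a multiple of the frame e, so the
      coefficient of e cannot vanish at u.\<close>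
    obtain s0 where s0: "s0 \<in> sec ?S (phi j l ` W)" "\<And>u. u \<in> W \<Longrightarrow> cf j l s0 u = 1"
      by (rule exists_sec_of_chart[OF jl areg_const[OF W]]) blast
    have "\<exists>g. reg X (phi j l ` W) g \<and> s0 = act ?S g (res ?S (phi j l ` W) e)"
      using V(2) openin_phi_image[OF jl W] WV s0(1) unfolding local_frame_def by blast
    then obtain g0 where "s0 = act ?S g0 (res ?S (phi j l ` W) e)" by blast
    then have "cf j l s0 u = cf j l (act ?S g0 (res ?S (phi j l ` W) e)) u" by simp
    then have e0: "cf j l e u \<noteq> 0" using s0(2)[OF uW] uW by (auto simp: cf_act cf_res)
    have "g (phi j l u) = 0 \<longleftrightarrow> phi j l u \<in> L"
    proof
      show "g (phi j l u) = 0" if "phi j l u \<in> L" using V(1,3) that unfolding local_equation_def by blast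
      assume g0: "g (phi j l u) = 0"
      show "phi j l u \<in> L"
      proof (rule ccontr)
        assume n: "phi j l u \<notin> L"
        \<comment> \<open>On \<open>V - L\<close> the constant 1 vanishes on L vacuously, so it is
          locally a multiple of g. Closedness of L is what makes this set open.\<close>
        have o: "openin (zar X) (V - L)" by (rule openin_diff[OF Vo closed])
        have "openin (zar X) (V - L) \<and> phi j l u \<in> V - L \<and> V - L \<subseteq> V \<and> reg X (V - L) (\<lambda>_. 1) \<and> (\<forall>x \<in> (V - L) \<inter> L. (1 :: 'k) = 0)"
          using o n V(1) reg_X_const[OF o, of 1] by blast
        then have "\<exists>W' g'. openin (zar X) W' \<and> phi j l u \<in> W' \<and> W' \<subseteq> V - L \<and> reg X W' g' \<and> (\<forall>x\<in>W'. 1 = g' x * g x)"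
          using V(1,3) unfolding local_equation_def by blast
        then show False using g0 by force
      qed
    qed
    then show ?thesis using val e0 by simp
  qed
  show ?thesis
  proof (rule that[of b])
    show "b 0 \<noteq> 0 \<or> b 1 \<noteq> 0"
    proof (rule ccontr)
      assume "\<not> (b 0 \<noteq> 0 \<or> b 1 \<noteq> 0)"
      then have "b j = 0" if "j \<le> 1" for j using that by (elim le_1_cases) auto
      then have c0: "cf j l s u = 0" if "j \<le> 1" "l \<le> 1" for j l u using b[OF that] that by simp
      have z: "act ?S (\<lambda>_. 0) s \<in> sec ?S pts"
        by (rule sec_act[OF openin_points s(1) reg_X_const[OF openin_points]])
      have "s = act ?S (\<lambda>_. 0) s"
        by (rule sec_eqI[OF openin_points sec_bihomogeneous[OF openin_points s(1)] sec_bihomogeneous[OF openin_points z]])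
          (simp add: c0 cf_act)
      then show False using s(2) by blast
    qed
    have LS: "L \<subseteq> pts" using closedin_subset[OF closed] by simp
    have "P \<in> L \<longleftrightarrow> (\<forall>y\<in>proj P. b 0 * y 0 + b 1 * y 1 = 0)" if P: "P \<in> pts" for P
    proof -
      obtain j l where jl: "j \<le> 1" "l \<le> 1" and c: "P \<in> chart j l" by (rule points_covered[OF P])
      obtain u where u: "P = phi j l u" by (rule chart_is_phi[OF jl c])
      show ?thesis unfolding u zero[OF jl] linear_form_on_fibre[OF jl] b[OF jl] ..
    qed
    then show "L = {P \<in> pts. \<forall>y\<in>proj P. b 0 * y 0 + b 1 * y 1 = 0}"
      using LS by blast
  qed
qed

end

theorem proposition4p3:
  fixes a0 a1 a :: nat
    and D :: "(nat \<Rightarrow> 'k::{alg_closed_field, field_char_0}) set set set"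
  assumes "0 < a0" and "a0 \<le> a1"
    and "arrangement (scroll a0 a1) D" and "card D = a"
    and "\<And>L. L \<in> D \<Longrightarrow> proj_line (a0 + a1 + 1) L"
    and "\<And>L. L \<in> D \<Longrightarrow> L \<in> linear_system (scroll a0 a1) (scroll_O a0 a1 0 1)"
    and "a \<ge> (a1 - a0) + 1"
  shows "sheaf_isomorphic (scroll a0 a1)
           (log_1forms (scroll a0 a1) (\<Union>D))
           (direct_sum (scroll_O a0 a1 0 (int a - 2))
                       (scroll_O a0 a1 (- 2) (int a0 + int a1)))"
proof -
  interpret scroll_surface a0 a1 by unfold_locales (use assms in auto)
  have fin: "finite D" using assms(3) by (simp add: arrangement_def)
  \<comment> \<open>The bound on \<open>a\<close> makes it at least 1; the fibre chosen from D
    supplies the form l of the splitting.\<close>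
  have "D \<noteq> {}" using assms(4,7) by auto
  then obtain L1 where L1: "L1 \<in> D" by blast
  have "\<forall>L\<in>D. \<exists>b :: nat \<Rightarrow> 'k. (b 0 \<noteq> 0 \<or> b 1 \<noteq> 0) \<and>
    L = {P \<in> scroll_points a0 a1. \<forall>y\<in>scroll_proj a0 a1 P. b 0 * y 0 + b 1 * y 1 = 0}"
  proof
    fix L assume L: "L \<in> D"
    have "closedin (zar (scroll a0 a1)) L"
      using assms(3) L by (simp add: arrangement_def smooth_irreducible_divisor_def irreducible_closed_def)
    then obtain b :: "nat \<Rightarrow> 'k" where "b 0 \<noteq> 0 \<or> b 1 \<noteq> 0"
      "L = {P \<in> scroll_points a0 a1. \<forall>y\<in>scroll_proj a0 a1 P. b 0 * y 0 + b 1 * y 1 = 0}"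
      by (rule linear_system_fibre_class[OF assms(6)[OF L]])
    then show "\<exists>b :: nat \<Rightarrow> 'k. (b 0 \<noteq> 0 \<or> b 1 \<noteq> 0) \<and>
      L = {P \<in> scroll_points a0 a1. \<forall>y\<in>scroll_proj a0 a1 P. b 0 * y 0 + b 1 * y 1 = 0}"
      by (intro exI[of _ b] conjI)
  qed
  then obtain lf :: "(nat \<Rightarrow> 'k) set set \<Rightarrow> nat \<Rightarrow> 'k" where lf: "\<forall>L\<in>D. (lf L 0 \<noteq> 0 \<or> lf L 1 \<noteq> 0) \<and>
    L = {P \<in> scroll_points a0 a1. \<forall>y\<in>scroll_proj a0 a1 P. lf L 0 * y 0 + lf L 1 * y 1 = 0}"
    by (rule bchoice[THEN exE])
  interpret fibre_arrangement a0 a1 D lf L1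
  proof unfold_locales
    show "finite D" by (rule fin)
    show "L1 \<in> D" by (rule L1)
    show "lf L 0 \<noteq> 0 \<or> lf L 1 \<noteq> 0" if "L \<in> D" for L using bspec[OF lf that] by (rule conjunct1)
    show "L = {P \<in> scroll_points a0 a1. \<forall>y\<in>scroll_proj a0 a1 P. lf L 0 * y 0 + lf L 1 * y 1 = 0}" if "L \<in> D" for L
      using bspec[OF lf that] by (rule conjunct2)
  qed
  show ?thesis using log_forms_isomorphic unfolding assms(4) .
qed

end
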